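(* Let $\mathcal F_{\mathrm{Row}}=\{a\odot M_{I}(k)^{*} : k\geq 3,\ a\in A_k\}\cup\{M_{IV},\overline{M_{IV}},M_{V}^{*},\overline{M_{V}^{*}}\}$. A binary matrix $M$ has the circular-ones property (for rows) if and only if $M$ contains no matrix of $\mathcal F_{\mathrm{Row}}$ as a configuration. Moreover, $\mathcal F_{\mathrm{Row}}$ is a minimal set having this property, and every matrix in $\mathcal F_{\mathrm{Row}}$ is a minimal forbidden submatrix for the circular-ones property.
   Context: All matrices are binary. A matrix has the circular-ones property (for rows) if its columns can be circularly arranged so that the $1$'s of each row occur consecutively in the circular arrangement. $M$ contains $M'$ as a configuration if some submatrix of $M$ equals $M'$ up to permutations of rows and of columns. A matrix is a minimal forbidden submatrix for the circular-ones property if it does not have the property but every submatrix of it different from itself does. $\overline{M}$ is obtained from $M$ by exchanging $0$'s and $1$'s. For a matrix $M$, $M^*$ is obtained by appending one last column consisting entirely of zeros. For a binary sequence $a=a_1\dots a_k$ and a matrix $M$ with $k$ rows, $a\odot M$ is obtained from $M$ by complementing (exchanging $0$ and $1$ in) each row $i$ with $a_i=1$. For $k\geq 3$, $M_I(k)$ is the $k\times k$ matrix whose row $i<k$ has ones exactly in columns $i,i+1$ and whose row $k$ has ones exactly in columns $1$ and $k$. $M_{IV}$ is the $4\times 6$ matrix with rows $(1,1,0,0,0,0),(0,0,1,1,0,0),(0,0,0,0,1,1),(0,1,0,1,0,1)$; $M_V$ is the $4\times5$ matrix with rows $(1,1,0,0,0),(1,1,1,1,0),(0,0,1,1,0),(1,0,0,1,1)$.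 The shift of $a_1a_2\dots a_k$ is $a_2\dots a_ka_1$ and its reversal is $a_k\dots a_1$; a binary bracelet is the lexicographically smallest element of an equivalence class of binary sequences under shifts and reversals. For $k\geq4$, $A_k$ is the set of all binary bracelets of length $k$, and $A_3=\{000,111\}$. *)

theory Defs
  imports "Jordan_Normal_Form.Matrix" "Jordan_Normal_Form.DL_Submatrix"
begin

text \<open>Binary matrices are elements of \<^typ>\<open>bool mat\<close>, with \<^term>\<open>True\<close> for the entry 1;
  rows, columns and sequence positions are numbered from 0.\<close>

text \<open>The columns are arranged around a circle in the order \<open>p 0, p 1, \<dots>, p (n - 1)\<close>. The ones of
  row \<open>i\<close> then have to fill the positions \<open>s, s + 1, \<dots>, s + l - 1\<close> modulo \<open>n\<close>; an
  all-zero row is covered by \<open>l = 0\<close> and an all-one row by \<open>l = n\<close>.\<close>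

definition circular_ones :: "bool mat \<Rightarrow> bool" where
  "circular_ones M \<longleftrightarrow>
    (\<exists>p. p permutes {..<dim_col M} \<and>
      (\<forall>i<dim_row M. \<exists>s l.
        {j. j < dim_col M \<and> M $$ (i, p j)} = (\<lambda>t. (s + t) mod dim_col M) ` {..<l}))"

definition contains_config :: "'a mat \<Rightarrow> 'a mat \<Rightarrow> bool" where
  "contains_config M M' \<longleftrightarrow>
    (\<exists>I J p q. p permutes {..<dim_row M'} \<and> q permutes {..<dim_col M'} \<and>
      submatrix M I J = mat (dim_row M') (dim_col M') (\<lambda>(i, j). M' $$ (p i, q j)))"

definition minimal_forbidden :: "bool mat \<Rightarrow> bool" where
  "minimal_forbidden M \<longleftrightarrow>
    \<not> circular_ones M \<and>
    (\<forall>I J. submatrix M I J \<noteq> M \<longrightarrow> circular_ones (submatrix M I J))"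

definition compl_mat :: "bool mat \<Rightarrow> bool mat" where
  "compl_mat M = map_mat Not M"

definition star_mat :: "bool mat \<Rightarrow> bool mat" where
  "star_mat M = mat (dim_row M) (Suc (dim_col M)) (\<lambda>(i, j). j < dim_col M \<and> M $$ (i, j))"

text \<open>The operation \<open>a \<odot> M\<close>; it is only meant for \<open>length a = dim_row M\<close>.\<close>

definition flip_rows :: "bool list \<Rightarrow> bool mat \<Rightarrow> bool mat" where
  "flip_rows a M = mat (dim_row M) (dim_col M)
    (\<lambda>(i, j). if a ! i then \<not> M $$ (i, j) else M $$ (i, j))"

definition M_I :: "nat \<Rightarrow> bool mat" where
  "M_I k = mat k k (\<lambda>(i, j). if i < k - 1 then j = i \<or> j = i + 1 else j = 0 \<or> j = k - 1)"

definition binary_mat_of_rows :: "nat \<Rightarrow> nat list list \<Rightarrow> bool mat" where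
  "binary_mat_of_rows n rs = map_mat (\<lambda>x. x = 1) (mat_of_rows_list n rs)"

definition M_IV :: "bool mat" where
  "M_IV = binary_mat_of_rows 6
    [[1,1,0,0,0,0],
     [0,0,1,1,0,0],
     [0,0,0,0,1,1],
     [0,1,0,1,0,1]]"

definition M_V :: "bool mat" where
  "M_V = binary_mat_of_rows 5
    [[1,1,0,0,0],
     [1,1,1,1,0],
     [0,0,1,1,0],
     [1,0,0,1,1]]"

definition bracelet_equiv :: "bool list \<Rightarrow> bool list \<Rightarrow> bool" where
  "bracelet_equiv = equivclp (\<lambda>a b. b = rotate1 a \<or> b = rev a)"

text \<open>Sequences are compared lexicographically with \<^prop>\<open>False < True\<close>, that is, with 0 below 1.\<close>

definition bracelet :: "bool list \<Rightarrow> bool" where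
  "bracelet a \<longleftrightarrow> (\<forall>b. bracelet_equiv a b \<longrightarrow> lexordp_eq a b)"

text \<open>The bracelets 001 and 011 are left out for length 3: they would give the same
  configurations as 111 and 000. Only lengths at least 3 are used.\<close>

definition bracelets :: "nat \<Rightarrow> bool list set" where
  "bracelets k =
    (if k = 3 then {[False, False, False], [True, True, True]}
     else {a. length a = k \<and> bracelet a})"

definition F_Row :: "bool mat set" where
  "F_Row =
    {flip_rows a (star_mat (M_I k)) | k a. k \<ge> 3 \<and> a \<in> bracelets k} \<union>
    {M_IV, compl_mat M_IV, star_mat M_V, compl_mat (star_mat M_V)}"

definition characterizes_circular_ones :: "bool mat set \<Rightarrow> bool" where
  "characterizes_circular_ones G \<longleftrightarrow>
    (\<forall>M. circular_ones M \<longleftrightarrow> \<not> (\<exists>F\<in>G. contains_config M F))"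

end

theory Submission
  imports Defs
begin

text \<open>Complementing a row does not affect the circular-ones property, so a row matters only as a
  split of the set of columns. Up to complementation of rows there are two kinds of forbidden
  configurations: the cycles \<open>M_I(k)\<^sup>*\<close>, and the claw consisting of three disjoint pairs of columns
  together with a transversal of these pairs, which is \<open>M_IV\<close>; complementing one of its pairs
  gives \<open>M_V\<^sup>*\<close>.

  Consider a maximal family of splits that contains the rows of a matrix but neither a cycle nor a
  claw. If two of its members \<open>A\<close> and \<open>B\<close> cross, then an obstruction that uses \<open>A \<inter> B\<close> can be turned
  into one that uses \<open>A\<close> or \<open>B\<close> instead; so the family contains \<open>A \<inter> B\<close>. The members avoiding a
  fixed column are then closed under union, intersection and difference of overlapping sets, and,
  since the cycle of length 3 is excluded, no three of them induce the traces \<open>{x, y}\<close>, \<open>{y, z}\<close>,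
  \<open>{x, z}\<close> on three columns. Such a family can be arranged consecutively, by induction on the number of columns:
  take a member that is minimal among those with at least two elements, remove one of its elements
  \<open>x\<close>, and put \<open>x\<close> back next to another element \<open>y\<close> of this member.\<close>

section \<open>Consecutive arrangements\<close>

text \<open>The exchange step has one resource, a point \<open>z\<close> outside both
  \<open>A\<close> and \<open>B\<close>. Families are closed under complement, so a new obstruction
  uses either \<open>A \<inter> B\<close> or its complement \<open>(X - A) \<union> (X - B)\<close>,
  and these need two different exchanges. In both, only one row of the obstruction can be new,
  because its rows induce different splits. The claw enters through the exchange itself: for a cycle
  of length 4, if \<open>z\<close> lies in the middle row of the path only, the rows left over form
  \<open>M_IV\<close>. For k >= 4 the zero column is recognisable, and the flips are determined up
  to rotation and reversal. For k = 3 the rows are the three splits of four columns into two pairs;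
  all four columns are alike, and only the parity of the number of flips survives. This is why
  length 3 is an exception among the bracelets.\<close>

definition consecutive :: "('a \<Rightarrow> real) \<Rightarrow> 'a set \<Rightarrow> 'a set \<Rightarrow> bool" where
  "consecutive f X B \<longleftrightarrow> (\<forall>u\<in>X \<inter> B. \<forall>v\<in>X \<inter> B. \<forall>c\<in>X - B. \<not> (f u < f c \<and> f c < f v))"

lemma consecutiveD:
  "consecutive f X B \<Longrightarrow> u \<in> X \<Longrightarrow> v \<in> X \<Longrightarrow> c \<in> X \<Longrightarrow> u \<in> B \<Longrightarrow> v \<in> B \<Longrightarrow> c \<notin> B
    \<Longrightarrow> f u < f c \<Longrightarrow> f c < f v \<Longrightarrow> False"
  by (auto simp: consecutive_def)

definition overlap :: "'a set \<Rightarrow> 'a set \<Rightarrow> 'a set \<Rightarrow> bool" where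
  "overlap X A B \<longleftrightarrow> X \<inter> A \<inter> B \<noteq> {} \<and> X \<inter> A - B \<noteq> {} \<and> X \<inter> B - A \<noteq> {}"

lemma overlapI:
  "x \<in> X \<Longrightarrow> x \<in> A \<Longrightarrow> x \<in> B \<Longrightarrow> y \<in> X \<Longrightarrow> y \<in> A \<Longrightarrow> y \<notin> B \<Longrightarrow> z \<in> X \<Longrightarrow> z \<notin> A \<Longrightarrow> z \<in> B
    \<Longrightarrow> overlap X A B"
  by (auto simp: overlap_def)

lemma overlap_mono: "overlap Y A B \<Longrightarrow> Y \<subseteq> X \<Longrightarrow> overlap X A B"
  unfolding overlap_def by blast

lemma room_below:
  fixes f :: "'a \<Rightarrow> real" and r :: real
  assumes "finite Y"
  shows "\<exists>t<r. \<forall>u\<in>Y. f u < r \<longrightarrow> f u < t"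
proof (cases "{u \<in> Y. f u < r} = {}")
  case True
  then show ?thesis by (intro exI[of _ "r - 1"]) auto
next
  case False
  define m where "m = Max (f ` {u \<in> Y. f u < r})"
  have fin: "finite (f ` {u \<in> Y. f u < r})" using assms by auto
  have "m \<in> f ` {u \<in> Y. f u < r}" unfolding m_def using fin False by (intro Max_in) auto
  then have "m < r" by auto
  moreover have "f u \<le> m" if "u \<in> Y" "f u < r" for u
    unfolding m_def using fin that by (intro Max_ge) auto
  ultimately show ?thesis by (intro exI[of _ "(m + r) / 2"]) fastforce
qed

text \<open>Positions are real numbers so that there is always a free one directly below that of
  \<open>y\<close>; no other point has to move.\<close>

lemma insert_below:
  fixes f :: "'a \<Rightarrow> real"
  assumes "finite X" and xy: "x \<in> X" "y \<in> X" "x \<noteq> y" and f: "inj_on f (X - {x})"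
  shows "\<exists>g :: 'a \<Rightarrow> real. inj_on g X \<and>
    (\<forall>u v. u \<in> X - {x} \<longrightarrow> v \<in> X - {x} \<longrightarrow> (g u < g v \<longleftrightarrow> f u < f v)) \<and> g x < g y \<and>
    (\<forall>u. u \<in> X - {x} \<longrightarrow> u \<noteq> y \<longrightarrow> (g u < g x \<longleftrightarrow> f u < f y)) \<and>
    (\<forall>u. u \<in> X - {x} \<longrightarrow> u \<noteq> y \<longrightarrow> (g x < g u \<longleftrightarrow> f y < f u))"
proof -
  obtain t where t: "t < f y" "\<forall>u\<in>X - {x}. f u < f y \<longrightarrow> f u < t"
    using room_below[of "X - {x}" "f y" f] assms(1) by auto
  have other: "f u < t \<or> f y < f u" if "u \<in> X - {x}" "u \<noteq> y" for u
    using t that inj_onD[OF f, of u y] xy by (metis Diff_iff linorder_neqE_linordered_idom singletonD)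
  have ne: "f u \<noteq> t" if "u \<in> X - {x}" for u
    using other[OF that] t by force
  have "inj_on (f(x := t)) X" using f ne by (auto simp: inj_on_def)
  moreover have "(f u < t \<longleftrightarrow> f u < f y) \<and> (t < f u \<longleftrightarrow> f y < f u)" if "u \<in> X - {x}" "u \<noteq> y" for u
    using other[OF that] t(1) by auto
  ultimately show ?thesis
    using t(1) xy by (auto intro!: exI[of _ "f(x := t)"])
qed

text \<open>Only traces on \<open>X\<close> enter, and \<open>overlap\<close> is monotone in
  \<open>X\<close>. Hence the hypotheses survive the removal of a point while \<open>F\<close> stays
  the same, which is what the induction needs.\<close>

lemma consecutive_order:
  fixes F :: "'a set set"
  assumes "finite X"
    and un: "\<And>A B. A \<in> F \<Longrightarrow> B \<in> F \<Longrightarrow> overlap X A B \<Longrightarrow> A \<union> B \<in> F"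
    and diff: "\<And>A B. A \<in> F \<Longrightarrow> B \<in> F \<Longrightarrow> overlap X A B \<Longrightarrow> A - B \<in> F"
    and inter: "\<And>A B. A \<in> F \<Longrightarrow> B \<in> F \<Longrightarrow> overlap X A B \<Longrightarrow> A \<inter> B \<in> F"
    and tri: "\<And>x y z A B C. x \<in> X \<Longrightarrow> y \<in> X \<Longrightarrow> z \<in> X \<Longrightarrow> A \<in> F \<Longrightarrow> B \<in> F \<Longrightarrow> C \<in> F \<Longrightarrow>
      x \<in> A \<Longrightarrow> y \<in> A \<Longrightarrow> z \<notin> A \<Longrightarrow> y \<in> B \<Longrightarrow> z \<in> B \<Longrightarrow> x \<notin> B \<Longrightarrow> x \<in> C \<Longrightarrow> z \<in> C \<Longrightarrow> y \<notin> C \<Longrightarrow> False"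
  shows "\<exists>f. inj_on f X \<and> (\<forall>B\<in>F. consecutive f X B)"
  using assms
proof (induction X rule: finite_psubset_induct)
  case (psubset X)
  note un = psubset.prems(1) and diff = psubset.prems(2) and inter = psubset.prems(3)
    and tri = psubset.prems(4)
  show ?case
  proof (cases "\<exists>A\<in>F. card (X \<inter> A) \<ge> 2")
    case False
    obtain f :: "'a \<Rightarrow> nat" where "inj_on f X"
      using finite_imp_inj_to_nat_seg[OF psubset.hyps(1)] by blast
    then have "inj_on (\<lambda>x. real (f x)) X" by (auto simp: inj_on_def)
    moreover have "consecutive (\<lambda>x. real (f x)) X B" if "B \<in> F" for B
    proof -
      have "u = v" if "u \<in> X \<inter> B" "v \<in> X \<inter> B" for u v
      proof (rule ccontr)
        assume "u \<noteq> v"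
        then have "card {u, v} \<le> card (X \<inter> B)"
          using that psubset.hyps(1) by (intro card_mono) auto
        then show False using False \<open>B \<in> F\<close> \<open>u \<noteq> v\<close> by auto
      qed
      then show ?thesis unfolding consecutive_def by (metis order_less_asym)
    qed
    ultimately show ?thesis by blast
  next
    case True
    define A where "A = arg_min (\<lambda>A. card (X \<inter> A)) (\<lambda>A. A \<in> F \<and> card (X \<inter> A) \<ge> 2)"
    have A: "A \<in> F" "card (X \<inter> A) \<ge> 2"
      using True arg_min_natI[of "\<lambda>A. A \<in> F \<and> card (X \<inter> A) \<ge> 2" _ "\<lambda>A. card (X \<inter> A)"]
      unfolding A_def by blast+
    have Amin: "card (X \<inter> A) \<le> card (X \<inter> B)" if "B \<in> F" "card (X \<inter> B) \<ge> 2" for B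
      unfolding A_def using that by (intro arg_min_nat_le) auto
    have small: "u = v" if "B \<in> F" "X \<inter> B \<subset> X \<inter> A" "u \<in> X" "u \<in> B" "v \<in> X" "v \<in> B" for B u v
    proof (rule ccontr)
      assume "u \<noteq> v"
      then have "card {u, v} \<le> card (X \<inter> B)"
        using that psubset.hyps(1) by (intro card_mono) auto
      then have "card (X \<inter> A) \<le> card (X \<inter> B)" using Amin that \<open>u \<noteq> v\<close> by auto
      moreover have "card (X \<inter> B) < card (X \<inter> A)"
        using that psubset.hyps(1) by (intro psubset_card_mono) auto
      ultimately show False by simp
    qed
    have IH: "\<exists>f. inj_on f (X - {x}) \<and> (\<forall>B\<in>F. consecutive f (X - {x}) B)" if "x \<in> X" for x
      apply (rule psubset.IH)
      subgoal using that by auto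
      subgoal for A B using un overlap_mono[of "X - {x}" A B X] by blast
      subgoal for A B using diff overlap_mono[of "X - {x}" A B X] by blast
      subgoal for A B using inter overlap_mono[of "X - {x}" A B X] by blast
      subgoal for u v w A B C by (rule tri[of u v w A B C]) auto
      done
    show ?thesis
    proof (cases "\<exists>B\<in>F. overlap X A B")
      case False
      have "\<not> card (X \<inter> A) \<le> Suc 0" using A(2) by linarith
      then obtain x y where xy: "x \<in> X \<inter> A" "y \<in> X \<inter> A" "x \<noteq> y"
        using psubset.hyps(1) card_le_Suc0_iff_eq[of "X \<inter> A"] by auto
      obtain f where f: "inj_on f (X - {x})" "\<forall>B\<in>F. consecutive f (X - {x}) B"
        using IH xy by blast
      obtain g :: "'a \<Rightarrow> real" where g0: "inj_on g X"
        "\<forall>u v. u \<in> X - {x} \<longrightarrow> v \<in> X - {x} \<longrightarrow> (g u < g v \<longleftrightarrow> f u < f v)" "g x < g y"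
        "\<forall>u. u \<in> X - {x} \<longrightarrow> u \<noteq> y \<longrightarrow> (g u < g x \<longleftrightarrow> f u < f y)"
        "\<forall>u. u \<in> X - {x} \<longrightarrow> u \<noteq> y \<longrightarrow> (g x < g u \<longleftrightarrow> f y < f u)"
        using insert_below[OF psubset.hyps(1) IntD1[OF xy(1)] IntD1[OF xy(2)] xy(3) f(1)] by blast
      note g = g0[rule_format]
      have "consecutive g X B" if B: "B \<in> F" for B
      proof -
        \<comment> \<open>Without overlaps, \<open>x\<close> and \<open>y\<close> are twins: a
          member containing just one of them has its trace properly inside that of \<open>A\<close>,
          so it has at most one point.\<close>
        have same: "x \<in> B \<longleftrightarrow> y \<in> B" if "u \<in> X" "u \<in> B" "v \<in> X" "v \<in> B" "u \<noteq> v" for u v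
        proof (rule ccontr)
          assume "(x \<in> B) \<noteq> (y \<in> B)"
          then have "X \<inter> B \<subset> X \<inter> A"
            using False B xy unfolding overlap_def by blast
          then show False using small[OF B] that by blast
        qed
        have cf: "consecutive f (X - {x}) B" using f B by blast
        have False if u: "u \<in> X" "u \<in> B" and v: "v \<in> X" "v \<in> B" and c: "c \<in> X" "c \<notin> B"
          and lt: "g u < g c" "g c < g v" for u v c
        proof -
          have "u \<noteq> v" using lt by auto
          have s: "x \<in> B \<longleftrightarrow> y \<in> B" using same[OF u v \<open>u \<noteq> v\<close>] .
          \<comment> \<open>Collapsing \<open>x\<close> onto its twin \<open>y\<close> turns a
            violation for \<open>g\<close> into one for \<open>f\<close>.\<close>
          define h where "h = (\<lambda>w. if w = x then y else w)"
          have hB: "h w \<in> B \<longleftrightarrow> w \<in> B" for w using s by (auto simp: h_def)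
          have hX: "h w \<in> X - {x}" if "w \<in> X" for w using that xy by (auto simp: h_def)
          have "f (h u) < f (h c)" if "u \<in> X" "c \<in> X" "g u < g c" "(u \<in> B) \<noteq> (c \<in> B)" for u c
            using that g(2)[of u c] g(4)[of u] g(5)[of c] s xy unfolding h_def
            by (auto split: if_splits)
          then have "f (h u) < f (h c)" "f (h c) < f (h v)" using u v c lt by auto
          then show False
            using consecutiveD[OF cf, of "h u" "h v" "h c"] hB hX u v c by blast
        qed
        then show ?thesis unfolding consecutive_def by blast
      qed
      then show ?thesis using g(1) by blast
    next
      case True
      then obtain B0 where B0: "B0 \<in> F" "overlap X A B0" by blast
      then obtain x y where x: "x \<in> X" "x \<in> A" "x \<notin> B0" and y: "y \<in> X" "y \<in> A" "y \<in> B0"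
        unfolding overlap_def by blast
      have ov': "overlap X B0 A" using B0(2) unfolding overlap_def by blast
      \<comment> \<open>Minimality of \<open>A\<close> makes each of the two pieces a single point,
        so \<open>A\<close> has the trace \<open>{x, y}\<close>.\<close>
      have "X \<inter> (A - B0) \<subset> X \<inter> A" "X \<inter> (A \<inter> B0) \<subset> X \<inter> A" using x y by auto
      note small' = small[OF diff[OF A(1) B0] this(1)] small[OF inter[OF A(1) B0] this(2)]
      have onlyx: "u = x" if "u \<in> X" "u \<in> A" "u \<notin> B0" for u
        using small'(1)[of u x] x that by blast
      have onlyy: "u = y" if "u \<in> X" "u \<in> A" "u \<in> B0" for u
        using small'(2)[of u y] y that by blast
      have A_eq: "u \<in> A \<longleftrightarrow> u = x \<or> u = y" if "u \<in> X" for u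
        using onlyx onlyy x y that by blast
      have "x \<noteq> y" using x y by auto
      have B0A: "B0 - A \<in> F" using diff[OF B0(1) A(1) ov'] .
      \<comment> \<open>As \<open>B0 - A\<close> is consecutive and misses \<open>y\<close>, it lies
        on one side of \<open>y\<close>; reflecting the order puts it above. The point
        \<open>x\<close>, which is not in \<open>B0\<close>, can then go directly below
        \<open>y\<close>.\<close>
      have "\<exists>f. inj_on f (X - {x}) \<and> (\<forall>B\<in>F. consecutive f (X - {x}) B) \<and>
          (\<forall>z\<in>X \<inter> B0 - A. f y < f z)"
      proof -
        obtain f where f: "inj_on f (X - {x})" "\<forall>B\<in>F. consecutive f (X - {x}) B"
          using IH x by blast
        have side: "\<not> (f u < f y \<and> f y < f v)" if "u \<in> X \<inter> B0 - A" "v \<in> X \<inter> B0 - A" for u v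
          using consecutiveD[of f "X - {x}" "B0 - A" u v y] f(2) B0A that x y \<open>x \<noteq> y\<close> by auto
        have ne: "f u \<noteq> f y" if "u \<in> X \<inter> B0 - A" for u
          using inj_onD[OF f(1), of u y] that x y \<open>x \<noteq> y\<close> by auto
        show ?thesis
        proof (cases "\<forall>z\<in>X \<inter> B0 - A. f y < f z")
          case True
          then show ?thesis using f by blast
        next
          case False
          then obtain u where u: "u \<in> X \<inter> B0 - A" "f u < f y" using ne
            by (meson linorder_neqE_linordered_idom)
          have "\<forall>z\<in>X \<inter> B0 - A. f z < f y" using side[OF u(1)] u(2) ne
            by (meson linorder_neqE_linordered_idom)
          moreover have "inj_on (\<lambda>u. - f u) (X - {x})" using f(1) by (auto simp: inj_on_def)
          moreover have "\<forall>B\<in>F. consecutive (\<lambda>u. - f u) (X - {x}) B"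
            using f(2) unfolding consecutive_def by (auto; blast)
          ultimately show ?thesis by (intro exI[of _ "\<lambda>u. - f u"]) auto
        qed
      qed
      then obtain f where f: "inj_on f (X - {x})" "\<forall>B\<in>F. consecutive f (X - {x}) B"
        and right: "\<And>z. z \<in> X \<Longrightarrow> z \<in> B0 \<Longrightarrow> z \<notin> A \<Longrightarrow> f y < f z" by blast
      obtain z where z: "z \<in> X" "z \<in> B0" "z \<notin> A" using B0(2) unfolding overlap_def by blast
      have yz: "f y < f z" using right z .
      obtain g :: "'a \<Rightarrow> real" where g0: "inj_on g X"
        "\<forall>u v. u \<in> X - {x} \<longrightarrow> v \<in> X - {x} \<longrightarrow> (g u < g v \<longleftrightarrow> f u < f v)" "g x < g y"
        "\<forall>u. u \<in> X - {x} \<longrightarrow> u \<noteq> y \<longrightarrow> (g u < g x \<longleftrightarrow> f u < f y)"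
        "\<forall>u. u \<in> X - {x} \<longrightarrow> u \<noteq> y \<longrightarrow> (g x < g u \<longleftrightarrow> f y < f u)"
        using insert_below[OF psubset.hyps(1) x(1) y(1) \<open>x \<noteq> y\<close> f(1)] by blast
      note g = g0[rule_format]
      have "consecutive g X B" if B: "B \<in> F" for B
      proof -
        have cf: False if "B' \<in> F" "u \<in> X - {x}" "v \<in> X - {x}" "c \<in> X - {x}" "u \<in> B'" "v \<in> B'" "c \<notin> B'"
          "f u < f c" "f c < f v" for B' u v c
          using consecutiveD[of f "X - {x}" B'] f(2) that by blast
        have yX: "y \<in> X - {x}" using y \<open>x \<noteq> y\<close> by blast
        have zX: "z \<in> X - {x}" using x z by blast
        have False if u: "u \<in> X" "u \<in> B" and v: "v \<in> X" "v \<in> B" and c: "c \<in> X" "c \<notin> B"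
          and lt: "g u < g c" "g c < g v" for u v c
        proof -
          have diffs: "u \<noteq> v" "u \<noteq> c" "v \<noteq> c" using lt c u v by auto
          consider "u \<noteq> x" "v \<noteq> x" "c \<noteq> x" | "c = x" | "u = x" | "v = x" by blast
          then show False
          proof cases
            case 1
            then show False using cf[OF B, of u v c] g(2) u v c lt by auto
          next
            case 2
            have uX: "u \<in> X - {x}" and vX: "v \<in> X - {x}" using u v c 2 by auto
            have uy': "u \<noteq> y" using lt 2 g(3) by auto
            then have uy: "f u < f y" "u \<noteq> y" using g(4)[OF uX] lt 2 by auto
            have yB: "y \<in> B"
            proof (rule ccontr)
              assume "y \<notin> B"
              then have "v \<noteq> y" using v by auto
              then have "f y < f v" using g(5)[OF vX] lt 2 by auto
              then show False using cf[OF B uX vX yX] u v uy \<open>y \<notin> B\<close> by auto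
            qed
            have uA: "u \<notin> A" using A_eq u uy uX by blast
            show False
            proof (cases "z \<in> B")
              case True
              have "overlap X B A"
                using overlapI[of y X B A u x] y yB u uA x 2 c by blast
              from diff[OF B A(1) this] show False
                using cf[of "B - A" u z y] uX zX yX u uA z True y uy yz by blast
            next
              case False
              have "u \<notin> B0" using right[OF u(1) _ uA] uy by force
              \<comment> \<open>The members \<open>A\<close>, \<open>B0\<close> and
                \<open>A \<union> B0 - B\<close> have the forbidden traces on \<open>x\<close>,
                \<open>y\<close>, \<open>z\<close>.\<close>
              have "overlap X (A \<union> B0) B"
                using overlapI[of y X "A \<union> B0" B x u] x y u yB c 2 uA \<open>u \<notin> B0\<close> by blast
              from diff[OF un[OF A(1) B0] B this] have "A \<union> B0 - B \<in> F" .
              from tri[OF x(1) y(1) z(1) A(1) B0(1) this] show False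
                using x y z yB c 2 False by blast
            qed
          next
            case 3
            have vX: "v \<in> X - {x}" and cX: "c \<in> X - {x}" using diffs v c 3 by auto
            have cv: "f c < f v" using g(2)[OF cX vX] lt by auto
            have ycv: "f y < f c \<or> c = y" using g(5)[OF cX] lt 3 by auto
            have yv: "f y < f v" "v \<noteq> y" using ycv cv by auto
            show False
            proof (cases "y \<in> B")
              case True
              then show False using cf[OF B yX vX cX] ycv cv v c by blast
            next
              case False
              have vA: "v \<notin> A" using A_eq v yv vX by blast
              have "overlap X A B" using overlapI[of x X A B y v] x y v vA u 3 False by blast
              note UN = un[OF A(1) B this]
              show False
              proof (cases "c = y")
                case False
                then have "c \<notin> A \<union> B" using A_eq c cX by blast
                then show False using cf[OF UN yX vX cX] ycv cv v y False by blast
              next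
                case True
                show False
                proof (cases "z \<in> B")
                  case True
                  then show False using tri[OF x(1) y(1) z(1) A(1) B0(1) B] x y z u 3 \<open>y \<notin> B\<close> by blast
                next
                  \<comment> \<open>Since \<open>A \<union> B\<close> is consecutive,
                    \<open>z\<close> is not between \<open>y\<close> and \<open>v\<close>. So
                    \<open>v\<close> is between \<open>y\<close> and \<open>z\<close>, hence in
                    \<open>B0\<close>, and the forbidden triple is \<open>x\<close>,
                    \<open>y\<close>, \<open>v\<close>.\<close>
                  case zB: False
                  have "\<not> f z < f v" using cf[OF UN yX vX zX] y v z zB yz by blast
                  moreover have "v \<noteq> z" using v zB by auto
                  ultimately have "f v < f z"
                    using inj_onD[OF f(1), of v z] vX zX by (meson linorder_neqE_linordered_idom)
                  then have "v \<in> B0" using cf[OF B0(1) yX zX vX] yv y z by blast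
                  then show False using tri[OF x(1) y(1) v(1) A(1) B0(1) B] x y v vA u 3 \<open>y \<notin> B\<close> by blast
                qed
              qed
            qed
          next
            case 4
            have uX: "u \<in> X - {x}" and cX: "c \<in> X - {x}" using diffs u c 4 by auto
            have uc: "f u < f c" using g(2)[OF uX cX] lt by auto
            have cy: "c \<noteq> y" using lt 4 g(3) by auto
            then have cy': "f c < f y" using g(4)[OF cX] lt 4 by auto
            have uA: "u \<notin> A" using A_eq u uc cy' uX by force
            show False
            proof (cases "y \<in> B")
              case True
              then show False using cf[OF B uX yX cX] uc cy' u c by blast
            next
              case False
              have "overlap X A B" using overlapI[of x X A B y u] x y u uA v 4 False by blast
              moreover have "c \<notin> A \<union> B" using A_eq c cX cy by blast
              ultimately show False using cf[OF un[OF A(1) B] uX yX cX] uc cy' u y by blast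
            qed
          qed
        qed
        then show ?thesis unfolding consecutive_def by blast
      qed
      then show ?thesis using g(1) by blast
    qed
  qed
qed

section \<open>Cycles and claws\<close>

definition separates :: "'a set \<Rightarrow> 'a set \<Rightarrow> 'a set \<Rightarrow> bool" where
  "separates R U V \<longleftrightarrow> (U \<subseteq> R \<and> V \<inter> R = {}) \<or> (V \<subseteq> R \<and> U \<inter> R = {})"

text \<open>The point \<open>q\<close> is the zero column of \<open>M_I(k)*\<close>, and a row is
  read as its side away from \<open>q\<close>, hence up to complement. The pattern itself forces all
  these points to be distinct.\<close>

definition has_cycle :: "'a set \<Rightarrow> 'a set set \<Rightarrow> bool" where
  "has_cycle X S \<longleftrightarrow> (\<exists>k p q. 3 \<le> k \<and> (\<forall>i<k. p i \<in> X) \<and> q \<in> X \<and>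
    (\<forall>i<k. \<exists>R\<in>S. \<forall>j<k. (p j \<in> R \<longleftrightarrow> q \<notin> R) \<longleftrightarrow> j = i \<or> j = Suc i mod k))"

definition has_claw :: "'a set \<Rightarrow> 'a set set \<Rightarrow> bool" where
  "has_claw X S \<longleftrightarrow> (\<exists>a a' b b' c c'. {a, a', b, b', c, c'} \<subseteq> X \<and>
    (\<exists>R\<in>S. separates R {a, a'} {b, b', c, c'}) \<and> (\<exists>R\<in>S. separates R {b, b'} {a, a', c, c'}) \<and>
    (\<exists>R\<in>S. separates R {c, c'} {a, a', b, b'}) \<and> (\<exists>R\<in>S. separates R {a, b, c} {a', b', c'}))"

locale obstruction_free =
  fixes X :: "'a set" and S :: "'a set set"
  assumes sub: "R \<in> S \<Longrightarrow> R \<subseteq> X"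
    and compl: "R \<in> S \<Longrightarrow> X - R \<in> S"
    and no_cycle: "\<not> has_cycle X S"
    and no_claw: "\<not> has_claw X S"
begin

lemma clawD:
  assumes "Ra \<in> S" "Rb \<in> S" "Rc \<in> S" "T \<in> S" "{a, a', b, b', c, c'} \<subseteq> X"
    "separates Ra {a, a'} {b, b', c, c'}" "separates Rb {b, b'} {a, a', c, c'}"
    "separates Rc {c, c'} {a, a', b, b'}" "separates T {a, b, c} {a', b', c'}"
  shows False
  using no_claw assms unfolding has_claw_def by blast

text \<open>The form in which cycles are found inside longer ones: the \<open>R l\<close> run along
  a stretch of a path, \<open>A\<close> closes it, and \<open>q\<close> is the zero column.\<close>

lemma path_cycleD:
  assumes ij: "i + 2 \<le> j" and X: "\<And>t. i \<le> t \<Longrightarrow> t \<le> j \<Longrightarrow> w t \<in> X" "q \<in> X"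
    and R: "\<And>l. i \<le> l \<Longrightarrow> l < j \<Longrightarrow> R l \<in> S" "\<And>l. i \<le> l \<Longrightarrow> l < j \<Longrightarrow> q \<notin> R l"
    "\<And>l t. i \<le> l \<Longrightarrow> l < j \<Longrightarrow> i \<le> t \<Longrightarrow> t \<le> j \<Longrightarrow> w t \<in> R l \<longleftrightarrow> t = l \<or> t = Suc l"
    and A: "A \<in> S" "q \<notin> A" "\<And>t. i \<le> t \<Longrightarrow> t \<le> j \<Longrightarrow> w t \<in> A \<longleftrightarrow> t = i \<or> t = j"
  shows False
proof -
  define k where "k = Suc (j - i)"
  have "\<exists>R\<in>S. \<forall>t<k. (w (i + t) \<in> R \<longleftrightarrow> q \<notin> R) \<longleftrightarrow> t = l \<or> t = Suc l mod k" if "l < k" for l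
  proof (cases "Suc l = k")
    case True
    then have "\<forall>t<k. (w (i + t) \<in> A \<longleftrightarrow> q \<notin> A) \<longleftrightarrow> t = l \<or> t = Suc l mod k"
      using A ij unfolding k_def by auto
    then show ?thesis using A by blast
  next
    case False
    then have "Suc l mod k = Suc l" using that by simp
    then have "\<forall>t<k. (w (i + t) \<in> R (i + l) \<longleftrightarrow> q \<notin> R (i + l)) \<longleftrightarrow> t = l \<or> t = Suc l mod k"
      using R(2)[of "i + l"] R(3)[of "i + l"] ij that False unfolding k_def by auto
    moreover have "R (i + l) \<in> S" using R(1)[of "i + l"] ij that False unfolding k_def by auto
    ultimately show ?thesis by blast
  qed
  moreover have "3 \<le> k" "\<forall>t<k. w (i + t) \<in> X" using ij X unfolding k_def by auto
  ultimately have "has_cycle X S" using X(2) unfolding has_cycle_def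
    by (intro exI[of _ k] exI[of _ "\<lambda>t. w (i + t)"] exI[of _ q]) simp
  then show False using no_cycle by simp
qed

text \<open>For k = 3 the rows are the three splits of four points into two pairs, so any of the
  four points can serve as zero column.\<close>

lemma triangleD:
  assumes "A \<in> S" "B \<in> S" "C \<in> S" "{x, y, z, q} \<subseteq> X"
    "separates A {x, y} {z, q}" "separates B {y, z} {x, q}" "separates C {x, z} {y, q}"
  shows False
proof -
  define p where "p = (\<lambda>i::nat. if i = 0 then x else if i = 1 then y else z)"
  have lt3: "i < 3 \<longleftrightarrow> i = 0 \<or> i = 1 \<or> i = 2" for i :: nat by auto
  have "\<forall>i<3. \<exists>R\<in>S. \<forall>j<3. (p j \<in> R \<longleftrightarrow> q \<notin> R) \<longleftrightarrow> j = i \<or> j = Suc i mod 3"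
  proof (intro allI impI)
    fix i :: nat assume "i < 3"
    then consider "i = 0" | "i = 1" | "i = 2" by linarith
    then show "\<exists>R\<in>S. \<forall>j<3. (p j \<in> R \<longleftrightarrow> q \<notin> R) \<longleftrightarrow> j = i \<or> j = Suc i mod 3"
    proof cases
      case 1
      then show ?thesis using assms(1,5) unfolding lt3 separates_def p_def by (intro bexI[of _ A]) auto
    next
      case 2
      then show ?thesis using assms(2,6) unfolding lt3 separates_def p_def by (intro bexI[of _ B]) auto
    next
      case 3
      then show ?thesis using assms(3,7) unfolding lt3 separates_def p_def by (intro bexI[of _ C]) auto
    qed
  qed
  moreover have "\<forall>i<3. p i \<in> X" using assms(4) by (auto simp: p_def)
  ultimately show False using no_cycle assms(4) unfolding has_cycle_def by blast
qed

lemma squareD: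
  assumes "A \<in> S" "B \<in> S" "C \<in> S" "D \<in> S" "{w, x, y, z, q} \<subseteq> X"
    "separates A {w, x} {y, z, q}" "separates B {x, y} {w, z, q}"
    "separates C {y, z} {w, x, q}" "separates D {w, z} {x, y, q}"
  shows False
proof -
  define p where "p = (\<lambda>i::nat. if i = 0 then w else if i = 1 then x else if i = 2 then y else z)"
  have lt4: "i < 4 \<longleftrightarrow> i = 0 \<or> i = 1 \<or> i = 2 \<or> i = 3" for i :: nat by auto
  have "\<forall>i<4. \<exists>R\<in>S. \<forall>j<4. (p j \<in> R \<longleftrightarrow> q \<notin> R) \<longleftrightarrow> j = i \<or> j = Suc i mod 4"
  proof (intro allI impI)
    fix i :: nat assume "i < 4"
    then consider "i = 0" | "i = 1" | "i = 2" | "i = 3" by linarith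
    then show "\<exists>R\<in>S. \<forall>j<4. (p j \<in> R \<longleftrightarrow> q \<notin> R) \<longleftrightarrow> j = i \<or> j = Suc i mod 4"
    proof cases
      case 1
      then show ?thesis using assms(1,6) unfolding lt4 separates_def p_def by (intro bexI[of _ A]) auto
    next
      case 2
      then show ?thesis using assms(2,7) unfolding lt4 separates_def p_def by (intro bexI[of _ B]) auto
    next
      case 3
      then show ?thesis using assms(3,8) unfolding lt4 separates_def p_def by (intro bexI[of _ C]) auto
    next
      case 4
      then show ?thesis using assms(4,9) unfolding lt4 separates_def p_def by (intro bexI[of _ D]) auto
    qed
  qed
  moreover have "\<forall>i<4. p i \<in> X" using assms(5) by (auto simp: p_def)
  moreover have "(3::nat) \<le> 4" by simp
  ultimately show False using no_cycle assms(5) unfolding has_cycle_def by blast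
qed

end

section \<open>Exchange in cycles that use a union or an intersection\<close>

lemma nearest_gap:
  fixes a b l :: nat
  assumes "P a" "P b" "a < l" "l < b" "\<not> P l"
  obtains i j where "a \<le> i" "i < l" "l < j" "j \<le> b" "P i" "P j" "\<And>m. i < m \<Longrightarrow> m < j \<Longrightarrow> \<not> P m"
proof -
  define i where "i = Max {m. m < l \<and> P m}"
  have fin: "finite {m. m < l \<and> P m}" "{m. m < l \<and> P m} \<noteq> {}" using assms by auto
  have i: "i < l" "P i" using Max_in[OF fin] unfolding i_def by auto
  have imax: "m \<le> i" if "m < l" "P m" for m using fin that unfolding i_def by simp
  define j where "j = (LEAST m. l < m \<and> P m)"
  have j: "l < j" "P j" using LeastI[of "\<lambda>m. l < m \<and> P m" b] assms unfolding j_def by auto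
  have jmin: "j \<le> m" if "l < m" "P m" for m unfolding j_def using that by (simp add: Least_le)
  show thesis
  proof (rule that[of i j])
    fix m assume "i < m" "m < j"
    then show "\<not> P m" using imax[of m] jmin[of m] assms(5) by (metis leD linorder_neqE_nat)
  qed (use i j imax[OF assms(3,1)] jmin[OF assms(4,2)] in auto)
qed

context obstruction_free
begin

text \<open>A cycle through the split \<open>A \<union> B\<close> with trace \<open>{v 1, v k}\<close> is opened at this split and closed
  through \<open>z \<in> A \<inter> B\<close>: with \<open>R' 0 = B\<close> and \<open>R' k = A\<close>, two successive indices \<open>i + 1 < j\<close> whose sets
  contain \<open>z\<close> yield the cycle \<open>z, v (i + 1), \<dots>, v j\<close>. If all \<open>R' l\<close> contain \<open>z\<close>, then \<open>R' 0, \<dots>, R' 3\<close>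
  form a cycle of length 4.\<close>

lemma union_cycle_aux:
  assumes AB: "A \<in> S" "B \<in> S" and z: "z \<in> X" "z \<in> A" "z \<in> B" and k: "3 \<le> k"
    and v: "\<And>t. 1 \<le> t \<Longrightarrow> t \<le> k \<Longrightarrow> v t \<in> X" and q: "q \<in> X" "q \<notin> A" "q \<notin> B"
    and R: "\<And>l. 1 \<le> l \<Longrightarrow> l < k \<Longrightarrow> R l \<in> S" "\<And>l. 1 \<le> l \<Longrightarrow> l < k \<Longrightarrow> q \<notin> R l"
    "\<And>l t. 1 \<le> l \<Longrightarrow> l < k \<Longrightarrow> 1 \<le> t \<Longrightarrow> t \<le> k \<Longrightarrow> v t \<in> R l \<longleftrightarrow> t = l \<or> t = Suc l"
    and A: "\<And>t. 1 \<le> t \<Longrightarrow> t \<le> k \<Longrightarrow> v t \<in> A \<longleftrightarrow> t = k"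
    and B: "\<And>t. 1 \<le> t \<Longrightarrow> t \<le> k \<Longrightarrow> v t \<in> B \<longleftrightarrow> t = 1"
  shows False
proof -
  define R' where "R' = R(0 := B, k := A)"
  have R': "R' l \<in> S" "q \<notin> R' l" if "l \<le> k" for l
    using R(1,2)[of l] that AB q unfolding R'_def by auto
  have vR': "v t \<in> R' l \<longleftrightarrow> t = l \<or> t = Suc l" if "l \<le> k" "1 \<le> t" "t \<le> k" for l t
    using R(3)[of l t] that A[of t] B[of t] k unfolding R'_def by auto
  have ends: "z \<in> R' 0" "z \<in> R' k" using z k unfolding R'_def by auto
  show False
  proof (cases "\<exists>l. 0 < l \<and> l < k \<and> z \<notin> R' l")
    case True
    then obtain l where l: "0 < l" "l < k" "z \<notin> R' l" by blast
    obtain i j where ij: "i < l" "l < j" "j \<le> k" "z \<in> R' i" "z \<in> R' j"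
      "\<And>m. i < m \<Longrightarrow> m < j \<Longrightarrow> z \<notin> R' m"
      using nearest_gap[of "\<lambda>l. z \<in> R' l" 0 k l] ends l by metis
    show False
    proof (rule path_cycleD[of i j "v(i := z)" q R' "R' j"])
      show "(v(i := z)) t \<in> R' l \<longleftrightarrow> t = l \<or> t = Suc l" if "i \<le> l" "l < j" "i \<le> t" "t \<le> j" for l t
        using that ij vR'[of l t] by (cases "t = i"; cases "l = i") auto
      show "(v(i := z)) t \<in> R' j \<longleftrightarrow> t = i \<or> t = j" if "i \<le> t" "t \<le> j" for t
        using that ij vR'[of j t] by auto
    qed (use ij R' z v q in auto)
  next
    case False
    then have "z \<in> R' l" if "l \<le> k" for l using that ends by (metis le_neq_implies_less neq0_conv)
    then have zR: "z \<in> R' 0" "z \<in> R' 1" "z \<in> R' 2" "z \<in> R' 3" using k by auto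
    have vR: "v 1 \<in> R' 0" "v 2 \<notin> R' 0" "v 3 \<notin> R' 0" "v 1 \<in> R' 1" "v 2 \<in> R' 1" "v 3 \<notin> R' 1"
      "v 1 \<notin> R' 2" "v 2 \<in> R' 2" "v 3 \<in> R' 2" "v 1 \<notin> R' 3" "v 2 \<notin> R' 3" "v 3 \<in> R' 3"
      using k by (simp_all add: vR')
    have RS: "R' 0 \<in> S" "R' 1 \<in> S" "R' 2 \<in> S" "R' 3 \<in> S" "q \<notin> R' 0" "q \<notin> R' 1" "q \<notin> R' 2" "q \<notin> R' 3"
      using k R' by simp_all
    have vX: "v 1 \<in> X" "v 2 \<in> X" "v 3 \<in> X" using v k by auto
    \<comment> \<open>Here the roles change: \<open>v 2\<close> becomes the zero column and
      \<open>v 1, z, v 3, q\<close> the cycle, with rows in the order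
      \<open>R' 0, R' 3, R' 1, R' 2\<close>.\<close>
    show False
      by (rule squareD[of "R' 0" "R' 3" "R' 1" "R' 2" "v 1" z "v 3" q "v 2"])
        (use zR vR RS vX q(1) z(1) in \<open>auto simp: separates_def\<close>)
  qed
qed

text \<open>If \<open>A\<close> or \<open>B\<close> contains both ends of the path, it closes the
  path alone. Otherwise each of them contains exactly one end.\<close>

lemma union_cycle:
  assumes AB: "A \<in> S" "B \<in> S" and z: "z \<in> X" "z \<in> A" "z \<in> B" and k: "3 \<le> k"
    and v: "\<And>t. 1 \<le> t \<Longrightarrow> t \<le> k \<Longrightarrow> v t \<in> X" and q: "q \<in> X" "q \<notin> A \<union> B"
    and R: "\<And>l. 1 \<le> l \<Longrightarrow> l < k \<Longrightarrow> R l \<in> S" "\<And>l. 1 \<le> l \<Longrightarrow> l < k \<Longrightarrow> q \<notin> R l"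
    "\<And>l t. 1 \<le> l \<Longrightarrow> l < k \<Longrightarrow> 1 \<le> t \<Longrightarrow> t \<le> k \<Longrightarrow> v t \<in> R l \<longleftrightarrow> t = l \<or> t = Suc l"
    and D: "\<And>t. 1 \<le> t \<Longrightarrow> t \<le> k \<Longrightarrow> v t \<in> A \<union> B \<longleftrightarrow> t = 1 \<or> t = k"
  shows False
proof -
  have closing: False if C: "C \<in> S" "C = A \<or> C = B" "v 1 \<in> C" "v k \<in> C" for C
  proof -
    have "v t \<in> C \<longleftrightarrow> t = 1 \<or> t = k" if "1 \<le> t" "t \<le> k" for t
      using D[OF that] C by blast
    then show False
      by (intro path_cycleD[of 1 k v q R C]) (use C k v q R in auto)
  qed
  have ends: "v 1 \<in> A \<union> B" "v k \<in> A \<union> B" using D[of 1] D[of k] k by auto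
  consider "v 1 \<in> B" "v 1 \<notin> A" "v k \<in> A" "v k \<notin> B" | "v 1 \<in> A" "v 1 \<notin> B" "v k \<in> B" "v k \<notin> A"
    using closing[OF AB(1)] closing[OF AB(2)] ends by blast
  then show False
  proof cases
    case 1
    have "v t \<in> A \<longleftrightarrow> t = k" "v t \<in> B \<longleftrightarrow> t = 1" if "1 \<le> t" "t \<le> k" for t
      using D[OF that] 1 by blast+
    then show False using union_cycle_aux[OF AB z k v q(1) _ _ R] q by blast
  next
    case 2
    have "v t \<in> B \<longleftrightarrow> t = k" "v t \<in> A \<longleftrightarrow> t = 1" if "1 \<le> t" "t \<le> k" for t
      using D[OF that] 2 by blast+
    then show False using union_cycle_aux[OF AB(2,1) z(1,3,2) k v q(1) _ _ R] q by blast
  qed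
qed

text \<open>If \<open>l\<close> is the largest index with \<open>z \<in> R l\<close>, then \<open>q, z, v (l + 1), \<dots>, v k\<close> is a cycle with rows
  \<open>X - A, R l, \<dots>, R (k - 1), B\<close>; for \<open>l \<ge> 3\<close> none of them contains \<open>v 2\<close>.\<close>

lemma inter_cycle_long:
  assumes AB: "A \<in> S" "B \<in> S" and z: "z \<in> X" "z \<notin> A" "z \<notin> B"
    and v: "\<And>t. 1 \<le> t \<Longrightarrow> t \<le> k \<Longrightarrow> v t \<in> X" and q: "q \<in> X" "q \<notin> A" "q \<in> B"
    and R: "\<And>l. 1 \<le> l \<Longrightarrow> l < k \<Longrightarrow> R l \<in> S" "\<And>l. 1 \<le> l \<Longrightarrow> l < k \<Longrightarrow> q \<notin> R l"
    "\<And>l t. 1 \<le> l \<Longrightarrow> l < k \<Longrightarrow> 1 \<le> t \<Longrightarrow> t \<le> k \<Longrightarrow> v t \<in> R l \<longleftrightarrow> t = l \<or> t = Suc l"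
    and A: "\<And>t. 1 \<le> t \<Longrightarrow> t \<le> k \<Longrightarrow> v t \<in> A"
    and B: "\<And>t. 1 \<le> t \<Longrightarrow> t \<le> k \<Longrightarrow> v t \<in> B \<longleftrightarrow> t = 1 \<or> t = k"
    and l: "3 \<le> l" "l < k" "z \<in> R l"
  shows False
proof -
  define j where "j = Max {l. l < k \<and> z \<in> R l}"
  have fin: "finite {l. l < k \<and> z \<in> R l}" "{l. l < k \<and> z \<in> R l} \<noteq> {}" using l by auto
  have j: "j < k" "z \<in> R j" using Max_in[OF fin] unfolding j_def by auto
  have jmax: "m \<le> j" if "m < k" "z \<in> R m" for m using fin that unfolding j_def by simp
  have j3: "3 \<le> j" using jmax[OF l(2,3)] l by simp
  define w where "w = v(j - 1 := q, j := z)"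
  define R' where "R' = R(j - 1 := X - A)"
  show False
  proof (rule path_cycleD[of "j - 1" k w "v 2" R' B])
    show "w t \<in> X" if "j - 1 \<le> t" "t \<le> k" for t using that v q z j3 unfolding w_def by auto
    show "R' l \<in> S" if "j - 1 \<le> l" "l < k" for l
      using that R(1)[of l] j3 compl[OF AB(1)] unfolding R'_def by auto
    show "v 2 \<notin> R' l" if "j - 1 \<le> l" "l < k" for l
      using that R(3)[of l 2] j3 A[of 2] unfolding R'_def by auto
    show "w t \<in> R' l \<longleftrightarrow> t = l \<or> t = Suc l" if lt: "j - 1 \<le> l" "l < k" "j - 1 \<le> t" "t \<le> k" for l t
    proof -
      consider "t = j - 1" | "t = j" | "j < t" using lt(3) by linarith
      then show ?thesis
      proof cases
        case 1
        then show ?thesis using lt j3 q R(2)[of l] unfolding w_def R'_def by auto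
      next
        case 2
        then show ?thesis using lt j3 z jmax[of l] j unfolding w_def R'_def by auto
      next
        case 3
        then show ?thesis using lt j3 A[of t] R(3)[of l t] unfolding w_def R'_def by auto
      qed
    qed
    show "w t \<in> B \<longleftrightarrow> t = j - 1 \<or> t = k" if "j - 1 \<le> t" "t \<le> k" for t
      using that B[of t] z q j j3 unfolding w_def by auto
  qed (use j j3 v AB B[of 2] in auto)
qed

text \<open>The rows \<open>R l\<close> containing \<open>z\<close> decide. If there are none,
  \<open>z\<close> can serve as zero column; otherwise the bounds on \<open>l\<close> from both ends
  of the path leave only k = 3, or k = 4 with \<open>l = 2\<close>.\<close>

lemma inter_cycle_aux:
  assumes AB: "A \<in> S" "B \<in> S" and z: "z \<in> X" "z \<notin> A" "z \<notin> B" and k: "3 \<le> k"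
    and v: "\<And>t. 1 \<le> t \<Longrightarrow> t \<le> k \<Longrightarrow> v t \<in> X" and q: "q \<in> X" "q \<notin> A" "q \<in> B"
    and R: "\<And>l. 1 \<le> l \<Longrightarrow> l < k \<Longrightarrow> R l \<in> S" "\<And>l. 1 \<le> l \<Longrightarrow> l < k \<Longrightarrow> q \<notin> R l"
    "\<And>l t. 1 \<le> l \<Longrightarrow> l < k \<Longrightarrow> 1 \<le> t \<Longrightarrow> t \<le> k \<Longrightarrow> v t \<in> R l \<longleftrightarrow> t = l \<or> t = Suc l"
    and A: "\<And>t. 1 \<le> t \<Longrightarrow> t \<le> k \<Longrightarrow> v t \<in> A"
    and B: "\<And>t. 1 \<le> t \<Longrightarrow> t \<le> k \<Longrightarrow> v t \<in> B \<longleftrightarrow> t = 1 \<or> t = k"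
  shows False
proof -
  have low: "l \<le> 2" if "1 \<le> l" "l < k" "z \<in> R l" for l
    using inter_cycle_long[OF AB z v q R A B, where l = l] that by force
  \<comment> \<open>The same bound for the path traversed backwards.\<close>
  have high: "k \<le> l + 2" if l: "1 \<le> l" "l < k" "z \<in> R l" for l
  proof (rule ccontr)
    assume "\<not> k \<le> l + 2"
    then show False
      by (intro inter_cycle_long[of A B z k "\<lambda>t. v (Suc k - t)" q "\<lambda>l. R (k - l)" "k - l"])
        (use that AB z v q R A B in auto)
  qed
  show False
  proof (cases "\<exists>l. 1 \<le> l \<and> l < k \<and> z \<in> R l")
    case False
    \<comment> \<open>Now \<open>z\<close> replaces \<open>q\<close> as zero column, being outside
      \<open>B\<close> and outside every \<open>R l\<close>.\<close>
    show False
      by (rule path_cycleD[of 1 k v z R B]) (use False k v z AB R B in auto)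
  next
    case True
    then obtain l where l: "1 \<le> l" "l < k" "z \<in> R l" by blast
    have vX: "v 1 \<in> X" "v 2 \<in> X" "v 3 \<in> X" using v k by auto
    show False
    proof (cases "k = 3")
      case True
      have R1: "R 1 \<in> S" "q \<notin> R 1" "v 1 \<in> R 1" "v 2 \<in> R 1" "v 3 \<notin> R 1" using R[of 1] True by auto
      have R2: "R 2 \<in> S" "q \<notin> R 2" "v 1 \<notin> R 2" "v 2 \<in> R 2" "v 3 \<in> R 2" using R[of 2] True by auto
      have A': "v 1 \<in> A" "v 2 \<in> A" "v 3 \<in> A" using A True by auto
      have B': "v 1 \<in> B" "v 2 \<notin> B" "v 3 \<in> B" using B True by auto
      have "l = 1 \<or> l = 2" using l True by auto
      then consider "z \<notin> R 1" "z \<in> R 2" | "z \<in> R 1" "z \<notin> R 2" | "z \<in> R 1" "z \<in> R 2"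
        using l by blast
      then show False
      proof cases
        case 1
        show False
          by (rule squareD[of A B "R 1" "R 2" q z "v 2" "v 1" "v 3"])
            (use 1 AB R1 R2 A' B' z q vX in \<open>auto simp: separates_def\<close>)
      next
        case 2
        show False
          by (rule squareD[of A B "R 2" "R 1" q z "v 2" "v 3" "v 1"])
            (use 2 AB R1 R2 A' B' z q vX in \<open>auto simp: separates_def\<close>)
      next
        case 3
        show False
          by (rule triangleD[of A "R 2" "R 1" z q "v 1" "v 3"])
            (use 3 AB R1 R2 A' B' z q vX in \<open>auto simp: separates_def\<close>)
      qed
    next
      case False
      then have "l = 2" "k = 4" using low[OF l] high[OF l] k by auto
      moreover have "z \<notin> R 1" "z \<notin> R 3" using low[of 3] high[of 1] \<open>k = 4\<close> by auto
      \<comment> \<open>A claw: the pairs are \<open>v 2, v 1\<close> in \<open>R 1\<close>,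
        \<open>v 3, v 4\<close> in \<open>R 3\<close>, and \<open>z, q\<close> outside
        \<open>A\<close>; the transversal is \<open>R 2\<close>.\<close>
      ultimately show False using l vX v[of 4] z q AB A[of 1] A[of 2] A[of 3] A[of 4]
        R(1,2)[of 1] R(1,2)[of 2] R(1,2)[of 3]
        by (intro clawD[of "R 1" "R 3" A "R 2" "v 2" "v 1" "v 3" "v 4" z q])
          (auto simp: separates_def R(3))
    qed
  qed
qed

text \<open>A member that avoids \<open>q\<close> and includes \<open>A \<inter> B\<close> contains
  the whole path, for a gap in it would be bridged by a shorter cycle. As \<open>v 2\<close> is not
  in \<open>A \<inter> B\<close>, exactly one of \<open>A\<close> and \<open>B\<close> avoids
  \<open>q\<close>.\<close>

lemma inter_cycle:
  assumes AB: "A \<in> S" "B \<in> S" and z: "z \<in> X" "z \<notin> A" "z \<notin> B" and k: "3 \<le> k"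
    and v: "\<And>t. 1 \<le> t \<Longrightarrow> t \<le> k \<Longrightarrow> v t \<in> X" and q: "q \<in> X" "q \<notin> A \<inter> B"
    and R: "\<And>l. 1 \<le> l \<Longrightarrow> l < k \<Longrightarrow> R l \<in> S" "\<And>l. 1 \<le> l \<Longrightarrow> l < k \<Longrightarrow> q \<notin> R l"
    "\<And>l t. 1 \<le> l \<Longrightarrow> l < k \<Longrightarrow> 1 \<le> t \<Longrightarrow> t \<le> k \<Longrightarrow> v t \<in> R l \<longleftrightarrow> t = l \<or> t = Suc l"
    and D: "\<And>t. 1 \<le> t \<Longrightarrow> t \<le> k \<Longrightarrow> v t \<in> A \<inter> B \<longleftrightarrow> t = 1 \<or> t = k"
  shows False
proof -
  have ends: "v 1 \<in> A \<inter> B" "v k \<in> A \<inter> B" using D[of 1] D[of k] k by auto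
  have full: "v t \<in> C" if C: "C \<in> S" "q \<notin> C" "A \<inter> B \<subseteq> C" and t: "1 \<le> t" "t \<le> k" for C t
  proof (rule ccontr)
    assume "v t \<notin> C"
    moreover from this have "1 < t" "t < k" using C ends t by (metis le_neq_implies_less subsetD)+
    moreover have "v 1 \<in> C" "v k \<in> C" using C ends by auto
    ultimately obtain i j where ij: "1 \<le> i" "i < t" "t < j" "j \<le> k" "v i \<in> C" "v j \<in> C"
      "\<And>m. i < m \<Longrightarrow> m < j \<Longrightarrow> v m \<notin> C"
      using nearest_gap[of "\<lambda>t. v t \<in> C" 1 k t] by metis
    show False
    proof (rule path_cycleD[of i j v q R C])
      show "v t \<in> C \<longleftrightarrow> t = i \<or> t = j" if "i \<le> t" "t \<le> j" for t
        using ij that by (metis le_neq_implies_less)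
    qed (use ij v q R C in auto)
  qed
  have mid: "v 2 \<notin> A \<inter> B" using D[of 2] k by auto
  consider "q \<notin> A" "q \<in> B" | "q \<in> A" "q \<notin> B"
    using q(2) full[OF AB(1), of 2] full[OF AB(2), of 2] mid k by auto
  then show False
  proof cases
    case 1
    have inA: "v t \<in> A" if "1 \<le> t" "t \<le> k" for t using full[OF AB(1) 1(1)] that by blast
    show False using inter_cycle_aux[OF AB z k v q(1) 1 R inA] D inA by blast
  next
    case 2
    have inB: "v t \<in> B" if "1 \<le> t" "t \<le> k" for t using full[OF AB(2) 2(2)] that by blast
    show False using inter_cycle_aux[OF AB(2,1) z(1,3,2) k v q(1) 2(2,1) R inB] D inB by blast
  qed
qed

end

section \<open>Exchange in claws that use a union or an intersection\<close>

lemma separates_cases: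
  "separates R U V \<Longrightarrow> separates R U (insert z V) \<or> separates R (insert z U) V"
  by (auto simp: separates_def)

lemma separates_sym: "separates R U V \<longleftrightarrow> separates R V U"
  by (auto simp: separates_def)

context obstruction_free
begin

text \<open>If \<open>B\<close> takes only one of \<open>b'\<close>, \<open>c'\<close>, then
  \<open>A\<close>, \<open>B\<close> and a pair row form a triangle. If it takes both, it cuts off
  \<open>a'\<close> and \<open>z\<close>, so \<open>z\<close> replaces \<open>a\<close> in a claw
  with transversal \<open>A\<close>, unless \<open>z\<close> lies on the side of the pair in
  \<open>Rb\<close> or \<open>Rc\<close>, which gives a triangle.\<close>

lemma claw_transversal_aux:
  assumes AB: "A \<in> S" "B \<in> S" and X: "{a, a', b, b', c, c', z} \<subseteq> X" and z: "z \<notin> A" "z \<notin> B"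
    and R: "Ra \<in> S" "Rb \<in> S" "Rc \<in> S" "separates Ra {a, a'} {b, b', c, c'}"
      "separates Rb {b, b'} {a, a', c, c'}" "separates Rc {c, c'} {a, a', b, b'}"
    and D: "{a, b, c} \<subseteq> A \<inter> B" and A: "a' \<in> A" "b' \<notin> A" "c' \<notin> A"
    and B: "a' \<notin> B" "b' \<in> B \<or> c' \<in> B"
  shows False
proof -
  have Bs: "X - B \<in> S" using compl AB by blast
  consider "b' \<in> B" "c' \<notin> B" | "c' \<in> B" "b' \<notin> B" | "b' \<in> B" "c' \<in> B" using B by blast
  then show False
  proof cases
    case 1
    show False
      by (rule triangleD[of A B Rc b' c' a' c]) (use AB R X D A B 1 in \<open>auto simp: separates_def\<close>)
  next
    case 2
    show False
      by (rule triangleD[of A B Rb c' b' a' b]) (use AB R X D A B 2 in \<open>auto simp: separates_def\<close>)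
  next
    case 3
    consider "separates Rb {b, b'} {z, a, a', c, c'}" "separates Rc {c, c'} {z, a, a', b, b'}"
      | "separates Rb {z, b, b'} {a, a', c, c'}" | "separates Rc {z, c, c'} {a, a', b, b'}"
      using separates_cases[OF R(5)] separates_cases[OF R(6)] by blast
    then show False
    proof cases
      case 1
      show False
        by (rule clawD[of B Rb Rc A a' z b b' c c'])
          (use AB R X D A B z 1 3 in \<open>auto simp: separates_def\<close>)
    next
      case 2
      show False
        by (rule triangleD[of B Rb A a' z b c'])
          (use AB R X D A B z 2 3 in \<open>auto simp: separates_def\<close>)
    next
      case 4: 3
      show False
        by (rule triangleD[of B Rc A a' z c b'])
          (use AB R X D A B z 4 \<open>b' \<in> B\<close> \<open>c' \<in> B\<close> in \<open>auto simp: separates_def\<close>)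
    qed
  qed
qed

text \<open>Neither \<open>A\<close> nor \<open>B\<close> can be a transversal itself, so each
  contains a primed point, and no primed point is in both. Hence one of them contains exactly one of
  the three.\<close>

lemma claw_transversal:
  assumes AB: "A \<in> S" "B \<in> S" and X: "{a, a', b, b', c, c', z} \<subseteq> X" and z: "z \<notin> A" "z \<notin> B"
    and R: "Ra \<in> S" "Rb \<in> S" "Rc \<in> S" "separates Ra {a, a'} {b, b', c, c'}"
      "separates Rb {b, b'} {a, a', c, c'}" "separates Rc {c, c'} {a, a', b, b'}"
    and D: "{a, b, c} \<subseteq> A \<inter> B" "{a', b', c'} \<inter> (A \<inter> B) = {}"
  shows False
proof -
  have "\<not> separates C {a, b, c} {a', b', c'}" if "C \<in> S" for C
    using clawD[of Ra Rb Rc C a a' b b' c c'] R X that by auto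
  then have ne: "a' \<in> C \<or> b' \<in> C \<or> c' \<in> C" if "C \<in> S" "{a, b, c} \<subseteq> C" for C
    using that unfolding separates_def by blast
  have *: False if CE: "C \<in> S" "E \<in> S" "C \<inter> E = A \<inter> B" "z \<notin> C" "z \<notin> E"
    "(a' \<in> C \<and> b' \<notin> C \<and> c' \<notin> C) \<or> (b' \<in> C \<and> a' \<notin> C \<and> c' \<notin> C) \<or> (c' \<in> C \<and> a' \<notin> C \<and> b' \<notin> C)" for C E
  proof -
    have sub: "{a, b, c} \<subseteq> C \<inter> E" and disj: "{a', b', c'} \<inter> (C \<inter> E) = {}" using CE D by auto
    have neE: "a' \<in> E \<or> b' \<in> E \<or> c' \<in> E" using ne[of E] CE sub by auto
    consider "a' \<in> C" "b' \<notin> C" "c' \<notin> C" | "b' \<in> C" "a' \<notin> C" "c' \<notin> C" | "c' \<in> C" "a' \<notin> C" "b' \<notin> C"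
      using CE(6) by blast
    then show False
    proof cases
      case 1
      show False
        by (rule claw_transversal_aux[of C E a a' b b' c c' z Ra Rb Rc])
          (use 1 CE sub disj neE X R in auto)
    next
      case 2
      show False
        by (rule claw_transversal_aux[of C E b b' a a' c c' z Rb Ra Rc])
          (use 2 CE sub disj neE X R in \<open>auto simp: insert_commute\<close>)
    next
      case 3
      show False
        by (rule claw_transversal_aux[of C E c c' a a' b b' z Rc Ra Rb])
          (use 3 CE sub disj neE X R in \<open>auto simp: insert_commute\<close>)
    qed
  qed
  show False
    using *[of A B] *[of B A] ne[of A] ne[of B] AB z D by blast
qed

text \<open>Let \<open>A\<close> contain \<open>b\<close> but not \<open>b'\<close>. If
  \<open>c\<close> is outside \<open>A\<close>, there is a triangle on \<open>a', b, b', c\<close>;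
  if only \<open>c'\<close> is outside, \<open>b, b', c', c\<close> is a cycle with zero column
  \<open>a'\<close>.\<close>

lemma claw_pair_split:
  assumes A: "A \<in> S" "a \<in> A" "a' \<in> A" "(b \<in> A) \<noteq> (b' \<in> A)" and X: "{a, a', b, b', c, c'} \<subseteq> X"
    and R: "Rb \<in> S" "Rc \<in> S" "T \<in> S" "separates Rb {b, b'} {a, a', c, c'}"
      "separates Rc {c, c'} {a, a', b, b'}" "separates T {a, b, c} {a', b', c'}"
  shows "c \<in> A \<and> c' \<in> A"
proof -
  have *: "c \<in> A \<and> c' \<in> A"
    if X: "{a, a', b, b', c, c'} \<subseteq> X" and A': "a \<in> A" "a' \<in> A" "b \<in> A" "b' \<notin> A"
      and R': "separates Rb {b, b'} {a, a', c, c'}"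
      "separates Rc {c, c'} {a, a', b, b'}" "separates T {a, b, c} {a', b', c'}" for a a' b b' c c'
  proof (rule ccontr)
    assume "\<not> (c \<in> A \<and> c' \<in> A)"
    then consider "c \<notin> A" | "c \<in> A" "c' \<notin> A" by blast
    then show False
    proof cases
      case 1
      show False
        by (rule triangleD[of A Rb T a' b b' c]) (use 1 A(1) X A' R(1-3) R' in \<open>auto simp: separates_def\<close>)
    next
      case 2
      show False
        by (rule squareD[of Rb A Rc T b b' c' c a'])
          (use 2 A(1) X A' R(1-3) R' in \<open>auto simp: separates_def\<close>)
    qed
  qed
  consider "b \<in> A" "b' \<notin> A" | "b' \<in> A" "b \<notin> A" using A(4) by blast
  then show ?thesis
  proof cases
    case 1
    show ?thesis using *[of a a' b b' c c'] 1 A X R by blast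
  next
    case 2
    have "separates Rb {b', b} {a', a, c', c}" "separates Rc {c', c} {a', a, b', b}"
      "separates T {a', b', c'} {a, b, c}"
      using R by (simp_all add: insert_commute separates_sym)
    then show ?thesis using *[of a' a b' b c' c] 2 A X by blast
  qed
qed

text \<open>\<open>A\<close>, \<open>B\<close> and the transversal form a triangle with zero column
  \<open>z\<close>; the side of \<open>T\<close> containing \<open>z\<close> decides whether it is
  on \<open>a, b', c'\<close> or on \<open>a', b, c\<close>.\<close>

lemma claw_pair_inter_aux:
  assumes AB: "A \<in> S" "B \<in> S" and X: "{a, a', b, b', c, c', z} \<subseteq> X" and z: "z \<notin> A" "z \<notin> B"
    and T: "T \<in> S" "separates T {a, b, c} {a', b', c'}"
    and A: "{a, a', b, b'} \<subseteq> A" "c \<notin> A" "c' \<notin> A" and B: "{a, a', c, c'} \<subseteq> B" "b \<notin> B" "b' \<notin> B"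
  shows False
proof (cases "z \<in> T \<longleftrightarrow> a \<in> T")
  case True
  show False
    by (rule triangleD[of A T B a b' c' z]) (use True AB X z T A B in \<open>auto simp: separates_def\<close>)
next
  case False
  show False
    by (rule triangleD[of A T B a' b c z]) (use False AB X z T A B in \<open>auto simp: separates_def\<close>)
qed

text \<open>Suppose that \<open>A\<close> splits \<open>b, b'\<close>. Then it contains
  \<open>c\<close> and \<open>c'\<close>, so \<open>B\<close> contains neither; but \<open>B\<close>
  meets the four points and cannot split \<open>b, b'\<close> either, so it contains both, although
  one of them is in \<open>A\<close>. By symmetry no pair is split, and \<open>A\<close> and
  \<open>B\<close> take one whole pair each.\<close>

lemma claw_pair_inter:
  assumes AB: "A \<in> S" "B \<in> S" and X: "{a, a', b, b', c, c', z} \<subseteq> X" and z: "z \<notin> A" "z \<notin> B"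
    and R: "Rb \<in> S" "Rc \<in> S" "T \<in> S" "separates Rb {b, b'} {a, a', c, c'}"
      "separates Rc {c, c'} {a, a', b, b'}" "separates T {a, b, c} {a', b', c'}"
    and D: "{a, a'} \<subseteq> A \<inter> B" "{b, b', c, c'} \<inter> (A \<inter> B) = {}"
  shows False
proof -
  have R': "separates T {a, c, b} {a', c', b'}" using R(6) by (simp add: insert_commute)
  have ne: "b \<in> C \<or> b' \<in> C \<or> c \<in> C \<or> c' \<in> C" if "C \<in> S" "{a, a'} \<subseteq> C" for C
    using clawD[of C Rb Rc T a a' b b' c c'] R X that unfolding separates_def by auto
  have bs: "c \<in> C \<and> c' \<in> C" if "C \<in> S" "{a, a'} \<subseteq> C" "(b \<in> C) \<noteq> (b' \<in> C)" for C
    using claw_pair_split[of C a a' b b' c c' Rb Rc T] that X R by blast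
  have cs: "b \<in> C \<and> b' \<in> C" if "C \<in> S" "{a, a'} \<subseteq> C" "(c \<in> C) \<noteq> (c' \<in> C)" for C
    using claw_pair_split[of C a a' c c' b b' Rc Rb T] that X R R' by blast
  have "(b \<in> A \<longleftrightarrow> b' \<in> A) \<and> (c \<in> A \<longleftrightarrow> c' \<in> A) \<and> (b \<in> B \<longleftrightarrow> b' \<in> B) \<and> (c \<in> B \<longleftrightarrow> c' \<in> B)"
  proof -
    have "{a, a'} \<subseteq> A" "{a, a'} \<subseteq> B" using D by auto
    note facts = bs[OF AB(1) this(1)] bs[OF AB(2) this(2)] cs[OF AB(1) this(1)] cs[OF AB(2) this(2)]
      ne[OF AB(1) this(1)] ne[OF AB(2) this(2)]
    have "\<not> (x \<in> A \<and> x \<in> B)" if "x = b \<or> x = b' \<or> x = c \<or> x = c'" for x using D that by auto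
    then show ?thesis using facts by metis
  qed
  then consider "b \<in> A" "b' \<in> A" "c \<notin> A" "c' \<notin> A" "b \<notin> B" "b' \<notin> B" "c \<in> B" "c' \<in> B"
    | "b \<notin> A" "b' \<notin> A" "c \<in> A" "c' \<in> A" "b \<in> B" "b' \<in> B" "c \<notin> B" "c' \<notin> B"
    using ne[of A] ne[of B] AB D by blast
  then show False
  proof cases
    case 1
    show False
      by (rule claw_pair_inter_aux[of A B a a' b b' c c' z T]) (use 1 AB X z R D in auto)
  next
    case 2
    show False
      by (rule claw_pair_inter_aux[of B A a a' b b' c c' z T]) (use 2 AB X z R D in auto)
  qed
qed

text \<open>The point \<open>z\<close> takes the place of \<open>a'\<close> in the pair, with
  \<open>A\<close> as its row. If \<open>z\<close> lies on the side of the pair in \<open>Rb\<close>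
  or \<open>Rc\<close>, a triangle arises instead.\<close>

lemma claw_pair_union_aux:
  assumes AB: "A \<in> S" "B \<in> S" and X: "{a, a', b, b', c, c', z} \<subseteq> X" and z: "z \<in> A" "z \<in> B"
    and R: "Rb \<in> S" "Rc \<in> S" "T \<in> S" "separates Rb {b, b'} {a, a', c, c'}"
      "separates Rc {c, c'} {a, a', b, b'}" "separates T {a, b, c} {a', b', c', z}"
    and D: "a \<in> A" "a' \<notin> A" "{b, b', c, c'} \<inter> (A \<union> B) = {}"
  shows False
proof -
  consider "separates Rb {b, b'} {z, a, a', c, c'}" "separates Rc {c, c'} {z, a, a', b, b'}"
    | "separates Rb {z, b, b'} {a, a', c, c'}" | "separates Rc {z, c, c'} {a, a', b, b'}"
    using separates_cases[OF R(4)] separates_cases[OF R(5)] by blast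
  then show False
  proof cases
    case 1
    show False
      by (rule clawD[of A Rb Rc T a z b b' c c']) (use 1 AB X z R D in \<open>auto simp: separates_def\<close>)
  next
    case 2
    show False
      by (rule triangleD[of A Rb T a z b a']) (use 2 AB X z R D in \<open>auto simp: separates_def\<close>)
  next
    case 3
    show False
      by (rule triangleD[of A Rc T a z c a']) (use 3 AB X z R D in \<open>auto simp: separates_def\<close>)
  qed
qed

text \<open>A set containing both \<open>a\<close> and \<open>a'\<close> would itself be the missing
  pair row, so these points are divided between \<open>A\<close> and \<open>B\<close>. Then
  \<open>z\<close> is paired with the one of them on the other side of \<open>T\<close>.\<close>

lemma claw_pair_union:
  assumes AB: "A \<in> S" "B \<in> S" and X: "{a, a', b, b', c, c', z} \<subseteq> X" and z: "z \<in> A" "z \<in> B"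
    and R: "Rb \<in> S" "Rc \<in> S" "T \<in> S" "separates Rb {b, b'} {a, a', c, c'}"
      "separates Rc {c, c'} {a, a', b, b'}" "separates T {a, b, c} {a', b', c'}"
    and D: "{a, a'} \<subseteq> A \<union> B" "{b, b', c, c'} \<inter> (A \<union> B) = {}"
  shows False
proof -
  have ne: "\<not> (a \<in> C \<and> a' \<in> C)" if "C \<in> S" "C \<subseteq> A \<union> B" for C
    using clawD[of C Rb Rc T a a' b b' c c'] R X that D unfolding separates_def by auto
  have *: False if "C \<in> S" "E \<in> S" "z \<in> C" "z \<in> E" "a \<in> C" "a' \<notin> C" "a' \<in> E" "a \<notin> E" "C \<union> E = A \<union> B" for C E
  proof (cases "z \<in> T \<longleftrightarrow> a \<in> T")
    case True
    then have "separates T {a', b', c'} {a, b, c, z}" using R unfolding separates_def by auto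
    then show False
      by (intro claw_pair_union_aux[of E C a' a b' b c' c z Rb Rc T])
        (use that X R D in \<open>auto simp: insert_commute\<close>)
  next
    case False
    then have "separates T {a, b, c} {a', b', c', z}" using R unfolding separates_def by auto
    then show False
      by (intro claw_pair_union_aux[of C E a a' b b' c c' z Rb Rc T]) (use that X R D in auto)
  qed
  show False using *[of A B] *[of B A] ne[of A] ne[of B] AB z D by blast
qed

end

section \<open>Extending an obstruction-free family\<close>

lemma mod_eq_close:
  fixes a b k :: nat
  assumes "a < b + k" "b < a + k"
  shows "a mod k = b mod k \<longleftrightarrow> a = b"
proof -
  have "m = n" if "m \<le> n" "n < m + k" "m mod k = n mod k" for m n :: nat
  proof -
    have "k dvd n - m" using that mod_eq_dvd_iff_nat[of m n k] by auto
    then show ?thesis using that by (auto dest: dvd_imp_le)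
  qed
  then show ?thesis using assms by (metis nat_le_linear)
qed

lemma oriented_row:
  assumes "\<exists>R\<in>S. \<forall>j<k. (p j \<in> R \<longleftrightarrow> q \<notin> R) \<longleftrightarrow> P j" and compl: "\<And>R. R \<in> S \<Longrightarrow> X - R \<in> S"
    and p: "\<And>j. j < k \<Longrightarrow> p j \<in> X" and q: "q \<in> X"
  shows "\<exists>R\<in>S. q \<notin> R \<and> (\<forall>j<(k::nat). p j \<in> R \<longleftrightarrow> P j)"
proof -
  obtain R where R: "R \<in> S" "\<forall>j<k. (p j \<in> R \<longleftrightarrow> q \<notin> R) \<longleftrightarrow> P j" using assms(1) by blast
  show ?thesis
  proof (cases "q \<in> R")
    case True
    then have "q \<notin> X - R" "\<forall>j<k. p j \<in> X - R \<longleftrightarrow> P j" using R(2) p by auto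
    then show ?thesis using compl[OF R(1)] by blast
  next
    case False
    then show ?thesis using R by auto
  qed
qed

context obstruction_free
begin

text \<open>Of \<open>A \<inter> B\<close> and its complement only one avoids \<open>q\<close>, and
  the rows of a cycle differ, so exactly one row is new. If it is the complement, it is the union of
  \<open>X - A\<close> and \<open>X - B\<close>, which share \<open>z\<close>.\<close>

lemma extend_no_cycle:
  assumes AB: "A \<in> S" "B \<in> S" and y: "y \<in> A" "y \<in> B" and z: "z \<in> X" "z \<notin> A" "z \<notin> B"
  shows "\<not> has_cycle X (S \<union> {A \<inter> B, X - A \<inter> B})"
proof
  define T where "T = S \<union> {A \<inter> B, X - A \<inter> B}"
  have "X - (X - A \<inter> B) = A \<inter> B" using sub[OF AB(1)] by blast
  then have complT: "X - R \<in> T" if "R \<in> T" for R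
    using that compl[of R] unfolding T_def by fastforce
  have casesT: "R \<in> S \<or> R = A \<inter> B \<or> R = X - A \<inter> B" if "R \<in> T" for R
    using that unfolding T_def by blast
  assume "has_cycle X (S \<union> {A \<inter> B, X - A \<inter> B})"
  then have "has_cycle X T" by (simp only: T_def)
  then obtain k p q where k: "3 \<le> k" and p: "\<And>i. i < k \<Longrightarrow> p i \<in> X" and q: "q \<in> X"
    and rows: "\<forall>i<k. \<exists>R\<in>T. \<forall>j<k. (p j \<in> R \<longleftrightarrow> q \<notin> R) \<longleftrightarrow> j = i \<or> j = Suc i mod k"
    unfolding has_cycle_def by blast
  note row = rows[THEN spec, THEN mp]
  have "\<exists>R\<in>T. q \<notin> R \<and> (\<forall>j<k. p j \<in> R \<longleftrightarrow> j = i \<or> j = Suc i mod k)" if i: "i < k" for i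
    by (rule oriented_row[OF row[OF i] complT p q])
  then obtain R where R: "\<And>i. i < k \<Longrightarrow> R i \<in> T" "\<And>i. i < k \<Longrightarrow> q \<notin> R i"
    "\<And>i j. i < k \<Longrightarrow> j < k \<Longrightarrow> p j \<in> R i \<longleftrightarrow> j = i \<or> j = Suc i mod k"
    by metis
  show False
  proof (cases "\<forall>i<k. R i \<in> S")
    case True
    have "\<forall>i<k. \<exists>R\<in>S. \<forall>j<k. (p j \<in> R \<longleftrightarrow> q \<notin> R) \<longleftrightarrow> j = i \<or> j = Suc i mod k"
    proof (intro allI impI)
      fix i assume i: "i < k"
      then have "\<forall>j<k. (p j \<in> R i \<longleftrightarrow> q \<notin> R i) \<longleftrightarrow> j = i \<or> j = Suc i mod k" using R(2,3) by simp
      moreover have "R i \<in> S" using True i by simp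
      ultimately show "\<exists>R\<in>S. \<forall>j<k. (p j \<in> R \<longleftrightarrow> q \<notin> R) \<longleftrightarrow> j = i \<or> j = Suc i mod k" by (rule bexI)
    qed
    then have "has_cycle X S" unfolding has_cycle_def using k p q by blast
    then show False using no_cycle by simp
  next
    case False
    then obtain d where d: "d < k" "R d \<notin> S" by blast
    have dD: "R d = A \<inter> B \<or> R d = X - A \<inter> B" using casesT[OF R(1)[OF d(1)]] d(2) by blast
    have RS: "R i \<in> S" if i: "i < k" "i \<noteq> d" for i
    proof (rule ccontr)
      assume "R i \<notin> S"
      then have "R i = R d" using casesT[OF R(1)[OF i(1)]] R(2)[OF i(1)] R(2)[OF d(1)] dD q by blast
      have sk: "Suc d mod k < k" using k by simp
      have "d = Suc i mod k" "Suc d mod k = i \<or> Suc d mod k = Suc i mod k"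
        using R(3)[of d d] R(3)[of i d] R(3)[OF d(1) sk] R(3)[OF i(1) sk] i d sk \<open>R i = R d\<close> by auto
      moreover have "Suc (Suc i mod k) mod k = Suc (Suc i) mod k" by (simp add: mod_Suc_eq)
      ultimately have "Suc (Suc i) mod k = i mod k \<or> Suc (Suc i) mod k = Suc i mod k" using i by auto
      then show False
        using k mod_eq_close[of "Suc (Suc i)" i k] mod_eq_close[of "Suc (Suc i)" "Suc i" k] by auto
    qed
    \<comment> \<open>Renumbering makes the new row join \<open>v k\<close> to \<open>v 1\<close>,
      while the old rows run along the path \<open>v 1, ..., v k\<close>.\<close>
    define v where "v = (\<lambda>t. p ((t + d) mod k))"
    define Q where "Q = (\<lambda>l. R ((l + d) mod k))"
    have vX: "v t \<in> X" for t unfolding v_def using p k by simp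
    have QS: "Q l \<in> S" if "1 \<le> l" "l < k" for l
    proof -
      have "(l + d) mod k \<noteq> d" using mod_eq_close[of "l + d" d k] that d(1) by auto
      then show ?thesis unfolding Q_def using RS[of "(l + d) mod k"] k by simp
    qed
    have qQ: "q \<notin> Q l" for l unfolding Q_def using R(2) k by simp
    have vQ: "v t \<in> Q l \<longleftrightarrow> t = l \<or> t = Suc l" if "1 \<le> l" "l < k" "1 \<le> t" "t \<le> k" for l t
    proof -
      have "Suc ((l + d) mod k) mod k = (Suc l + d) mod k" by (simp add: mod_Suc_eq)
      then show ?thesis unfolding v_def Q_def
        using R(3)[of "(l + d) mod k" "(t + d) mod k"] k that
          mod_eq_close[of "t + d" "l + d" k] mod_eq_close[of "t + d" "Suc l + d" k] by auto
    qed
    have vD: "v t \<in> R d \<longleftrightarrow> t = 1 \<or> t = k" if "1 \<le> t" "t \<le> k" for t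
      unfolding v_def using R(3)[of d "(t + d) mod k"] k that d(1)
        mod_eq_close[of "t + d" "k + d" k] mod_eq_close[of "t + d" "Suc d" k] by auto
    from dD show False
    proof
      assume e: "R d = A \<inter> B"
      show False
        by (rule inter_cycle[OF AB z k vX q _ QS qQ vQ]) (use vD R(2)[OF d(1)] e in auto)
    next
      assume e: "R d = X - A \<inter> B"
      then have e': "R d = (X - A) \<union> (X - B)" by blast
      show False
        by (rule union_cycle[of "X - A" "X - B" z k v q Q])
          (use AB[THEN compl] z k vX q QS qQ vQ vD R(2)[OF d(1)] e' in auto)
    qed
  qed
qed

text \<open>The four rows split the six points differently, so \<open>A \<inter> B\<close> replaces
  one row only: the transversal, or a pair row with the pair inside or outside
  \<open>A \<inter> B\<close>.\<close>

lemma extend_no_claw: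
  assumes AB: "A \<in> S" "B \<in> S" and y: "y \<in> A" "y \<in> B" and z: "z \<in> X" "z \<notin> A" "z \<notin> B"
  shows "\<not> has_claw X (S \<union> {A \<inter> B, X - A \<inter> B})"
proof
  let ?D = "A \<inter> B"
  let ?S = "S \<union> {?D, X - ?D}"
  assume "has_claw X ?S"
  then obtain a a' b b' c c' Ra Rb Rc T where X: "{a, a', b, b', c, c'} \<subseteq> X"
    and R: "Ra \<in> ?S" "Rb \<in> ?S" "Rc \<in> ?S" "T \<in> ?S" "separates Ra {a, a'} {b, b', c, c'}"
      "separates Rb {b, b'} {a, a', c, c'}" "separates Rc {c, c'} {a, a', b, b'}"
      "separates T {a, b, c} {a', b', c'}"
    unfolding has_claw_def by (elim exE conjE bexE) (rule that)
  have X': "{a, a', b, b', c, c', z} \<subseteq> X" using X z by auto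
  have toD: "separates ?D U V" if "R \<in> {?D, X - ?D}" "separates R U V" "U \<subseteq> X" "V \<subseteq> X" for R U V
    using that unfolding separates_def by blast
  have Da: "separates ?D {a, a'} {b, b', c, c'}" if "Ra \<notin> S" using toD[of Ra] R that X by auto
  have Db: "separates ?D {b, b'} {a, a', c, c'}" if "Rb \<notin> S" using toD[of Rb] R that X by auto
  have Dc: "separates ?D {c, c'} {a, a', b, b'}" if "Rc \<notin> S" using toD[of Rc] R that X by auto
  have DT: "separates ?D {a, b, c} {a', b', c'}" if "T \<notin> S" using toD[of T] R that X by auto
  have pair: False if P: "P \<in> S" "Q \<in> S" "U \<in> S" "{u, u', v, v', w, w'} \<subseteq> X"
    "separates P {v, v'} {u, u', w, w'}" "separates Q {w, w'} {u, u', v, v'}"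
    "separates U {u, v, w} {u', v', w'}" "separates ?D {u, u'} {v, v', w, w'}"
    for P Q U u u' v v' w w'
  proof -
    from P(8) consider "{u, u'} \<subseteq> ?D" "{v, v', w, w'} \<inter> ?D = {}"
      | "{v, v', w, w'} \<subseteq> ?D" "{u, u'} \<inter> ?D = {}" unfolding separates_def by blast
    then show False
    proof cases
      case 1
      show False
        by (rule claw_pair_inter[OF AB _ z(2,3) P(1-3) P(5-7) 1]) (use P z in auto)
    next
      case 2
      show False
        by (rule claw_pair_union[OF AB[THEN compl] _ _ _ P(1-3) P(5-7), of z]) (use P z 2 in auto)
    qed
  qed
  consider "Ra \<in> S" "Rb \<in> S" "Rc \<in> S" "T \<in> S" | "Ra \<notin> S" | "Rb \<notin> S" | "Rc \<notin> S"
    | "T \<notin> S" by blast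
  then show False
  proof cases
    case 1
    then show False using clawD[OF 1 X R(5-8)] by blast
  next
    case 2
    have "Rb \<in> S" "Rc \<in> S" "T \<in> S" using Da[OF 2] Db Dc DT unfolding separates_def by auto
    then show False using pair[of Rb Rc T a a' b b' c c'] X R Da[OF 2] by blast
  next
    case 3
    have "Ra \<in> S" "Rc \<in> S" "T \<in> S" using Db[OF 3] Da Dc DT unfolding separates_def by auto
    then show False
      by (intro pair[of Ra Rc T b b' a a' c c'])
        (use X R Db[OF 3] in \<open>auto simp: insert_commute\<close>)
  next
    case 4
    have "Ra \<in> S" "Rb \<in> S" "T \<in> S" using Dc[OF 4] Da Db DT unfolding separates_def by auto
    then show False
      by (intro pair[of Ra Rb T c c' a a' b b'])
        (use X R Dc[OF 4] in \<open>auto simp: insert_commute\<close>)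
  next
    case 5
    have RS: "Ra \<in> S" "Rb \<in> S" "Rc \<in> S" using DT[OF 5] Da Db Dc unfolding separates_def by auto
    from DT[OF 5] consider "{a, b, c} \<subseteq> ?D" "{a', b', c'} \<inter> ?D = {}"
      | "{a', b', c'} \<subseteq> ?D" "{a, b, c} \<inter> ?D = {}" unfolding separates_def by blast
    then show False
    proof cases
      case 1
      show False by (rule claw_transversal[OF AB X' z(2,3) RS R(5-7) 1])
    next
      case 2
      show False
        by (rule claw_transversal[OF AB _ z(2,3) RS, of a' a b' b c' c])
          (use X' R(5-7) 2 in \<open>auto simp: insert_commute\<close>)
    qed
  qed
qed

lemma extend:
  assumes "A \<in> S" "B \<in> S" "y \<in> A" "y \<in> B" "z \<in> X" "z \<notin> A" "z \<notin> B"
  shows "obstruction_free X (S \<union> {A \<inter> B, X - A \<inter> B})"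
proof
  have sA: "A \<subseteq> X" using sub assms by simp
  then have "X - (X - A \<inter> B) = A \<inter> B" by blast
  then show "X - R \<in> S \<union> {A \<inter> B, X - A \<inter> B}" if "R \<in> S \<union> {A \<inter> B, X - A \<inter> B}" for R
    using that compl by auto
  show "R \<subseteq> X" if "R \<in> S \<union> {A \<inter> B, X - A \<inter> B}" for R
    using that sub sA by blast
  show "\<not> has_cycle X (S \<union> {A \<inter> B, X - A \<inter> B})" by (rule extend_no_cycle[OF assms])
  show "\<not> has_claw X (S \<union> {A \<inter> B, X - A \<inter> B})" by (rule extend_no_claw[OF assms])
qed

end

text \<open>The arrangement of \<open>X\<close> in the circular order of the values of \<open>f\<close> makes \<open>R\<close> an arc iff
  \<open>R\<close> and its complement do not alternate four times.\<close>

definition circular_on :: "('a \<Rightarrow> real) \<Rightarrow> 'a set \<Rightarrow> 'a set \<Rightarrow> bool" where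
  "circular_on f X R \<longleftrightarrow> (\<forall>w\<in>X. \<forall>x\<in>X. \<forall>y\<in>X. \<forall>z\<in>X. f w < f x \<longrightarrow> f x < f y \<longrightarrow> f y < f z \<longrightarrow>
    (w \<in> R \<longleftrightarrow> y \<in> R) \<longrightarrow> (x \<in> R \<longleftrightarrow> z \<in> R) \<longrightarrow> (w \<in> R \<longleftrightarrow> x \<in> R))"

lemma circular_on_compl: "circular_on f X (X - R) \<longleftrightarrow> circular_on f X R"
  unfolding circular_on_def by auto

text \<open>Placed first, \<open>q\<close> can only be the point \<open>w\<close> of an alternation;
  then \<open>x\<close> and \<open>z\<close> are in \<open>R\<close> with \<open>y\<close> between
  them, contrary to consecutiveness.\<close>

lemma circular_on_extend:
  assumes "consecutive f (X - {q}) R" "q \<notin> R" "\<And>x. x \<in> X - {q} \<Longrightarrow> m < f x"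
  shows "circular_on (f(q := m)) X R"
proof -
  let ?g = "f(q := m)"
  have False if h: "w \<in> X" "x \<in> X" "y \<in> X" "z \<in> X" "?g w < ?g x" "?g x < ?g y" "?g y < ?g z"
    "w \<in> R \<longleftrightarrow> y \<in> R" "x \<in> R \<longleftrightarrow> z \<in> R" "w \<in> R \<longleftrightarrow> x \<notin> R" for w x y z
  proof -
    have ge: "m \<le> ?g u" if "u \<in> X" for u using assms(3)[of u] that by (cases "u = q") auto
    have "x \<noteq> q" using h ge[of w] by auto
    moreover have "y \<noteq> q" using h ge[of x] by auto
    moreover have "z \<noteq> q" using h ge[of y] by auto
    ultimately show False
      using consecutiveD[OF assms(1), of w y x] consecutiveD[OF assms(1), of x z y] h assms(2)
      by (cases "w = q") (auto split: if_splits)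
  qed
  then show ?thesis unfolding circular_on_def by blast
qed

text \<open>The circle is cut at a point \<open>q\<close>: replacing every split by its side that
  avoids \<open>q\<close> turns arcs into intervals.\<close>

theorem obstruction_free_circular:
  assumes fin: "finite X" and S: "obstruction_free X S"
  shows "\<exists>f. inj_on f X \<and> (\<forall>R\<in>S. circular_on f X R)"
proof (cases "X = {}")
  case True
  then show ?thesis by (auto simp: circular_on_def)
next
  case False
  then obtain q where q: "q \<in> X" by blast
  have "{T. S \<subseteq> T \<and> obstruction_free X T} \<subseteq> Pow (Pow X)"
    using obstruction_free.sub by fastforce
  then have "finite {T. S \<subseteq> T \<and> obstruction_free X T}"
    using fin by (meson finite_Pow_iff finite_subset)
  then obtain T where T: "S \<subseteq> T" "obstruction_free X T"
    and max: "\<And>T'. obstruction_free X T' \<Longrightarrow> T \<subseteq> T' \<Longrightarrow> T' = T"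
    using finite_has_maximal2[of "{T. S \<subseteq> T \<and> obstruction_free X T}" S] S
    by (smt (verit) mem_Collect_eq order_trans order_refl)
  interpret T: obstruction_free X T by (rule T)
  have int: "A \<inter> B \<in> T" if "A \<in> T" "B \<in> T" "y \<in> A" "y \<in> B" "z \<in> X" "z \<notin> A" "z \<notin> B" for A B y z
    using max[OF T.extend[OF that]] by blast
  define F where "F = {R \<in> T. q \<notin> R}"
  have "\<exists>f. inj_on f (X - {q}) \<and> (\<forall>B\<in>F. consecutive f (X - {q}) B)"
  proof (rule consecutive_order)
    show "finite (X - {q})" using fin by simp
  next
    \<comment> \<open>Overlapping sets that avoid \<open>q\<close> have all four cells inhabited,
      the outer one by \<open>q\<close>. So \<open>int\<close> applies to any choice of a side of
      \<open>A\<close> and a side of \<open>B\<close>.\<close>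
    fix A B assume AB: "A \<in> F" "B \<in> F" "overlap (X - {q}) A B"
    then have AT: "A \<in> T" "B \<in> T" "q \<notin> A" "q \<notin> B" by (auto simp: F_def)
    obtain x y z where xyz: "x \<in> A" "x \<in> B" "x \<in> X" "y \<in> A" "y \<notin> B" "y \<in> X" "z \<in> B" "z \<notin> A" "z \<in> X"
      using AB(3) unfolding overlap_def by blast
    have "(X - A) \<inter> (X - B) \<in> T" using int[of "X - A" "X - B" q x] T.compl AT xyz q by blast
    then have "X - (X - A) \<inter> (X - B) \<in> T" by (rule T.compl)
    moreover have "X - (X - A) \<inter> (X - B) = A \<union> B" using T.sub AT by blast
    ultimately show "A \<union> B \<in> F" using AT by (auto simp: F_def)
    have "A \<inter> (X - B) \<in> T" using int[of A "X - B" y z] T.compl AT xyz by blast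
    moreover have "A \<inter> (X - B) = A - B" using T.sub AT by blast
    ultimately show "A - B \<in> F" using AT by (auto simp: F_def)
    show "A \<inter> B \<in> F" using int[of A B x q] AT xyz q by (auto simp: F_def)
  next
    fix x y z A B C
    assume "x \<in> X - {q}" "y \<in> X - {q}" "z \<in> X - {q}" "A \<in> F" "B \<in> F" "C \<in> F"
      "x \<in> A" "y \<in> A" "z \<notin> A" "y \<in> B" "z \<in> B" "x \<notin> B" "x \<in> C" "z \<in> C" "y \<notin> C"
    then show False
      using q by (intro T.triangleD[of A B C x y z q]) (auto simp: F_def separates_def)
  qed
  then obtain f where f: "inj_on f (X - {q})" "\<And>B. B \<in> F \<Longrightarrow> consecutive f (X - {q}) B" by blast
  define m where "m = Min (insert 0 (f ` (X - {q}))) - 1"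
  have m: "m < f x" if "x \<in> X - {q}" for x
  proof -
    have "Min (insert 0 (f ` (X - {q}))) \<le> f x" using fin that by (intro Min_le) auto
    then show ?thesis unfolding m_def by simp
  qed
  have "inj_on (f(q := m)) X" using f(1) m by (fastforce simp: inj_on_def)
  moreover have "circular_on (f(q := m)) X R" if "R \<in> S" for R
  proof (cases "q \<in> R")
    case False
    then show ?thesis using that T f(2)[of R] circular_on_extend[where X = X and q = q and f = f, OF _ _ m] by (auto simp: F_def)
  next
    case True
    then have "circular_on (f(q := m)) X (X - R)"
      using that T f(2)[of "X - R"] T.compl[of R] circular_on_extend[where X = X and q = q and f = f, OF _ _ m] by (auto simp: F_def)
    then show ?thesis by (simp add: circular_on_compl)
  qed
  ultimately show ?thesis by blast
qed

section \<open>Matrices and configurations\<close>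

definition row_ones :: "bool mat \<Rightarrow> nat \<Rightarrow> nat set" where
  "row_ones M i = {j. j < dim_col M \<and> M $$ (i, j)}"

section \<open>Arcs modulo n and alternation along real positions\<close>

lemma arc_iff:
  fixes s u n :: nat
  assumes "s < n"
  shows "u \<in> (\<lambda>t. (s + t) mod n) ` {..<l} \<longleftrightarrow> u < n \<and> (s \<le> u \<and> u < s + l \<or> u < s \<and> u + n < s + l)"
proof
  assume "u \<in> (\<lambda>t. (s + t) mod n) ` {..<l}"
  then obtain t where t: "t < l" "u = (s + t) mod n" by blast
  define t' where "t' = t mod n"
  have t': "t' < n" "t' \<le> t" "u = (s + t') mod n"
    using assms t by (auto simp: t'_def mod_add_right_eq)
  then show "u < n \<and> (s \<le> u \<and> u < s + l \<or> u < s \<and> u + n < s + l)"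
    using assms t(1) by (cases "s + t' < n") (auto simp: le_mod_geq)
next
  assume u: "u < n \<and> (s \<le> u \<and> u < s + l \<or> u < s \<and> u + n < s + l)"
  show "u \<in> (\<lambda>t. (s + t) mod n) ` {..<l}"
  proof (cases "s \<le> u")
    case True
    then show ?thesis using u by (intro image_eqI[of _ _ "u - s"]) auto
  next
    case False
    then show ?thesis using u assms by (intro image_eqI[of _ _ "u + n - s"]) auto
  qed
qed

lemma circular_on_arc:
  "circular_on real {..<n} ((\<lambda>t. (s + t) mod n) ` {..<l})"
proof (cases "n = 0")
  case False
  have "(\<lambda>t. (s + t) mod n) ` {..<l} = (\<lambda>t. (s mod n + t) mod n) ` {..<l}"
    by (simp add: mod_add_left_eq)
  moreover have "circular_on real {..<n} ((\<lambda>t. (s' + t) mod n) ` {..<l})" if "s' < n" for s'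
    unfolding circular_on_def
  proof (intro ballI impI)
    fix w x y z :: nat
    let ?U = "(\<lambda>t. (s' + t) mod n) ` {..<l}"
    assume "w \<in> {..<n}" "x \<in> {..<n}" "y \<in> {..<n}" "z \<in> {..<n}"
      "real w < real x" "real x < real y" "real y < real z"
      "w \<in> ?U \<longleftrightarrow> y \<in> ?U" "x \<in> ?U \<longleftrightarrow> z \<in> ?U"
    then show "w \<in> ?U \<longleftrightarrow> x \<in> ?U" unfolding arc_iff[OF that] by simp linarith
  qed
  ultimately show ?thesis using False by simp
qed (simp add: circular_on_def)

text \<open>A gap \<open>x\<close> between the least element a and the greatest element b would make
  \<open>0, a, x, b\<close> an alternation.\<close>

lemma arc_if_circular_on_aux:
  assumes U: "U \<subseteq> {..<n}" "0 \<notin> U" "U \<noteq> {}" and c: "circular_on real {..<n} U"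
  obtains a b where "0 < a" "a \<le> b" "b < n" "U = {a..b}"
proof
  have fin: "finite U" using U finite_subset by blast
  let ?a = "Min U" and ?b = "Max U"
  have ab: "?a \<in> U" "?b \<in> U" using fin U by auto
  then show "0 < ?a" using U(2) by (cases "?a = 0") auto
  show "?a \<le> ?b" using ab fin by simp
  show "?b < n" using ab U by auto
  have mid: "x \<in> U" if "?a < x" "x < ?b" for x
  proof (rule ccontr)
    assume "x \<notin> U"
    moreover have "0 < ?a" "?b < n" by fact+
    ultimately show False
      using c[unfolded circular_on_def, rule_format, of 0 ?a x ?b] ab U(2) that by auto
  qed
  have "x \<in> U" if "?a \<le> x" "x \<le> ?b" for x
    using that ab mid[of x] by (cases "x = ?a \<or> x = ?b") auto
  moreover have "?a \<le> x \<and> x \<le> ?b" if "x \<in> U" for x using fin that by simp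
  ultimately show "U = {?a..?b}" unfolding set_eq_iff atLeastAtMost_iff by blast
qed

lemma arc_if_circular_on:
  assumes U: "U \<subseteq> {..<n}" and c: "circular_on real {..<n} U"
  shows "\<exists>s l. U = (\<lambda>t. (s + t) mod n) ` {..<l}"
proof -
  consider "U = {}" | "0 \<notin> U" "U \<noteq> {}" | "U = {..<n}" "n > 0" | "0 \<in> U" "{..<n} - U \<noteq> {}"
    using U by auto
  then show ?thesis
  proof cases
    case 1
    then show ?thesis by (intro exI[of _ 0]) auto
  next
    case 2
    obtain a b where ab: "0 < a" "a \<le> b" "b < n" "U = {a..b}"
      using arc_if_circular_on_aux[OF U 2 c] .
    then have "a < n" by simp
    then have "U = (\<lambda>t. (a + t) mod n) ` {..<Suc b - a}"
      unfolding set_eq_iff using ab by (simp only: arc_iff) auto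
    then show ?thesis by blast
  next
    case 3
    then have "U = (\<lambda>t. (0 + t) mod n) ` {..<n}"
      unfolding set_eq_iff by (simp only: arc_iff) auto
    then show ?thesis by blast
  next
    case 4
    have V: "{..<n} - U \<subseteq> {..<n}" "0 \<notin> {..<n} - U" using 4 by auto
    have "circular_on real {..<n} ({..<n} - U)" using c by (simp add: circular_on_compl)
    from arc_if_circular_on_aux[OF V 4(2) this]
    obtain a b where ab: "0 < a" "a \<le> b" "b < n" "{..<n} - U = {a..b}" .
    then have "u \<in> {..<n} - U \<longleftrightarrow> a \<le> u \<and> u \<le> b" for u by simp
    then have Ueq: "u \<in> U \<longleftrightarrow> u < n \<and> (u < a \<or> b < u)" for u
      using U by (metis Diff_iff lessThan_iff not_less subsetD ab(3) le_less_trans)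
    \<comment> \<open>The arc starts right after the complementary interval and wraps around; the
      \<open>mod\<close> matters when \<open>b = n - 1\<close>.\<close>
    have "U = (\<lambda>t. (Suc b mod n + t) mod n) ` {..<n + a - Suc b}"
    proof (rule Set.set_eqI)
      fix u
      have "Suc b mod n = (if Suc b = n then 0 else Suc b)" "Suc b mod n < n" using ab(1-3) by auto
      then show "u \<in> U \<longleftrightarrow> u \<in> (\<lambda>t. (Suc b mod n + t) mod n) ` {..<n + a - Suc b}"
        unfolding arc_iff[OF \<open>Suc b mod n < n\<close>] Ueq using ab(1-3) by (cases "Suc b = n") auto
    qed
    then show ?thesis by blast
  qed
qed

text \<open>The number of smaller values is a permutation of the indices, and its inverse lists them
  in increasing order of \<open>f\<close>.\<close>

lemma rank_permutation:
  fixes f :: "nat \<Rightarrow> real"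
  assumes "inj_on f {..<n}"
  shows "\<exists>p. p permutes {..<n} \<and> (\<forall>i<n. \<forall>j<n. i < j \<longrightarrow> f (p i) < f (p j))"
proof -
  define r where "r u = (if u < n then card {v. v < n \<and> f v < f u} else u)" for u
  have lt: "r u < r v" if "u < n" "v < n" "f u < f v" for u v
    unfolding r_def using that by (auto intro!: psubset_card_mono)
  have r_less: "r u < n" if "u < n" for u
  proof -
    have "card {v. v < n \<and> f v < f u} < card {..<n}" using that by (intro psubset_card_mono) auto
    then show ?thesis using that by (simp add: r_def)
  qed
  have inj: "inj_on r {..<n}"
  proof (rule inj_onI, rule ccontr)
    fix u v assume "u \<in> {..<n}" "v \<in> {..<n}" "r u = r v" "u \<noteq> v"
    moreover from this have "f u \<noteq> f v" using inj_onD[OF assms, of u v] by blast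
    ultimately show False using lt[of u v] lt[of v u] by fastforce
  qed
  have "r ` {..<n} = {..<n}" by (rule endo_inj_surj) (use r_less inj in auto)
  then have perm: "r permutes {..<n}"
    by (intro bij_imp_permutes; use inj in \<open>simp add: bij_betw_def r_def\<close>)
  have "f (inv_into UNIV r i) < f (inv_into UNIV r j)" if "i < n" "j < n" "i < j" for i j
  proof -
    let ?u = "inv_into UNIV r i" and ?v = "inv_into UNIV r j"
    have uv: "?u < n" "?v < n" "r ?u = i" "r ?v = j"
      using permutes_in_image[OF permutes_inv[OF perm]] that permutes_inverses[OF perm] by auto
    then have "\<not> f ?v < f ?u" using lt[of ?v ?u] that by auto
    moreover have "f ?u \<noteq> f ?v" using inj_onD[OF assms, of ?u ?v] uv that by auto
    ultimately show ?thesis by simp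
  qed
  then show ?thesis using permutes_inv[OF perm] by blast
qed

lemma circular_on_comp:
  assumes "circular_on f X R" "\<And>u. u \<in> Y \<Longrightarrow> g u \<in> X"
    "\<And>u v. u \<in> Y \<Longrightarrow> v \<in> Y \<Longrightarrow> f' u < f' v \<Longrightarrow> f (g u) < f (g v)"
    "\<And>u. u \<in> Y \<Longrightarrow> u \<in> R' \<longleftrightarrow> (g u \<in> R) \<noteq> a"
  shows "circular_on f' Y R'"
  unfolding circular_on_def
proof (intro ballI impI)
  fix w x y z assume h: "w \<in> Y" "x \<in> Y" "y \<in> Y" "z \<in> Y" "f' w < f' x" "f' x < f' y" "f' y < f' z"
    "w \<in> R' \<longleftrightarrow> y \<in> R'" "x \<in> R' \<longleftrightarrow> z \<in> R'"
  then show "w \<in> R' \<longleftrightarrow> x \<in> R'"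
    using assms(1)[unfolded circular_on_def, rule_format, of "g w" "g x" "g y" "g z"]
      assms(2-4) by auto
qed

text \<open>Index sets instead of submatrices: deleting a row or a column then needs no
  renumbering.\<close>

definition circular_within :: "bool mat \<Rightarrow> nat set \<Rightarrow> nat set \<Rightarrow> bool" where
  "circular_within M I J \<longleftrightarrow> (\<exists>f. inj_on f J \<and> (\<forall>i\<in>I. circular_on f J (row_ones M i)))"

text \<open>The permutation sends positions to columns, the real function columns to positions; one
  passes between them by inversion and by ranking.\<close>

lemma circular_ones_iff: "circular_ones M \<longleftrightarrow> circular_within M {..<dim_row M} {..<dim_col M}"
proof
  let ?n = "dim_col M"
  assume "circular_ones M"
  obtain p where p: "p permutes {..<?n}"
    and arcs: "\<And>i. i < dim_row M \<Longrightarrow>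
      \<exists>s l. {j. j < ?n \<and> M $$ (i, p j)} = (\<lambda>t. (s + t) mod ?n) ` {..<l}"
    using \<open>circular_ones M\<close> unfolding circular_ones_def by blast
  have invp: "inv_into UNIV p u < ?n" "p (inv_into UNIV p u) = u" if "u < ?n" for u
    using that permutes_in_image[OF permutes_inv[OF p], of u] permutes_inverses[OF p] by auto
  define h where "h u = real (inv_into UNIV p u)" for u
  have "inj_on h {..<?n}"
  proof (rule inj_onI)
    fix u v assume "u \<in> {..<?n}" "v \<in> {..<?n}" "h u = h v"
    then have "inv_into UNIV p u = inv_into UNIV p v" "u < ?n" "v < ?n" by (simp_all add: h_def)
    then show "u = v" using invp(2)[of u] invp(2)[of v] by argo
  qed
  moreover have "circular_on h {..<?n} (row_ones M i)" if i: "i < dim_row M" for i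
  proof -
    obtain s l where "{j. j < ?n \<and> M $$ (i, p j)} = (\<lambda>t. (s + t) mod ?n) ` {..<l}"
      using arcs[OF i] by blast
    then have "circular_on real {..<?n} {j. j < ?n \<and> M $$ (i, p j)}"
      using circular_on_arc[where n = ?n and s = s and l = l] by simp
    then show ?thesis
    proof (rule circular_on_comp[where g = "inv_into UNIV p" and a = False])
      fix u assume "u \<in> {..<?n}"
      then show "inv_into UNIV p u \<in> {..<?n}"
        "u \<in> row_ones M i \<longleftrightarrow> (inv_into UNIV p u \<in> {j. j < ?n \<and> M $$ (i, p j)}) \<noteq> False"
        using invp[of u] by (simp_all add: row_ones_def)
    qed (simp add: h_def)
  qed
  ultimately show "circular_within M {..<dim_row M} {..<?n}" unfolding circular_within_def by blast
next
  let ?n = "dim_col M"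
  assume "circular_within M {..<dim_row M} {..<?n}"
  then obtain f where f: "inj_on f {..<?n}" "\<And>i. i < dim_row M \<Longrightarrow> circular_on f {..<?n} (row_ones M i)"
    unfolding circular_within_def by blast
  obtain p where p: "p permutes {..<?n}" "\<And>i j. i < ?n \<Longrightarrow> j < ?n \<Longrightarrow> i < j \<Longrightarrow> f (p i) < f (p j)"
    using rank_permutation[OF f(1)] by blast
  have "\<exists>s l. {j. j < ?n \<and> M $$ (i, p j)} = (\<lambda>t. (s + t) mod ?n) ` {..<l}" if i: "i < dim_row M" for i
  proof (rule arc_if_circular_on)
    have pn: "p u < ?n" if "u < ?n" for u using permutes_in_image[OF p(1), of u] that by simp
    show "circular_on real {..<?n} {j. j < ?n \<and> M $$ (i, p j)}"
      by (rule circular_on_comp[OF f(2)[OF i], where g = p and a = False])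
        (use p(2) pn in \<open>auto simp: row_ones_def\<close>)
  qed auto
  then show "circular_ones M" unfolding circular_ones_def using p(1) by blast
qed

text \<open>Row \<open>i\<close> of \<open>N\<close> is row \<open>f i\<close> of \<open>M\<close>, complemented if \<open>a i\<close> holds.\<close>

definition embeds :: "(nat \<Rightarrow> nat) \<Rightarrow> (nat \<Rightarrow> nat) \<Rightarrow> (nat \<Rightarrow> bool) \<Rightarrow> bool mat \<Rightarrow> bool mat \<Rightarrow> bool" where
  "embeds f g a M N \<longleftrightarrow> inj_on f {..<dim_row N} \<and> (\<forall>i<dim_row N. f i < dim_row M) \<and>
    inj_on g {..<dim_col N} \<and> (\<forall>j<dim_col N. g j < dim_col M) \<and>
    (\<forall>i<dim_row N. \<forall>j<dim_col N. N $$ (i, j) \<longleftrightarrow> M $$ (f i, g j) \<noteq> a i)"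

lemma circular_within_embeds:
  assumes e: "embeds f g a M N" and c: "circular_within M I J"
    and I: "I' \<subseteq> {..<dim_row N}" "f ` I' \<subseteq> I" and J: "J' \<subseteq> {..<dim_col N}" "g ` J' \<subseteq> J"
  shows "circular_within N I' J'"
proof -
  obtain h where h: "inj_on h J" "\<And>i. i \<in> I \<Longrightarrow> circular_on h J (row_ones M i)"
    using c unfolding circular_within_def by blast
  have "inj_on g J'" using e J(1) unfolding embeds_def by (meson inj_on_subset)
  then have "inj_on (h \<circ> g) J'" using h(1) J(2) by (meson comp_inj_on inj_on_subset)
  moreover have "circular_on (h \<circ> g) J' (row_ones N i)" if i: "i \<in> I'" for i
  proof (rule circular_on_comp[OF h(2)[of "f i"], where g = g and a = "a i"])
    fix u assume "u \<in> J'"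
    then have "i < dim_row N" "u < dim_col N" "g u < dim_col M" using i I J e by (auto simp: embeds_def)
    then show "u \<in> row_ones N i \<longleftrightarrow> (g u \<in> row_ones M (f i)) \<noteq> a i"
      using e by (simp add: embeds_def row_ones_def)
  qed (use i I J in auto)
  ultimately show ?thesis unfolding circular_within_def by blast
qed

lemma embeds_trans:
  assumes "embeds f g a M N" "embeds f' g' a' N P"
  shows "embeds (f \<circ> f') (g \<circ> g') (\<lambda>i. a (f' i) \<noteq> a' i) M P"
proof -
  have "inj_on f (f' ` {..<dim_row P})" "inj_on g (g' ` {..<dim_col P})"
    using assms unfolding embeds_def by (auto intro: inj_on_subset)
  then have "inj_on (f \<circ> f') {..<dim_row P}" "inj_on (g \<circ> g') {..<dim_col P}"
    using assms unfolding embeds_def by (simp_all add: comp_inj_on)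
  then show ?thesis using assms unfolding embeds_def by auto
qed

lemma pick_bij:
  "bij_betw (pick I) {..<card {i. i < m \<and> i \<in> I}} {i. i < m \<and> i \<in> I}"
proof -
  let ?A = "{i. i < m \<and> i \<in> I}"
  have le: "card ?A \<le> card I" if "finite I" using that by (intro card_mono) auto
  have ok: "k < card I \<or> infinite I" if "k < card ?A" for k using le that by fastforce
  have inj: "inj_on (pick I) {..<card ?A}"
  proof (rule inj_onI)
    fix x y assume "x \<in> {..<card ?A}" "y \<in> {..<card ?A}" "pick I x = pick I y"
    then show "x = y"
      using pick_mono[OF ok, of x y] pick_mono[OF ok, of y x] by (cases x y rule: linorder_cases) auto
  qed
  moreover have sub: "pick I ` {..<card ?A} \<subseteq> ?A" using pick_in_set[OF ok] pick_le by auto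
  moreover have "card (pick I ` {..<card ?A}) = card ?A" using card_image[OF inj] by simp
  ultimately show ?thesis by (simp add: bij_betw_def card_subset_eq)
qed

lemma embeds_submatrix:
  "embeds (pick I) (pick J) (\<lambda>_. False) M (submatrix M I J)"
  unfolding embeds_def
  using pick_bij[of I "dim_row M"] pick_bij[of J "dim_col M"]
  by (auto simp: dim_submatrix submatrix_index bij_betw_def)

text \<open>\<open>submatrix\<close> lists the chosen rows and columns in increasing order by
  \<open>pick\<close>. The permutations account for the difference between this order and that of an
  arbitrary injection.\<close>

lemma contains_config_iff: "contains_config M N \<longleftrightarrow> (\<exists>f g. embeds f g (\<lambda>_. False) M N)"
proof
  assume "contains_config M N"
  then obtain I J p q where p: "p permutes {..<dim_row N}" and q: "q permutes {..<dim_col N}"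
    and eq: "submatrix M I J = mat (dim_row N) (dim_col N) (\<lambda>(i, j). N $$ (p i, q j))"
    unfolding contains_config_def by blast
  have d: "dim_row (submatrix M I J) = dim_row N" "dim_col (submatrix M I J) = dim_col N"
    using eq by simp_all
  have "embeds (inv_into UNIV p) (inv_into UNIV q) (\<lambda>_. False) (submatrix M I J) N"
    unfolding embeds_def d
    using permutes_in_image[OF permutes_inv[OF p]] permutes_in_image[OF permutes_inv[OF q]]
      permutes_inj_on[OF permutes_inv[OF p]] permutes_inj_on[OF permutes_inv[OF q]]
      permutes_inverses(1)[OF p] permutes_inverses(1)[OF q] by (auto simp: eq)
  from embeds_trans[OF embeds_submatrix this] show "\<exists>f g. embeds f g (\<lambda>_. False) M N" by auto
next
  assume "\<exists>f g. embeds f g (\<lambda>_. False) M N"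
  then obtain f g where e: "embeds f g (\<lambda>_. False) M N" by blast
  have perm: "\<exists>p. p permutes {..<k} \<and> card {i. i < m \<and> i \<in> h ` {..<k}} = k \<and>
      (\<forall>i<k. pick (h ` {..<k}) i = h (p i))"
    if h: "inj_on h {..<k}" "\<forall>i<k. h i < m" for h :: "nat \<Rightarrow> nat" and k m
  proof -
    let ?I = "h ` {..<k}"
    have I: "{i. i < m \<and> i \<in> ?I} = ?I" using h by auto
    have c: "card ?I = k" using h by (simp add: card_image)
    have b: "bij_betw (pick ?I) {..<k} ?I" using pick_bij[of ?I m] unfolding I c .
    have bh: "bij_betw h {..<k} ?I" using h by (simp add: bij_betw_def)
    define p where "p i = (if i < k then inv_into {..<k} h (pick ?I i) else i)" for i
    have "bij_betw (inv_into {..<k} h \<circ> pick ?I) {..<k} {..<k}"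
      using bij_betw_trans[OF b bij_betw_inv_into[OF bh]] .
    then have "bij_betw p {..<k} {..<k}" by (rule bij_betw_cong[THEN iffD1, rotated]) (auto simp: p_def)
    then have "p permutes {..<k}" by (rule bij_imp_permutes) (auto simp: p_def)
    moreover have "pick ?I i = h (p i)" if "i < k" for i
      using that bij_betwE[OF b] by (auto simp: p_def f_inv_into_f)
    ultimately show ?thesis using I c by auto
  qed
  obtain p where p: "p permutes {..<dim_row N}"
    "card {i. i < dim_row M \<and> i \<in> f ` {..<dim_row N}} = dim_row N"
    "\<And>i. i < dim_row N \<Longrightarrow> pick (f ` {..<dim_row N}) i = f (p i)"
    using perm[of f "dim_row N" "dim_row M"] e unfolding embeds_def by auto
  obtain q where q: "q permutes {..<dim_col N}"
    "card {i. i < dim_col M \<and> i \<in> g ` {..<dim_col N}} = dim_col N"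
    "\<And>i. i < dim_col N \<Longrightarrow> pick (g ` {..<dim_col N}) i = g (q i)"
    using perm[of g "dim_col N" "dim_col M"] e unfolding embeds_def by auto
  have "p i < dim_row N" if "i < dim_row N" for i using permutes_in_image[OF p(1), of i] that by simp
  moreover have "q i < dim_col N" if "i < dim_col N" for i
    using permutes_in_image[OF q(1), of i] that by simp
  ultimately have "submatrix M (f ` {..<dim_row N}) (g ` {..<dim_col N}) =
      mat (dim_row N) (dim_col N) (\<lambda>(i, j). N $$ (p i, q j))"
    unfolding submatrix_def p(2) q(2) using e p(3) q(3) by (intro eq_matI) (auto simp: embeds_def)
  then show "contains_config M N" unfolding contains_config_def using p(1) q(1) by blast
qed

section \<open>Minimality of the cycles\<close>

lemma embeds_inverse:
  assumes e: "embeds f g a M N" and d: "dim_row M = dim_row N" "dim_col M = dim_col N"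
  obtains f' g' where "embeds f' g' (\<lambda>i. a (f' i)) N M" "\<And>i. i < dim_row N \<Longrightarrow> f (f' i) = i"
    "\<And>i. i < dim_row N \<Longrightarrow> f' i < dim_row N"
proof -
  have bij: "bij_betw h {..<n} {..<n}" if "inj_on h {..<n}" "\<And>i. i < n \<Longrightarrow> h i < n" for h :: "nat \<Rightarrow> nat" and n
    unfolding bij_betw_def using that endo_inj_surj[of "{..<n}" h] by auto
  have bf: "bij_betw f {..<dim_row N} {..<dim_row N}" and bg: "bij_betw g {..<dim_col N} {..<dim_col N}"
    by (rule bij; use e d in \<open>auto simp: embeds_def\<close>)+
  define f' where "f' = inv_into {..<dim_row N} f"
  define g' where "g' = inv_into {..<dim_col N} g"
  have bf': "bij_betw f' {..<dim_row N} {..<dim_row N}" and bg': "bij_betw g' {..<dim_col N} {..<dim_col N}"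
    unfolding f'_def g'_def using bf bg by (auto intro: bij_betw_inv_into)
  have ff: "f (f' i) = i" if "i < dim_row N" for i
    unfolding f'_def using that bf by (simp add: bij_betw_inv_into_right)
  have gg: "g (g' i) = i" if "i < dim_col N" for i
    unfolding g'_def using that bg by (simp add: bij_betw_inv_into_right)
  have lt: "f' i < dim_row N" if "i < dim_row N" for i using bij_betwE[OF bf'] that by auto
  have lt': "g' i < dim_col N" if "i < dim_col N" for i using bij_betwE[OF bg'] that by auto
  have "embeds f' g' (\<lambda>i. a (f' i)) N M"
    unfolding embeds_def
  proof (intro conjI allI impI)
    show "inj_on f' {..<dim_row M}" "inj_on g' {..<dim_col M}"
      using bf' bg' d by (auto simp: bij_betw_def)
    fix i j assume ij: "i < dim_row M" "j < dim_col M"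
    then have "N $$ (f' i, g' j) \<longleftrightarrow> M $$ (f (f' i), g (g' j)) \<noteq> a (f' i)"
      using e lt lt' d unfolding embeds_def by auto
    then show "M $$ (i, j) \<longleftrightarrow> N $$ (f' i, g' j) \<noteq> a (f' i)" using ij ff gg d by auto
  qed (use lt lt' d in auto)
  then show thesis using that ff lt by blast
qed

text \<open>Single deletions suffice because \<open>circular_within\<close> is inherited by smaller
  index sets. Unlike \<open>minimal_forbidden\<close>, this form avoids the numbering of
  submatrices.\<close>

definition minimal_noncircular :: "bool mat \<Rightarrow> bool" where
  "minimal_noncircular M \<longleftrightarrow> \<not> circular_within M {..<dim_row M} {..<dim_col M} \<and>
    (\<forall>i<dim_row M. circular_within M ({..<dim_row M} - {i}) {..<dim_col M}) \<and>
    (\<forall>j<dim_col M. circular_within M {..<dim_row M} ({..<dim_col M} - {j}))"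

lemma submatrix_all:
  assumes "{..<dim_row M} \<subseteq> I" "{..<dim_col M} \<subseteq> J"
  shows "submatrix M I J = M"
proof -
  have pick: "pick K i = i" if "{..<n} \<subseteq> K" "i < n" for K i n
  proof -
    have "{a \<in> K. a < i} = {..<i}" using that by auto
    then have "card {a \<in> K. a < i} = i" by simp
    then show ?thesis using pick_card_in_set[of i K] that by auto
  qed
  have "{i. i < dim_row M \<and> i \<in> I} = {..<dim_row M}" "{i. i < dim_col M \<and> i \<in> J} = {..<dim_col M}"
    using assms by auto
  then show ?thesis unfolding submatrix_def using pick[OF assms(1)] pick[OF assms(2)]
    by (intro eq_matI) auto
qed

lemma minimal_forbidden_if_noncircular:
  assumes M: "minimal_noncircular M"
  shows "minimal_forbidden M"
  unfolding minimal_forbidden_def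
proof (intro conjI allI impI)
  show "\<not> circular_ones M" using M unfolding minimal_noncircular_def circular_ones_iff by blast
  fix I J assume ne: "submatrix M I J \<noteq> M"
  let ?N = "submatrix M I J"
  have pI: "pick I i < dim_row M" "pick I i \<in> I" if "i < dim_row ?N" for i
    using bij_betwE[OF pick_bij[of I "dim_row M"]] that by (auto simp: dim_submatrix)
  have pJ: "pick J j < dim_col M" "pick J j \<in> J" if "j < dim_col ?N" for j
    using bij_betwE[OF pick_bij[of J "dim_col M"]] that by (auto simp: dim_submatrix)
  consider i where "i < dim_row M" "i \<notin> I" | j where "j < dim_col M" "j \<notin> J"
    using submatrix_all[of M I J] ne by auto
  then have "circular_within ?N {..<dim_row ?N} {..<dim_col ?N}"
  proof cases
    case 1
    then have "circular_within M ({..<dim_row M} - {i}) {..<dim_col M}"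
      using M unfolding minimal_noncircular_def by blast
    then show ?thesis
      by (rule circular_within_embeds[OF embeds_submatrix]) (use pI pJ 1 in auto)
  next
    case 2
    then have "circular_within M {..<dim_row M} ({..<dim_col M} - {j})"
      using M unfolding minimal_noncircular_def by blast
    then show ?thesis
      by (rule circular_within_embeds[OF embeds_submatrix]) (use pI pJ 2 in auto)
  qed
  then show "circular_ones ?N" by (simp add: circular_ones_iff)
qed

text \<open>The flips \<open>a\<close> are arbitrary, so minimality has to be checked only for
  \<open>M_I(k)*\<close> and for \<open>M_IV\<close>.\<close>

lemma minimal_noncircular_embeds:
  assumes e: "embeds f g a M N" and d: "dim_row M = dim_row N" "dim_col M = dim_col N"
    and M: "minimal_noncircular M"
  shows "minimal_noncircular N"
proof -
  have bounds: "\<And>i. i < dim_row N \<Longrightarrow> f i < dim_row M" "\<And>j. j < dim_col N \<Longrightarrow> g j < dim_col M"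
    and inj: "inj_on f {..<dim_row N}" "inj_on g {..<dim_col N}"
    using e unfolding embeds_def by auto
  have del_f: "f ` ({..<dim_row N} - {i}) \<subseteq> {..<dim_row M} - {f i}" "g ` {..<dim_col N} \<subseteq> {..<dim_col M}"
    if "i < dim_row N" for i
    using bounds inj_on_eq_iff[OF inj(1)] that by auto
  have del_g: "g ` ({..<dim_col N} - {j}) \<subseteq> {..<dim_col M} - {g j}" "f ` {..<dim_row N} \<subseteq> {..<dim_row M}"
    if "j < dim_col N" for j
    using bounds inj_on_eq_iff[OF inj(2)] that by auto
  obtain f' g' where e': "embeds f' g' (\<lambda>i. a (f' i)) N M"
    by (rule embeds_inverse[OF e d], rule that, assumption)
  show ?thesis
    unfolding minimal_noncircular_def
  proof (intro conjI allI impI)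
  show "\<not> circular_within N {..<dim_row N} {..<dim_col N}"
  proof
    assume "circular_within N {..<dim_row N} {..<dim_col N}"
    then have "circular_within M {..<dim_row M} {..<dim_col M}"
      by (rule circular_within_embeds[OF e']) (use e' in \<open>auto simp: embeds_def\<close>)
    then show False using M unfolding minimal_noncircular_def by blast
  qed
  fix i assume i: "i < dim_row N"
  then have fi: "f i < dim_row M" using e by (auto simp: embeds_def)
  then have "circular_within M ({..<dim_row M} - {f i}) {..<dim_col M}"
    using M unfolding minimal_noncircular_def by blast
  then show "circular_within N ({..<dim_row N} - {i}) {..<dim_col N}"
    by (rule circular_within_embeds[OF e]) (use del_f i in auto)
next
  fix i assume i: "i < dim_col N"
  then have fi: "g i < dim_col M" using e by (auto simp: embeds_def)
  then have "circular_within M {..<dim_row M} ({..<dim_col M} - {g i})"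
    using M unfolding minimal_noncircular_def by blast
  then show "circular_within N {..<dim_row N} ({..<dim_col N} - {i})"
    by (rule circular_within_embeds[OF e]) (use del_g i in auto)
  qed
qed

lemma circular_on_interval:
  assumes "\<And>u. u \<in> X \<Longrightarrow> (u \<in> R) \<noteq> c \<longleftrightarrow> lo \<le> f u \<and> f u \<le> hi"
  shows "circular_on f X R"
  unfolding circular_on_def
proof (intro ballI impI)
  fix w x y z assume h: "w \<in> X" "x \<in> X" "y \<in> X" "z \<in> X" "f w < f x" "f x < f y" "f y < f z"
    "w \<in> R \<longleftrightarrow> y \<in> R" "x \<in> R \<longleftrightarrow> z \<in> R"
  then show "w \<in> R \<longleftrightarrow> x \<in> R"
    using assms[of w] assms[of x] assms[of y] assms[of z] by (cases "x \<in> R"; cases "w \<in> R"; cases c) auto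
qed

text \<open>Rotating the circular arrangement so that it starts with \<open>q\<close> makes every row that avoids
  \<open>q\<close> consecutive.\<close>

lemma circular_on_consecutive:
  fixes f :: "'a \<Rightarrow> real"
  assumes fin: "finite X" and inj: "inj_on f X" and q: "q \<in> X"
  obtains g where "inj_on g X"
    "\<And>R. circular_on f X R \<Longrightarrow> q \<notin> R \<Longrightarrow> consecutive g (X - {q}) R"
proof -
  \<comment> \<open>Any two values of \<open>f\<close> differ by less than \<open>C\<close>, so
    adding \<open>C\<close> moves everything before \<open>q\<close> behind all the rest.\<close>
  define C where "C = 2 * Max (insert 0 ((\<lambda>x. \<bar>f x\<bar>) ` X)) + 1"
  have C: "f x < f y + C" if "x \<in> X" "y \<in> X" for x y
  proof -
    have "\<bar>f u\<bar> \<le> Max (insert 0 ((\<lambda>x. \<bar>f x\<bar>) ` X))" if "u \<in> X" for u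
      using fin that by (intro Max_ge) auto
    from this[OF that(1)] this[OF that(2)] show ?thesis unfolding C_def by linarith
  qed
  define g where "g u = (if f u < f q then f u + C else f u)" for u
  have less: "g u < g v \<longleftrightarrow> (if f u < f q \<longleftrightarrow> f v < f q then f u < f v else f v < f q)"
    if "u \<in> X" "v \<in> X" for u v
    using C[OF that] C[OF that(2,1)] by (auto simp: g_def)
  have "inj_on g X"
  proof (rule inj_onI)
    fix u v assume uv: "u \<in> X" "v \<in> X" "g u = g v"
    then have "f u = f v" using C[of u v] C[of v u] unfolding g_def by (auto split: if_splits)
    then show "u = v" using inj uv by (auto dest: inj_onD)
  qed
  moreover have "consecutive g (X - {q}) R" if R: "circular_on f X R" "q \<notin> R" for R
    unfolding consecutive_def
  proof (intro ballI notI)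
    fix u v c assume h: "u \<in> (X - {q}) \<inter> R" "v \<in> (X - {q}) \<inter> R" "c \<in> X - {q} - R" "g u < g c \<and> g c < g v"
    have alt: False if "w \<in> X" "x \<in> X" "y \<in> X" "z \<in> X" "f w < f x" "f x < f y" "f y < f z"
      "w \<in> R \<longleftrightarrow> y \<in> R" "x \<in> R \<longleftrightarrow> z \<in> R" "w \<in> R \<longleftrightarrow> x \<notin> R" for w x y z
      using R(1) that unfolding circular_on_def by blast
    have ne: "f u \<noteq> f q" "f v \<noteq> f q" "f c \<noteq> f q" using inj_onD[OF inj] h q by blast+
    \<comment> \<open>Undoing the cut, \<open>q, u, c, v\<close> appear in one of the four rotations
      of this order, and each of them alternates.\<close>
    have cyc: "f q < f u \<and> f u < f c \<and> f c < f v \<or> f u < f c \<and> f c < f v \<and> f v < f q \<or>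
      f c < f v \<and> f v < f q \<and> f q < f u \<or> f v < f q \<and> f q < f u \<and> f u < f c"
      using h(4) ne less[of u c] less[of c v] h(1-3) by (auto split: if_splits)
    show False
      using cyc alt[of q u c v] alt[of u c v q] alt[of c v q u] alt[of v q u c] h(1-3) q R(2) by auto
  qed
  ultimately show thesis using that by blast
qed

lemma star_M_I_dim [simp]:
  "dim_row (star_mat (M_I k)) = k" "dim_col (star_mat (M_I k)) = Suc k"
  by (simp_all add: star_mat_def M_I_def)

lemma star_M_I_index:
  assumes "3 \<le> k" "i < k" "j < Suc k"
  shows "star_mat (M_I k) $$ (i, j) \<longleftrightarrow> j < k \<and> (j = i \<or> j = Suc i mod k)"
  using assms by (cases "Suc i = k") (auto simp: star_mat_def M_I_def)

lemma star_M_I_row_ones: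
  assumes "3 \<le> k" "i < k"
  shows "row_ones (star_mat (M_I k)) i = {i, Suc i mod k}"
  using assms by (auto simp: row_ones_def star_M_I_index less_Suc_eq)

lemma Suc_mod_exists:
  assumes "3 \<le> k" "i < (k::nat)"
  obtains h where "h < k" "Suc h mod k = i" "h \<noteq> i" "h \<noteq> Suc i mod k"
proof (cases i)
  case 0
  show thesis by (rule that[of "k - 1"]) (use assms 0 in auto)
next
  case (Suc h)
  show thesis by (rule that[of h]) (use assms Suc in \<open>auto simp: mod_Suc\<close>)
qed

text \<open>Cut at the zero column and take the first column \<open>i\<close>. Both cyclic
  neighbours share a row with \<open>i\<close> alone, and the nearer one lies between
  \<open>i\<close> and the farther one.\<close>

lemma star_M_I_not_circular:
  assumes k: "3 \<le> k"
  shows "\<not> circular_within (star_mat (M_I k)) {..<k} {..<Suc k}"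
proof
  assume "circular_within (star_mat (M_I k)) {..<k} {..<Suc k}"
  then obtain f where f: "inj_on f {..<Suc k}" "\<And>i. i < k \<Longrightarrow> circular_on f {..<Suc k} {i, Suc i mod k}"
    unfolding circular_within_def using star_M_I_row_ones[OF k] by auto
  obtain g where g: "inj_on g {..<Suc k}"
    "\<And>R. circular_on f {..<Suc k} R \<Longrightarrow> k \<notin> R \<Longrightarrow> consecutive g ({..<Suc k} - {k}) R"
    using circular_on_consecutive[OF _ f(1), of k] by auto
  have c: "consecutive g {..<k} {i, Suc i mod k}" if "i < k" for i
  proof -
    have "Suc i mod k \<noteq> k" using mod_less_divisor[of k "Suc i"] k by linarith
    then have "k \<notin> {i, Suc i mod k}" "{..<Suc k} - {k} = {..<k}" using that by auto
    then show ?thesis using g(2)[OF f(2)[OF that]] by simp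
  qed
  define i where "i = arg_min_on g {..<k}"
  have i: "i < k" "\<And>u. u < k \<Longrightarrow> g i \<le> g u"
    using arg_min_if_finite[of "{..<k}" g] k unfolding i_def by (auto simp: not_less lessThan_empty_iff)
  have less: "g i < g u" if "u < k" "u \<noteq> i" for u
    using i(2)[OF that(1)] inj_onD[OF g(1), of i u] that i(1) by fastforce
  obtain h where h: "h < k" "Suc h mod k = i" "h \<noteq> i" "h \<noteq> Suc i mod k"
    using Suc_mod_exists[OF k i(1)] .
  let ?s = "Suc i mod k"
  have s: "?s < k" "?s \<noteq> i" using k i(1) by (auto simp: mod_Suc)
  have "g h \<noteq> g ?s" using inj_onD[OF g(1), of h ?s] h s by auto
  then consider "g h < g ?s" | "g ?s < g h" by linarith
  then show False
  proof cases
    case 1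
    then show False using consecutiveD[OF c[OF i(1)], of i ?s h] i(1) h s less[OF h(1,3)] by auto
  next
    case 2
    then show False using consecutiveD[OF c[OF h(1)], of i h ?s] i(1) h s less[OF s] by auto
  qed
qed

lemma star_M_I_minimal_noncircular:
  assumes k: "3 \<le> k"
  shows "minimal_noncircular (star_mat (M_I k))"
proof -
  let ?M = "star_mat (M_I k)"
  \<comment> \<open>The cyclic order starting after \<open>d\<close>: column
    \<open>Suc d mod k\<close> gets position 0, column \<open>d\<close> position
    \<open>k - 1\<close>, and the zero column comes last. Only row \<open>d\<close> is not an
    interval.\<close>
  define f where "f d j = (if j < k then real ((j + (k - Suc d)) mod k) else real k)" for d j
  have mod_inj: "(i + e) mod k = (j + e) mod k \<longleftrightarrow> i = j" if "i < k" "j < k" for i j e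
    using mod_eq_close[of "i + e" "j + e" k] that by auto
  have inj: "inj_on (f d) {..<Suc k}" for d
  proof (rule inj_onI)
    have lt: "(m + (k - Suc d)) mod k \<noteq> k" for m
      using mod_less_divisor[of k "m + (k - Suc d)"] k by linarith
    fix i j assume "i \<in> {..<Suc k}" "j \<in> {..<Suc k}" "f d i = f d j"
    then show "i = j" using mod_inj[of i j "k - Suc d"] lt[of i] lt[of j] unfolding f_def
      by (auto split: if_splits simp: less_Suc_eq)
  qed
  have row: "circular_on (f d) {..<Suc k} {i, Suc i mod k}" if d: "d < k" and i: "i < k" "i \<noteq> d" for d i
  proof -
    let ?e = "k - Suc d"
    define e where "e = (i + ?e) mod k"
    have "(d + ?e) mod k = k - 1" using d by simp
    then have "e \<noteq> k - 1" using mod_inj[OF i(1) d, of ?e] i(2) by (simp add: e_def)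
    moreover have "e < k" using k by (simp add: e_def)
    ultimately have e: "Suc e < k" by simp
    have "(Suc i mod k + ?e) mod k = Suc e mod k"
      by (simp add: e_def mod_add_left_eq mod_Suc_eq)
    then have s: "(Suc i mod k + ?e) mod k = Suc e" using e by simp
    have "u \<in> {i, Suc i mod k} \<longleftrightarrow> real e \<le> f d u \<and> f d u \<le> real (Suc e)" if u: "u \<in> {..<Suc k}" for u
    proof (cases "u < k")
      case True
      have "Suc i mod k < k" using k by simp
      then have "u \<in> {i, Suc i mod k} \<longleftrightarrow> (u + ?e) mod k = e \<or> (u + ?e) mod k = Suc e"
        using mod_inj[OF True i(1), of ?e] mod_inj[OF True, of "Suc i mod k" ?e] s by (auto simp: e_def)
      then show ?thesis using True by (auto simp: f_def)
    next
      case False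
      then show ?thesis using u i e k by (auto simp: f_def)
    qed
    then show ?thesis by (intro circular_on_interval[of _ _ False "real e" _ "real (Suc e)"]) simp
  qed
  have mono: "circular_on g Y R" if "circular_on g X R" "Y \<subseteq> X" for g :: "nat \<Rightarrow> real" and X Y R
    using that unfolding circular_on_def by blast
  have del_row: "circular_within ?M ({..<k} - {d}) {..<Suc k}" if "d < k" for d
    unfolding circular_within_def using inj[of d] row[OF that] star_M_I_row_ones[OF k] by auto
  have del_col: "circular_within ?M {..<k} ({..<Suc k} - {d})" if d: "d < k" for d
  proof -
    have "circular_on (f d) ({..<Suc k} - {d}) {d, Suc d mod k}"
    proof (rule circular_on_interval[of _ _ False 0 _ 0])
      fix u assume u: "u \<in> {..<Suc k} - {d}"
      have "(Suc d mod k + (k - Suc d)) mod k = (Suc d + (k - Suc d)) mod k" by (rule mod_add_left_eq)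
      then have s: "(Suc d mod k + (k - Suc d)) mod k = 0" using d by simp
      have "Suc d mod k < k" using k by simp
      then have "u = Suc d mod k \<longleftrightarrow> (u + (k - Suc d)) mod k = 0" if "u < k"
        using mod_inj[OF that, of "Suc d mod k" "k - Suc d"] s by auto
      then show "(u \<in> {d, Suc d mod k}) \<noteq> False \<longleftrightarrow> 0 \<le> f d u \<and> f d u \<le> 0"
        using u k \<open>Suc d mod k < k\<close> by (auto simp: f_def)
    qed
    moreover have "circular_on (f d) ({..<Suc k} - {d}) {i, Suc i mod k}" if "i < k" "i \<noteq> d" for i
      by (rule mono[OF row[OF d that]]) auto
    ultimately have "circular_on (f d) ({..<Suc k} - {d}) {i, Suc i mod k}" if "i < k" for i
      using that by (cases "i = d") simp_all
    then have "\<forall>i\<in>{..<k}. circular_on (f d) ({..<Suc k} - {d}) (row_ones ?M i)"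
      using star_M_I_row_ones[OF k] by simp
    moreover have "inj_on (f d) ({..<Suc k} - {d})" using inj[of d] by (rule inj_on_subset) auto
    ultimately show ?thesis unfolding circular_within_def by blast
  qed
  have del_star: "circular_within ?M {..<k} ({..<Suc k} - {k})"
  proof -
    have "circular_on real ({..<Suc k} - {k}) {i, Suc i mod k}" if "i < k" for i
    proof (cases "Suc i = k")
      case True
      \<comment> \<open>The last row \<open>{k - 1, 0}\<close> wraps around, so its complement
        serves as the interval.\<close>
      then show ?thesis using k
        by (intro circular_on_interval[of _ _ True 1 _ "real (k - 2)"]) auto
    next
      case False
      then show ?thesis using that
        by (intro circular_on_interval[of _ _ False "real i" _ "real (Suc i)"]) auto
    qed
    then show ?thesis unfolding circular_within_def using star_M_I_row_ones[OF k]
      by (intro exI[of _ real]) auto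
  qed
  show ?thesis
    unfolding minimal_noncircular_def star_M_I_dim
    using star_M_I_not_circular[OF k] del_row del_col del_star by (auto simp: less_Suc_eq)
qed

section \<open>Minimality of the claw\<close>

lemma M_IV_dim [simp]: "dim_row M_IV = 4" "dim_col M_IV = 6"
  by (simp_all add: M_IV_def binary_mat_of_rows_def mat_of_rows_list_def)

lemma M_V_dim [simp]: "dim_row M_V = 4" "dim_col M_V = 5"
  by (simp_all add: M_V_def binary_mat_of_rows_def mat_of_rows_list_def)

lemma less_4_iff: "i < 4 \<longleftrightarrow> i = 0 \<or> i = 1 \<or> i = 2 \<or> i = (3::nat)"
  by auto

lemma less_6_iff: "i < 6 \<longleftrightarrow> i = 0 \<or> i = 1 \<or> i = 2 \<or> i = 3 \<or> i = 4 \<or> i = (5::nat)"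
  by auto

lemma M_IV_index:
  "i < 4 \<Longrightarrow> j < 6 \<Longrightarrow> M_IV $$ (i, j) \<longleftrightarrow> j \<in> [{0, 1}, {2, 3}, {4, 5}, {1, 3, 5::nat}] ! i"
  unfolding less_4_iff less_6_iff
  by (auto simp: M_IV_def binary_mat_of_rows_def mat_of_rows_list_def)

lemma star_M_V_index:
  "i < 4 \<Longrightarrow> j < 6 \<Longrightarrow>
    star_mat M_V $$ (i, j) \<longleftrightarrow> j \<in> [{0, 1}, {0, 1, 2, 3}, {2, 3}, {0, 3, 4::nat}] ! i"
  unfolding less_4_iff less_6_iff
  by (auto simp: star_mat_def M_V_def binary_mat_of_rows_def mat_of_rows_list_def)

lemma M_IV_row_ones:
  "row_ones M_IV 0 = {0, 1}" "row_ones M_IV (Suc 0) = {2, 3}" "row_ones M_IV 2 = {4, 5}" "row_ones M_IV 3 = {1, 3, 5}"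
  unfolding row_ones_def by (auto simp: M_IV_index)

text \<open>Cut at column 0. Row 0 puts column 1 at an end, after which \<open>{2, 3}\<close> and
  \<open>{4, 5}\<close> are two blocks; the nearer block has an even column among the two nearest to
  column 1, so \<open>{1, 3, 5}\<close> is not consecutive.\<close>

lemma M_IV_not_circular: "\<not> circular_within M_IV {..<4} {..<6}"
proof
  assume "circular_within M_IV {..<4} {..<6}"
  then obtain f where f: "inj_on f {..<6}" "\<And>i. i < 4 \<Longrightarrow> circular_on f {..<6} (row_ones M_IV i)"
    unfolding circular_within_def by auto
  obtain g where g: "inj_on g {..<6}"
    and c: "\<And>R. circular_on f {..<6} R \<Longrightarrow> 0 \<notin> R \<Longrightarrow> consecutive g ({..<6} - {0}) R"
    using circular_on_consecutive[OF _ f(1), of 0] by auto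
  have "circular_on f {..<6} ({..<6} - {0, 1})"
    using f(2)[of 0] by (simp add: M_IV_row_ones circular_on_compl)
  then have c0: "consecutive g ({..<6} - {0}) ({..<6} - {0, 1})" by (rule c) simp
  have c1: "consecutive g ({..<6} - {0}) {2, 3}" using f(2)[of 1] by (intro c) (simp_all add: M_IV_row_ones)
  have c2: "consecutive g ({..<6} - {0}) {4, 5}" using f(2)[of 2] by (intro c) (simp_all add: M_IV_row_ones)
  have c3: "consecutive g ({..<6} - {0}) {1, 3, 5}" using f(2)[of 3] by (intro c) (simp_all add: M_IV_row_ones)
  have ne: "g u \<noteq> g v" if "u < 6" "v < 6" "u \<noteq> v" for u v using inj_onD[OF g, of u v] that by auto
  have "\<not> (g 2 < g 1 \<and> g 1 < g 3 \<or> g 3 < g 1 \<and> g 1 < g 2)"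
    "\<not> (g 3 < g 1 \<and> g 1 < g 5 \<or> g 5 < g 1 \<and> g 1 < g 3)"
    "\<not> (g 4 < g 1 \<and> g 1 < g 5 \<or> g 5 < g 1 \<and> g 1 < g 4)"
    using consecutiveD[OF c0, of 2 3 1] consecutiveD[OF c0, of 3 2 1] consecutiveD[OF c0, of 3 5 1]
      consecutiveD[OF c0, of 5 3 1] consecutiveD[OF c0, of 4 5 1] consecutiveD[OF c0, of 5 4 1]
    by auto
  moreover have "\<not> (g 2 < g 5 \<and> g 5 < g 3 \<or> g 3 < g 5 \<and> g 5 < g 2)"
    "\<not> (g 4 < g 3 \<and> g 3 < g 5 \<or> g 5 < g 3 \<and> g 3 < g 4)"
    using consecutiveD[OF c1, of 2 3 5] consecutiveD[OF c1, of 3 2 5] consecutiveD[OF c2, of 4 5 3]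
      consecutiveD[OF c2, of 5 4 3] by auto
  moreover have "\<not> (g 1 < g 2 \<and> g 2 < g 3 \<or> g 3 < g 2 \<and> g 2 < g 1)"
    "\<not> (g 1 < g 2 \<and> g 2 < g 5 \<or> g 5 < g 2 \<and> g 2 < g 1)"
    "\<not> (g 1 < g 4 \<and> g 4 < g 3 \<or> g 3 < g 4 \<and> g 4 < g 1)"
    "\<not> (g 1 < g 4 \<and> g 4 < g 5 \<or> g 5 < g 4 \<and> g 4 < g 1)"
    using consecutiveD[OF c3, of 1 3 2] consecutiveD[OF c3, of 3 1 2]
      consecutiveD[OF c3, of 1 5 4] consecutiveD[OF c3, of 5 1 4]
      consecutiveD[OF c3, of 1 5 2] consecutiveD[OF c3, of 5 1 2]
      consecutiveD[OF c3, of 1 3 4] consecutiveD[OF c3, of 3 1 4] by auto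
  moreover have "g 1 \<noteq> g 2" "g 1 \<noteq> g 3" "g 1 \<noteq> g 4" "g 1 \<noteq> g 5" "g 2 \<noteq> g 3" "g 2 \<noteq> g 5"
    "g 3 \<noteq> g 4" "g 3 \<noteq> g 5" "g 4 \<noteq> g 5" using ne by auto
  ultimately show False by (smt (verit))
qed

text \<open>\<open>xs ! u\<close> is the position of column \<open>u\<close>, and \<open>c\<close>
  tells whether the row or its complement is the interval from \<open>lo\<close> to
  \<open>hi\<close>.\<close>

lemma M_IV_circular_withinI:
  assumes "I \<subseteq> {..<4}" "J \<subseteq> {..<6}" "distinct xs" "length xs = 6"
    "\<And>i. i \<in> I \<Longrightarrow> \<exists>c lo hi. \<forall>u\<in>J. (u \<in> [{0, 1}, {2, 3}, {4, 5}, {1, 3, 5::nat}] ! i) \<noteq> c \<longleftrightarrow> lo \<le> xs ! u \<and> xs ! u \<le> (hi::nat)"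
  shows "circular_within M_IV I J"
proof -
  have "inj_on (\<lambda>u. real (xs ! u)) J"
    using inj_on_nth[OF assms(3), of J] assms(2,4) by (auto simp: inj_on_def)
  moreover have "circular_on (\<lambda>u. real (xs ! u)) J (row_ones M_IV i)" if i: "i \<in> I" for i
  proof -
    obtain c lo hi where h: "\<forall>u\<in>J. (u \<in> [{0, 1}, {2, 3}, {4, 5}, {1, 3, 5::nat}] ! i) \<noteq> c \<longleftrightarrow> lo \<le> xs ! u \<and> xs ! u \<le> hi"
      using assms(5)[OF i] by blast
    show ?thesis
    proof (rule circular_on_interval[of _ _ c "real lo" _ "real hi"])
      fix u assume u: "u \<in> J"
      then have "i < 4" "u < 6" using assms(1,2) i by auto
      then have "u \<in> row_ones M_IV i \<longleftrightarrow> u \<in> [{0, 1}, {2, 3}, {4, 5}, {1, 3, 5::nat}] ! i"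
        by (simp add: row_ones_def M_IV_index)
      then show "(u \<in> row_ones M_IV i) \<noteq> c \<longleftrightarrow> real lo \<le> real (xs ! u) \<and> real (xs ! u) \<le> real hi"
        using h u by simp
    qed
  qed
  ultimately show ?thesis unfolding circular_within_def by blast
qed

lemma M_IV_minimal_noncircular: "minimal_noncircular M_IV"
proof -
  have row0: "circular_within M_IV ({..<4} - {0}) ({..<6})"
  proof (rule M_IV_circular_withinI[of _ _ "[0, 3, 1, 2, 5, 4]"])
    fix i :: nat assume "i \<in> {..<4} - {0}"
    then consider "i = 1" | "i = 2" | "i = 3" by force
    then show "\<exists>c lo hi. \<forall>u\<in>{..<6}. (u \<in> [{0, 1}, {2, 3}, {4, 5}, {1, 3, 5::nat}] ! i) \<noteq> c \<longleftrightarrow>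
        lo \<le> [0::nat, 3, 1, 2, 5, 4] ! u \<and> [0::nat, 3, 1, 2, 5, 4] ! u \<le> (hi::nat)"
      by cases (rule exI[of _ False], rule exI[of _ 1], rule exI[of _ 2], force simp: less_6_iff,
        rule exI[of _ False], rule exI[of _ 4], rule exI[of _ 5], force simp: less_6_iff,
        rule exI[of _ False], rule exI[of _ 2], rule exI[of _ 4], force simp: less_6_iff)
  qed auto
  have row1: "circular_within M_IV ({..<4} - {1}) ({..<6})"
  proof (rule M_IV_circular_withinI[of _ _ "[0, 1, 5, 2, 4, 3]"])
    fix i :: nat assume "i \<in> {..<4} - {1}"
    then consider "i = 0" | "i = 2" | "i = 3" by force
    then show "\<exists>c lo hi. \<forall>u\<in>{..<6}. (u \<in> [{0, 1}, {2, 3}, {4, 5}, {1, 3, 5::nat}] ! i) \<noteq> c \<longleftrightarrow>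
        lo \<le> [0::nat, 1, 5, 2, 4, 3] ! u \<and> [0::nat, 1, 5, 2, 4, 3] ! u \<le> (hi::nat)"
      by cases (rule exI[of _ False], rule exI[of _ 0], rule exI[of _ 1], force simp: less_6_iff,
        rule exI[of _ False], rule exI[of _ 3], rule exI[of _ 4], force simp: less_6_iff,
        rule exI[of _ False], rule exI[of _ 1], rule exI[of _ 3], force simp: less_6_iff)
  qed auto
  have row2: "circular_within M_IV ({..<4} - {2}) ({..<6})"
  proof (rule M_IV_circular_withinI[of _ _ "[0, 1, 4, 3, 5, 2]"])
    fix i :: nat assume "i \<in> {..<4} - {2}"
    then consider "i = 0" | "i = 1" | "i = 3" by force
    then show "\<exists>c lo hi. \<forall>u\<in>{..<6}. (u \<in> [{0, 1}, {2, 3}, {4, 5}, {1, 3, 5::nat}] ! i) \<noteq> c \<longleftrightarrow>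
        lo \<le> [0::nat, 1, 4, 3, 5, 2] ! u \<and> [0::nat, 1, 4, 3, 5, 2] ! u \<le> (hi::nat)"
      by cases (rule exI[of _ False], rule exI[of _ 0], rule exI[of _ 1], force simp: less_6_iff,
        rule exI[of _ False], rule exI[of _ 3], rule exI[of _ 4], force simp: less_6_iff,
        rule exI[of _ False], rule exI[of _ 1], rule exI[of _ 3], force simp: less_6_iff)
  qed auto
  have row3: "circular_within M_IV ({..<4} - {3}) ({..<6})"
  proof (rule M_IV_circular_withinI[of _ _ "[0, 1, 2, 3, 4, 5]"])
    fix i :: nat assume "i \<in> {..<4} - {3}"
    then consider "i = 0" | "i = 1" | "i = 2" by force
    then show "\<exists>c lo hi. \<forall>u\<in>{..<6}. (u \<in> [{0, 1}, {2, 3}, {4, 5}, {1, 3, 5::nat}] ! i) \<noteq> c \<longleftrightarrow>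
        lo \<le> [0::nat, 1, 2, 3, 4, 5] ! u \<and> [0::nat, 1, 2, 3, 4, 5] ! u \<le> (hi::nat)"
      by cases (rule exI[of _ False], rule exI[of _ 0], rule exI[of _ 1], force simp: less_6_iff,
        rule exI[of _ False], rule exI[of _ 2], rule exI[of _ 3], force simp: less_6_iff,
        rule exI[of _ False], rule exI[of _ 4], rule exI[of _ 5], force simp: less_6_iff)
  qed auto
  have col0: "circular_within M_IV ({..<4}) ({..<6} - {0})"
  \<comment> \<open>In this and the following cases, 6 is a dummy position for the deleted column
    that keeps the list distinct.\<close>
  proof (rule M_IV_circular_withinI[of _ _ "[6, 0, 2, 1, 3, 4]"])
    fix i :: nat assume "i \<in> {..<4}"
    then consider "i = 0" | "i = 1" | "i = 2" | "i = 3" by force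
    then show "\<exists>c lo hi. \<forall>u\<in>{..<6} - {0}. (u \<in> [{0, 1}, {2, 3}, {4, 5}, {1, 3, 5::nat}] ! i) \<noteq> c \<longleftrightarrow>
        lo \<le> [6::nat, 0, 2, 1, 3, 4] ! u \<and> [6::nat, 0, 2, 1, 3, 4] ! u \<le> (hi::nat)"
      by cases (rule exI[of _ False], rule exI[of _ 0], rule exI[of _ 0], force simp: less_6_iff,
        rule exI[of _ False], rule exI[of _ 1], rule exI[of _ 2], force simp: less_6_iff,
        rule exI[of _ False], rule exI[of _ 3], rule exI[of _ 4], force simp: less_6_iff,
        rule exI[of _ True], rule exI[of _ 2], rule exI[of _ 3], force simp: less_6_iff)
  qed auto
  have col1: "circular_within M_IV ({..<4}) ({..<6} - {1})"
  proof (rule M_IV_circular_withinI[of _ _ "[0, 6, 1, 2, 4, 3]"])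
    fix i :: nat assume "i \<in> {..<4}"
    then consider "i = 0" | "i = 1" | "i = 2" | "i = 3" by force
    then show "\<exists>c lo hi. \<forall>u\<in>{..<6} - {1}. (u \<in> [{0, 1}, {2, 3}, {4, 5}, {1, 3, 5::nat}] ! i) \<noteq> c \<longleftrightarrow>
        lo \<le> [0::nat, 6, 1, 2, 4, 3] ! u \<and> [0::nat, 6, 1, 2, 4, 3] ! u \<le> (hi::nat)"
      by cases (rule exI[of _ False], rule exI[of _ 0], rule exI[of _ 0], force simp: less_6_iff,
        rule exI[of _ False], rule exI[of _ 1], rule exI[of _ 2], force simp: less_6_iff,
        rule exI[of _ False], rule exI[of _ 3], rule exI[of _ 4], force simp: less_6_iff,
        rule exI[of _ False], rule exI[of _ 2], rule exI[of _ 3], force simp: less_6_iff)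
  qed auto
  have col2: "circular_within M_IV ({..<4}) ({..<6} - {2})"
  proof (rule M_IV_circular_withinI[of _ _ "[0, 1, 6, 2, 4, 3]"])
    fix i :: nat assume "i \<in> {..<4}"
    then consider "i = 0" | "i = 1" | "i = 2" | "i = 3" by force
    then show "\<exists>c lo hi. \<forall>u\<in>{..<6} - {2}. (u \<in> [{0, 1}, {2, 3}, {4, 5}, {1, 3, 5::nat}] ! i) \<noteq> c \<longleftrightarrow>
        lo \<le> [0::nat, 1, 6, 2, 4, 3] ! u \<and> [0::nat, 1, 6, 2, 4, 3] ! u \<le> (hi::nat)"
      by cases (rule exI[of _ False], rule exI[of _ 0], rule exI[of _ 1], force simp: less_6_iff,
        rule exI[of _ False], rule exI[of _ 2], rule exI[of _ 2], force simp: less_6_iff,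
        rule exI[of _ False], rule exI[of _ 3], rule exI[of _ 4], force simp: less_6_iff,
        rule exI[of _ False], rule exI[of _ 1], rule exI[of _ 3], force simp: less_6_iff)
  qed auto
  have col3: "circular_within M_IV ({..<4}) ({..<6} - {3})"
  proof (rule M_IV_circular_withinI[of _ _ "[0, 1, 4, 6, 3, 2]"])
    fix i :: nat assume "i \<in> {..<4}"
    then consider "i = 0" | "i = 1" | "i = 2" | "i = 3" by force
    then show "\<exists>c lo hi. \<forall>u\<in>{..<6} - {3}. (u \<in> [{0, 1}, {2, 3}, {4, 5}, {1, 3, 5::nat}] ! i) \<noteq> c \<longleftrightarrow>
        lo \<le> [0::nat, 1, 4, 6, 3, 2] ! u \<and> [0::nat, 1, 4, 6, 3, 2] ! u \<le> (hi::nat)"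
      by cases (rule exI[of _ False], rule exI[of _ 0], rule exI[of _ 1], force simp: less_6_iff,
        rule exI[of _ False], rule exI[of _ 4], rule exI[of _ 4], force simp: less_6_iff,
        rule exI[of _ False], rule exI[of _ 2], rule exI[of _ 3], force simp: less_6_iff,
        rule exI[of _ False], rule exI[of _ 1], rule exI[of _ 2], force simp: less_6_iff)
  qed auto
  have col4: "circular_within M_IV ({..<4}) ({..<6} - {4})"
  proof (rule M_IV_circular_withinI[of _ _ "[0, 1, 4, 3, 6, 2]"])
    fix i :: nat assume "i \<in> {..<4}"
    then consider "i = 0" | "i = 1" | "i = 2" | "i = 3" by force
    then show "\<exists>c lo hi. \<forall>u\<in>{..<6} - {4}. (u \<in> [{0, 1}, {2, 3}, {4, 5}, {1, 3, 5::nat}] ! i) \<noteq> c \<longleftrightarrow>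
        lo \<le> [0::nat, 1, 4, 3, 6, 2] ! u \<and> [0::nat, 1, 4, 3, 6, 2] ! u \<le> (hi::nat)"
      by cases (rule exI[of _ False], rule exI[of _ 0], rule exI[of _ 1], force simp: less_6_iff,
        rule exI[of _ False], rule exI[of _ 3], rule exI[of _ 4], force simp: less_6_iff,
        rule exI[of _ False], rule exI[of _ 2], rule exI[of _ 2], force simp: less_6_iff,
        rule exI[of _ False], rule exI[of _ 1], rule exI[of _ 3], force simp: less_6_iff)
  qed auto
  have col5: "circular_within M_IV ({..<4}) ({..<6} - {5})"
  proof (rule M_IV_circular_withinI[of _ _ "[0, 1, 3, 2, 4, 6]"])
    fix i :: nat assume "i \<in> {..<4}"
    then consider "i = 0" | "i = 1" | "i = 2" | "i = 3" by force
    then show "\<exists>c lo hi. \<forall>u\<in>{..<6} - {5}. (u \<in> [{0, 1}, {2, 3}, {4, 5}, {1, 3, 5::nat}] ! i) \<noteq> c \<longleftrightarrow>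
        lo \<le> [0::nat, 1, 3, 2, 4, 6] ! u \<and> [0::nat, 1, 3, 2, 4, 6] ! u \<le> (hi::nat)"
      by cases (rule exI[of _ False], rule exI[of _ 0], rule exI[of _ 1], force simp: less_6_iff,
        rule exI[of _ False], rule exI[of _ 2], rule exI[of _ 3], force simp: less_6_iff,
        rule exI[of _ False], rule exI[of _ 4], rule exI[of _ 4], force simp: less_6_iff,
        rule exI[of _ False], rule exI[of _ 1], rule exI[of _ 2], force simp: less_6_iff)
  qed auto
  show ?thesis unfolding minimal_noncircular_def M_IV_dim
    using M_IV_not_circular row0 row1 row2 row3 col0 col1 col2 col3 col4 col5
    by (auto simp: less_4_iff less_6_iff)
qed

lemma embeds_compl: "embeds f g a M N \<Longrightarrow> embeds f g (\<lambda>i. \<not> a i) M (compl_mat N)"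
  by (auto simp: embeds_def compl_mat_def)

lemma star_M_V_dim [simp]: "dim_row (star_mat M_V) = 4" "dim_col (star_mat M_V) = 6"
  by (simp_all add: star_mat_def)

lemma M_IV_embeds_star_M_V_aux:
  assumes "distinct s" "distinct p" "length s = 4" "length p = 6" "set s \<subseteq> {..<4}" "set p \<subseteq> {..<6}"
    "\<forall>i<4. \<forall>j<6. j \<in> [{0, 1}, {0, 1, 2, 3}, {2, 3}, {0, 3, 4::nat}] ! i \<longleftrightarrow>
      (p ! j \<in> [{0, 1}, {2, 3}, {4, 5}, {1, 3, 5::nat}] ! (s ! i)) \<noteq> a (s ! i)"
  shows "\<exists>f g. embeds f g (\<lambda>i. a (f i)) M_IV (star_mat M_V)"
proof (intro exI)
  have "s ! i < 4" if "i < 4" for i using subsetD[OF assms(5) nth_mem, of i] that assms(3) by simp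
  moreover have "p ! j < 6" if "j < 6" for j using subsetD[OF assms(6) nth_mem, of j] that assms(4) by simp
  ultimately show "embeds ((!) s) ((!) p) (\<lambda>i. a (s ! i)) M_IV (star_mat M_V)"
    unfolding embeds_def using inj_on_nth[OF assms(1)] inj_on_nth[OF assms(2)] assms(3,4,7)
    by (simp add: M_IV_index star_M_V_index)
qed

text \<open>With row 1 complemented, \<open>star_mat M_V\<close> has the pairs
  \<open>{0, 1}\<close>, \<open>{4, 5}\<close>, \<open>{2, 3}\<close> and the transversal
  \<open>{0, 3, 4}\<close>. So row 1 goes to the flipped pair row, and \<open>a 3\<close> fixes the
  order inside the pairs.\<close>

lemma M_IV_embeds_star_M_V:
  assumes "a 0 \<and> \<not> a 1 \<and> \<not> a 2 \<or> \<not> a 0 \<and> a 1 \<and> \<not> a 2 \<or> \<not> a 0 \<and> \<not> a 1 \<and> a 2"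
  shows "\<exists>f g. embeds f g (\<lambda>i. a (f i)) M_IV (star_mat M_V)"
proof -
  consider "\<not> a 0" "\<not> a 1" "a 2" "\<not> a 3"
    | "\<not> a 0" "\<not> a 1" "a 2" "a 3"
    | "\<not> a 0" "a 1" "\<not> a 2" "\<not> a 3"
    | "\<not> a 0" "a 1" "\<not> a 2" "a 3"
    | "a 0" "\<not> a 1" "\<not> a 2" "\<not> a 3"
    | "a 0" "\<not> a 1" "\<not> a 2" "a 3"
    using assms by blast
  then show ?thesis
  proof cases
    case 1
    then show ?thesis by (intro M_IV_embeds_star_M_V_aux[of "[0, 2, 1, 3]" "[1, 0, 2, 3, 5, 4]"]) (auto simp: less_4_iff less_6_iff)
  next
    case 2
    then show ?thesis by (intro M_IV_embeds_star_M_V_aux[of "[0, 2, 1, 3]" "[0, 1, 3, 2, 4, 5]"]) (auto simp: less_4_iff less_6_iff)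
  next
    case 3
    then show ?thesis by (intro M_IV_embeds_star_M_V_aux[of "[0, 1, 2, 3]" "[1, 0, 4, 5, 3, 2]"]) (auto simp: less_4_iff less_6_iff)
  next
    case 4
    then show ?thesis by (intro M_IV_embeds_star_M_V_aux[of "[0, 1, 2, 3]" "[0, 1, 5, 4, 2, 3]"]) (auto simp: less_4_iff less_6_iff)
  next
    case 5
    then show ?thesis by (intro M_IV_embeds_star_M_V_aux[of "[1, 0, 2, 3]" "[3, 2, 4, 5, 1, 0]"]) (auto simp: less_4_iff less_6_iff)
  next
    case 6
    then show ?thesis by (intro M_IV_embeds_star_M_V_aux[of "[1, 0, 2, 3]" "[2, 3, 5, 4, 0, 1]"]) (auto simp: less_4_iff less_6_iff)
  qed
qed

text \<open>Flipping the transversal amounts to swapping the columns of every pair, and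
  complementing the whole matrix reduces two or three flipped pairs to one or none. The flags are
  indexed by the rows of \<open>M_IV\<close> so that they cancel in
  \<open>embeds_trans\<close>.\<close>

lemma M_IV_flips:
  "\<exists>N\<in>{M_IV, compl_mat M_IV, star_mat M_V, compl_mat (star_mat M_V)}.
    \<exists>f g. embeds f g (\<lambda>i. a (f i)) M_IV N"
proof -
  have base: "\<exists>f g. embeds f g (\<lambda>i. a (f i)) M_IV M_IV" if "\<not> a 0" "\<not> a 1" "\<not> a 2" for a
  proof (cases "a 3")
    case False
    have "embeds id id (\<lambda>i. a (id i)) M_IV M_IV" using that False by (auto simp: embeds_def less_4_iff)
    then show ?thesis by blast
  next
    case True
    have "inj_on ((!) [1, 0, 3, 2, 5, 4::nat]) {..<6}" by (rule inj_on_nth) auto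
    then have "embeds id ((!) [1, 0, 3, 2, 5, 4]) (\<lambda>i. a (id i)) M_IV M_IV"
      unfolding embeds_def using that True
      by (auto simp: less_4_iff less_6_iff M_IV_index)
    then show ?thesis by blast
  qed
  have compl: "\<exists>f g. embeds f g (\<lambda>i. a (f i)) M_IV (compl_mat N)"
    if "\<exists>f g. embeds f g (\<lambda>i. \<not> a (f i)) M_IV N" for N
    using that embeds_compl by fastforce
  consider "\<not> a 0" "\<not> a 1" "\<not> a 2" | "a 0" "a 1" "a 2"
    | "a 0 \<and> \<not> a 1 \<and> \<not> a 2 \<or> \<not> a 0 \<and> a 1 \<and> \<not> a 2 \<or> \<not> a 0 \<and> \<not> a 1 \<and> a 2"
    | "\<not> a 0 \<and> a 1 \<and> a 2 \<or> a 0 \<and> \<not> a 1 \<and> a 2 \<or> a 0 \<and> a 1 \<and> \<not> a 2" by blast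
  then show ?thesis
  proof cases
    case 1
    then show ?thesis using base[of a] by blast
  next
    case 2
    then show ?thesis using base[of "\<lambda>i. \<not> a i"] compl[of M_IV] by blast
  next
    case 3
    then show ?thesis using M_IV_embeds_star_M_V[of a] by blast
  next
    case 4
    then show ?thesis using M_IV_embeds_star_M_V[of "\<lambda>i. \<not> a i"] compl[of "star_mat M_V"] by blast
  qed
qed

section \<open>Bracelets\<close>

definition row_sets :: "bool mat \<Rightarrow> nat set set" where
  "row_sets M = {R. \<exists>i<dim_row M. R = row_ones M i \<or> R = {..<dim_col M} - row_ones M i}"

lemma row_ones_subset: "row_ones M i \<subseteq> {..<dim_col M}"
  by (auto simp: row_ones_def)

lemma obstruction_if_not_circular:
  assumes "\<not> circular_within M {..<dim_row M} {..<dim_col M}"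
  shows "has_cycle {..<dim_col M} (row_sets M) \<or> has_claw {..<dim_col M} (row_sets M)"
proof (rule ccontr)
  assume no: "\<not> ?thesis"
  have "obstruction_free {..<dim_col M} (row_sets M)"
  proof
    have "{..<dim_col M} - ({..<dim_col M} - row_ones M i) = row_ones M i" for i
      using row_ones_subset by blast
    then show "{..<dim_col M} - R \<in> row_sets M" if "R \<in> row_sets M" for R
      using that unfolding row_sets_def by auto
    show "R \<subseteq> {..<dim_col M}" if "R \<in> row_sets M" for R
      using that row_ones_subset unfolding row_sets_def by blast
  qed (use no in auto)
  from obstruction_free_circular[OF _ this] show False
    using assms unfolding circular_within_def row_sets_def by auto
qed

lemma Suc_mod_cycle:
  fixes i k :: nat
  assumes "3 \<le> k" "i < k"
  shows "Suc i mod k \<noteq> i" "Suc (Suc i mod k) mod k \<noteq> i" "Suc i mod k < k"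
  using assms by (auto simp: mod_Suc)

lemma Suc_mod_inj:
  fixes i j k :: nat
  assumes "i < k" "j < k" "Suc i mod k = Suc j mod k"
  shows "i = j"
  using assms by (auto simp: mod_Suc split: if_splits)

text \<open>For k >= 3 the incidence pattern forces the rows and columns found to be distinct.
  Flipping row \<open>i\<close> by its entry in column \<open>q\<close> makes that column
  zero.\<close>

lemma has_cycle_embeds:
  assumes "has_cycle {..<dim_col M} (row_sets M)"
  shows "\<exists>k\<ge>3. \<exists>f g a. embeds f g a M (star_mat (M_I k))"
proof -
  obtain k p q where k: "3 \<le> k" and p: "\<forall>i<k. p i < dim_col M" and q: "q < dim_col M"
    and rows: "\<forall>i<k. \<exists>R\<in>row_sets M. \<forall>j<k. (p j \<in> R \<longleftrightarrow> q \<notin> R) \<longleftrightarrow> j = i \<or> j = Suc i mod k"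
    using assms unfolding has_cycle_def lessThan_iff by blast
  have "\<exists>r. r < dim_row M \<and> (\<forall>j<k. (M $$ (r, p j) \<noteq> M $$ (r, q)) \<longleftrightarrow> j = i \<or> j = Suc i mod k)" if i: "i < k" for i
  proof -
    obtain R where R: "R \<in> row_sets M" "\<forall>j<k. (p j \<in> R \<longleftrightarrow> q \<notin> R) \<longleftrightarrow> j = i \<or> j = Suc i mod k"
      using rows[THEN spec, THEN mp, OF i] by (elim bexE)
    obtain r where r: "r < dim_row M" "R = row_ones M r \<or> R = {..<dim_col M} - row_ones M r"
      using R(1) unfolding row_sets_def by blast
    have "(M $$ (r, p j) \<noteq> M $$ (r, q)) \<longleftrightarrow> (p j \<in> R \<longleftrightarrow> q \<notin> R)" if "j < k" for j
      using r(2) p q that by (auto simp: row_ones_def)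
    then show ?thesis using R(2) r(1) by auto
  qed
  then obtain r where r: "\<And>i. i < k \<Longrightarrow> r i < dim_row M"
    "\<And>i j. i < k \<Longrightarrow> j < k \<Longrightarrow> (M $$ (r i, p j) \<noteq> M $$ (r i, q)) \<longleftrightarrow> j = i \<or> j = Suc i mod k"
    by metis
  note cyc = Suc_mod_cycle[OF k]
  have "inj_on r {..<k}"
  proof (rule inj_onI, rule ccontr)
    fix i j assume ij: "i \<in> {..<k}" "j \<in> {..<k}" "r i = r j" "i \<noteq> j"
    then have e: "t = i \<or> t = Suc i mod k \<longleftrightarrow> t = j \<or> t = Suc j mod k" if "t < k" for t
      using r(2)[of i t] r(2)[of j t] that by auto
    show False using e[of i] e[of j] ij cyc[of i] cyc[of j] by auto
  qed
  moreover define g where "g j = (if j < k then p j else q)" for j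
  have "inj_on g {..<Suc k}"
  proof (rule inj_onI, rule ccontr)
    fix i j assume ij: "i \<in> {..<Suc k}" "j \<in> {..<Suc k}" "g i = g j" "i \<noteq> j"
    have pq: "p t \<noteq> q" if "t < k" for t using r(2)[of t t] that by auto
    then have lt: "i < k" "j < k" "p i = p j" using ij unfolding g_def by (auto split: if_splits)
    then have e: "i = t \<or> i = Suc t mod k \<longleftrightarrow> j = t \<or> j = Suc t mod k" if "t < k" for t
      using r(2)[of t i] r(2)[of t j] that by auto
    show False using e[of i] e[of j] ij lt cyc[of i] cyc[of j] by auto
  qed
  moreover have "star_mat (M_I k) $$ (i, j) \<longleftrightarrow> M $$ (r i, g j) \<noteq> M $$ (r i, q)"
    if "i < k" "j < Suc k" for i j
    using r(2)[OF that(1), of j] that k by (auto simp: star_M_I_index g_def)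
  ultimately have "embeds r g (\<lambda>i. M $$ (r i, q)) M (star_mat (M_I k))"
    unfolding embeds_def star_M_I_dim using r(1) p q by (simp add: g_def)
  then show ?thesis using k by blast
qed

lemma has_claw_embeds:
  assumes "has_claw {..<dim_col M} (row_sets M)"
  shows "\<exists>f g a. embeds f g a M M_IV"
proof -
  have row: "\<exists>r<dim_row M. separates (row_ones M r) U V"
    if h: "R \<in> row_sets M" "separates R U V" "U \<subseteq> {..<dim_col M}" "V \<subseteq> {..<dim_col M}" for R U V
  proof -
    obtain r where r: "r < dim_row M" "R = row_ones M r \<or> R = {..<dim_col M} - row_ones M r"
      using h(1) unfolding row_sets_def by blast
    have "separates (row_ones M r) U V" using r(2) h(2-4) unfolding separates_def by auto
    then show ?thesis using r(1) by blast
  qed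
  obtain a a' b b' c c' Ra Rb Rc T where X: "{a, a', b, b', c, c'} \<subseteq> {..<dim_col M}"
    and R: "Ra \<in> row_sets M" "separates Ra {a, a'} {b, b', c, c'}"
      "Rb \<in> row_sets M" "separates Rb {b, b'} {a, a', c, c'}"
      "Rc \<in> row_sets M" "separates Rc {c, c'} {a, a', b, b'}"
      "T \<in> row_sets M" "separates T {a, b, c} {a', b', c'}"
    using assms unfolding has_claw_def by (elim exE conjE bexE) (rule that)
  obtain r0 where r0: "r0 < dim_row M" "separates (row_ones M r0) {a, a'} {b, b', c, c'}"
    using row[OF R(1,2)] X by auto
  obtain r1 where r1: "r1 < dim_row M" "separates (row_ones M r1) {b, b'} {a, a', c, c'}"
    using row[OF R(3,4)] X by auto
  obtain r2 where r2: "r2 < dim_row M" "separates (row_ones M r2) {c, c'} {a, a', b, b'}"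
    using row[OF R(5,6)] X by auto
  obtain r3 where r3: "r3 < dim_row M" "separates (row_ones M r3) {a, b, c} {a', b', c'}"
    using row[OF R(7,8)] X by auto
  \<comment> \<open>The order of \<open>?g\<close> puts \<open>a\<close>, \<open>b\<close>,
    \<open>c\<close> at the columns 1, 3, 5 of the transversal; \<open>?neg\<close> flips a row when
    the side it should mark is outside it.\<close>
  let ?f = "[r0, r1, r2, r3]" and ?g = "[a', a, b', b, c', c]"
  let ?neg = "\<lambda>i. [a, b, c, a] ! i \<notin> row_ones M (?f ! i)"
  have "distinct ?f" "distinct ?g" using r0 r1 r2 r3 unfolding separates_def by auto
  then have "inj_on ((!) ?f) {..<4}" "inj_on ((!) ?g) {..<6}" by (auto intro!: inj_on_nth)
  moreover have "M_IV $$ (i, j) \<longleftrightarrow> M $$ (?f ! i, ?g ! j) \<noteq> ?neg i" if "i < 4" "j < 6" for i j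
  proof -
    have "?g ! j < dim_col M" using that X unfolding less_6_iff by auto
    then have "M $$ (?f ! i, ?g ! j) \<longleftrightarrow> ?g ! j \<in> row_ones M (?f ! i)" by (simp add: row_ones_def)
    moreover have "j \<in> [{0, 1}, {2, 3}, {4, 5}, {1, 3, 5}] ! i \<longleftrightarrow> (?g ! j \<in> row_ones M (?f ! i)) \<noteq> ?neg i"
      using that r0(2) r1(2) r2(2) r3(2) unfolding less_4_iff less_6_iff separates_def
      by (elim disjE) simp_all
    ultimately show ?thesis using M_IV_index[OF that] by simp
  qed
  ultimately have "embeds ((!) ?f) ((!) ?g) ?neg M M_IV"
    unfolding embeds_def M_IV_dim using r0(1) r1(1) r2(1) r3(1) X
    by (auto simp: less_4_iff less_6_iff)
  then show ?thesis by blast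
qed

section \<open>Row flips and the symmetries of the cycle\<close>

lemma flip_rows_dim [simp]: "dim_row (flip_rows a M) = dim_row M" "dim_col (flip_rows a M) = dim_col M"
  by (simp_all add: flip_rows_def)

lemma flip_rows_index:
  "i < dim_row M \<Longrightarrow> j < dim_col M \<Longrightarrow> flip_rows a M $$ (i, j) \<longleftrightarrow> M $$ (i, j) \<noteq> a ! i"
  by (simp add: flip_rows_def)

lemma embeds_flip_rows:
  assumes "embeds f g (\<lambda>_. False) M N" "\<And>i. i < dim_row N \<Longrightarrow> b ! i \<longleftrightarrow> a i"
  shows "embeds f g a M (flip_rows b N)"
  using assms by (auto simp: embeds_def flip_rows_index)

lemma star_M_I_rotate:
  assumes k: "3 \<le> k"
  shows "embeds (\<lambda>i. Suc i mod k) (\<lambda>j. if j < k then Suc j mod k else j) (\<lambda>_. False)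
    (star_mat (M_I k)) (star_mat (M_I k))"
proof -
  note cyc = Suc_mod_cycle[OF k]
  have "inj_on (\<lambda>i. Suc i mod k) {..<k}" 
  proof (rule inj_onI)
    fix i j assume "i \<in> {..<k}" "j \<in> {..<k}" "Suc i mod k = Suc j mod k"
    then show "i = j" using Suc_mod_inj[of i k j] by simp
  qed
  moreover have "inj_on (\<lambda>j. if j < k then Suc j mod k else j) {..<Suc k}"
  proof (rule inj_onI)
    fix i j assume "i \<in> {..<Suc k}" "j \<in> {..<Suc k}"
      "(if i < k then Suc i mod k else i) = (if j < k then Suc j mod k else j)"
    then show "i = j" using Suc_mod_inj[of i k j] cyc(3)[of i] cyc(3)[of j]
      by (cases "i < k"; cases "j < k") auto
  qed
  moreover have "star_mat (M_I k) $$ (i, j) \<longleftrightarrow>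
      star_mat (M_I k) $$ (Suc i mod k, if j < k then Suc j mod k else j)" if "i < k" "j < Suc k" for i j
  proof (cases "j < k")
    case True
    then have "Suc j mod k < Suc k" using cyc(3) by (simp add: less_SucI)
    from star_M_I_index[OF k cyc(3)[OF that(1)] this] show ?thesis
      using True star_M_I_index[OF k that] cyc(3)[OF True] Suc_mod_inj[OF True that(1)]
        Suc_mod_inj[OF True cyc(3)[OF that(1)]] by auto
  next
    case False
    then show ?thesis using that k cyc(3)[OF that(1)] by (simp add: star_M_I_index)
  qed
  ultimately show ?thesis unfolding embeds_def star_M_I_dim using cyc(3) by (auto simp: less_Suc_eq)
qed

text \<open>Negating the column index modulo \<open>k\<close> sends the pair of row \<open>i\<close>
  to that of row \<open>k - 1 - i\<close>, which matches \<open>rev\<close> on flip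
  sequences.\<close>

lemma star_M_I_reverse:
  assumes k: "3 \<le> k"
  shows "embeds (\<lambda>i. k - 1 - i) (\<lambda>j. if j < k then (k - j) mod k else j) (\<lambda>_. False)
    (star_mat (M_I k)) (star_mat (M_I k))"
proof -
  define h where "h j = (if j < k then (k - j) mod k else j)" for j
  have h: "h j = (if j = 0 then 0 else if j < k then k - j else j)" for j
    using k by (auto simp: h_def)
  define r where "r i = k - 1 - i" for i
  have "inj_on r {..<k}" "inj_on h {..<Suc k}"
    by (rule inj_onI, use k in \<open>auto simp: h r_def split: if_splits\<close>)+
  moreover have "star_mat (M_I k) $$ (i, j) \<longleftrightarrow> star_mat (M_I k) $$ (r i, h j)"
    if "i < k" "j < Suc k" for i j
  proof -
    have "h j < Suc k" using that by (auto simp: h)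
    moreover have "Suc (k - 1 - i) mod k = (if i = 0 then 0 else k - i)" using that by auto
    moreover have "Suc i mod k = (if i = k - 1 then 0 else Suc i)" using that by (cases "Suc i = k") auto
    ultimately show ?thesis using that k
      by (cases "j = 0"; cases "j < k") (auto simp: star_M_I_index h r_def)
  qed
  ultimately have "embeds r h (\<lambda>_. False) (star_mat (M_I k)) (star_mat (M_I k))"
    unfolding embeds_def star_M_I_dim using k by (auto simp: h r_def)
  then show ?thesis unfolding h_def[abs_def] r_def[abs_def] .
qed

text \<open>Shifts and reversals are induced by symmetries of the cycle that act on rows. A backward
  step of the equivalence closure uses the inverse symmetry.\<close>

lemma bracelet_equiv_embeds:
  assumes "bracelet_equiv a b" and k: "3 \<le> k" "length a = k"
  shows "length b = k \<and> (\<exists>f g. embeds f g (\<lambda>_. False) (star_mat (M_I k)) (star_mat (M_I k)) \<and>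
    (\<forall>i<k. b ! i = a ! f i))"
  using assms(1) unfolding bracelet_equiv_def
proof (induction rule: equivclp_induct)
  case base
  have "embeds id id (\<lambda>_. False) (star_mat (M_I k)) (star_mat (M_I k))" by (simp add: embeds_def)
  then show ?case using k by (metis id_apply)
next
  case (step b c)
  let ?N = "star_mat (M_I k)"
  obtain f g where f: "embeds f g (\<lambda>_. False) ?N ?N" "\<forall>i<k. b ! i = a ! f i" and lb: "length b = k"
    using step.IH by blast
  have move: "\<exists>f g. embeds f g (\<lambda>_. False) ?N ?N \<and> (\<forall>i<k. d ! i = c ! f i)"
    if "d = rotate1 c \<or> d = rev c" "length c = k" for c d :: "bool list"
    using that(1)
  proof
    assume "d = rotate1 c"
    then have "\<forall>i<k. d ! i = c ! (Suc i mod k)" using that(2) by (simp add: nth_rotate1)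
    then show ?thesis using star_M_I_rotate[OF k(1)] by blast
  next
    assume "d = rev c"
    then have "\<forall>i<k. d ! i = c ! (k - 1 - i)" using that(2) by (simp add: rev_nth)
    then show ?thesis using star_M_I_reverse[OF k(1)] by blast
  qed
  have lc: "length c = k" using step.hyps(2) lb by auto
  have "\<exists>f g. embeds f g (\<lambda>_. False) ?N ?N \<and> (\<forall>i<k. c ! i = b ! f i)"
  proof (cases "c = rotate1 b \<or> c = rev b")
    case True
    then show ?thesis using move lb by blast
  next
    case False
    then have "b = rotate1 c \<or> b = rev c" using step.hyps(2) by blast
    then obtain f g where f: "embeds f g (\<lambda>_. False) ?N ?N" "\<forall>i<k. b ! i = c ! f i"
      using move lc by blast
    obtain f' g' where f': "embeds f' g' (\<lambda>i. False) ?N ?N" "\<And>i. i < dim_row ?N \<Longrightarrow> f (f' i) = i"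
      "\<And>i. i < dim_row ?N \<Longrightarrow> f' i < dim_row ?N"
      by (rule embeds_inverse[OF f(1)]) auto
    have "\<forall>i<k. c ! i = b ! f' i" using f(2) f'(2,3) by auto
    then show ?thesis using f'(1) by blast
  qed
  then obtain f' g' where f': "embeds f' g' (\<lambda>_. False) ?N ?N" "\<forall>i<k. c ! i = b ! f' i" by blast
  have "embeds (f \<circ> f') (g \<circ> g') (\<lambda>_. False) ?N ?N" using embeds_trans[OF f(1) f'(1)] by simp
  moreover have "\<forall>i<k. c ! i = a ! (f \<circ> f') i" using f(2) f'(2) f'(1) by (auto simp: embeds_def)
  ultimately show ?case using lc by blast
qed

lemma bracelet_exists: "\<exists>b. bracelet_equiv a b \<and> bracelet b"
proof -
  let ?E = "{b. bracelet_equiv a b}"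
  have "length b = length a" if "bracelet_equiv a b" for b
    using that unfolding bracelet_equiv_def by (induction rule: equivclp_induct) auto
  then have "?E \<subseteq> {b. set b \<subseteq> UNIV \<and> length b = length a}" by auto
  then have fin: "finite ?E" using finite_lists_length_eq[of "UNIV :: bool set"] finite_subset by fastforce
  have "\<exists>m\<in>A. \<forall>b\<in>A. lexordp_eq m b" if "finite A" "A \<noteq> {}" for A :: "bool list set"
    using that
  proof (induction rule: finite_ne_induct)
    case (singleton x)
    then show ?case by (simp add: lexordp_eq_refl)
  next
    case (insert x F)
    then obtain m where m: "m \<in> F" "\<forall>b\<in>F. lexordp_eq m b" by blast
    show ?case
    proof (cases "lexordp_eq x m")
      case True
      then have "\<forall>b\<in>insert x F. lexordp_eq x b"
        using m by (auto simp: lexordp_eq_refl intro: lexordp_eq_trans)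
      then show ?thesis by blast
    next
      case False
      then have "\<forall>b\<in>insert x F. lexordp_eq m b" using m lexordp_eq_linear[of x m] by auto
      then show ?thesis using m(1) by blast
    qed
  qed
  moreover have "a \<in> ?E" by (simp add: bracelet_equiv_def)
  ultimately obtain m where m: "bracelet_equiv a m" "\<forall>b. bracelet_equiv a b \<longrightarrow> lexordp_eq m b"
    using fin by (metis empty_iff mem_Collect_eq)
  have "bracelet_equiv a b" if "bracelet_equiv m b" for b
    using m(1) that unfolding bracelet_equiv_def by (rule equivclp_trans)
  then show ?thesis using m unfolding bracelet_def by blast
qed

lemma less_3_iff: "i < 3 \<longleftrightarrow> i = 0 \<or> i = 1 \<or> i = (2::nat)"
  by auto

text \<open>A double transposition of the four columns preserves one of the three splits and
  exchanges the sides of the other two. So two flags can be toggled at once, which makes all three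
  equal.\<close>

lemma star_M_I_3_flips:
  "\<exists>b\<in>bracelets 3. \<exists>f g. embeds f g (\<lambda>i. a (f i)) (star_mat (M_I 3)) (flip_rows b (star_mat (M_I 3)))"
proof -
  have *: "\<exists>f g. embeds f g (\<lambda>i. a (f i)) (star_mat (M_I 3)) (flip_rows [c, c, c] (star_mat (M_I 3)))"
    if "distinct p" "length p = 4" "set p \<subseteq> {..<4}"
      "\<forall>i<3. \<forall>j<4. (j < 3 \<and> (j = i \<or> j = Suc i mod 3)) \<noteq> c \<longleftrightarrow>
        (p ! j < 3 \<and> (p ! j = i \<or> p ! j = Suc i mod 3)) \<noteq> a i" for p c
  proof -
    have "p ! j < 4" if "j < 4" for j
      using subsetD[OF \<open>set p \<subseteq> {..<4}\<close> nth_mem, of j] that \<open>length p = 4\<close> by simp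
    moreover have "inj_on ((!) p) {..<4}" using that by (intro inj_on_nth) auto
    moreover have "[c, c, c] ! i = c" if "i < 3" for i using that unfolding less_3_iff by auto
    ultimately have "embeds id ((!) p) (\<lambda>i. a (id i)) (star_mat (M_I 3)) (flip_rows [c, c, c] (star_mat (M_I 3)))"
      unfolding embeds_def using that(4) by (simp add: flip_rows_index star_M_I_index)
    then show ?thesis by blast
  qed
  have "\<exists>c. \<exists>f g. embeds f g (\<lambda>i. a (f i)) (star_mat (M_I 3)) (flip_rows [c, c, c] (star_mat (M_I 3)))"
  proof -
    consider "a 0 \<longleftrightarrow> a 1" "a 1 \<longleftrightarrow> a 2" | "a 0 \<noteq> a 1" "a 1 \<longleftrightarrow> a 2" | "a 1 \<noteq> a 0" "a 0 \<longleftrightarrow> a 2"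
      | "a 2 \<noteq> a 0" "a 0 \<longleftrightarrow> a 1" by blast
    then show ?thesis
    proof cases
      case 1
      then show ?thesis
        by (intro exI[of _ "a 0"] *[of "[0, 1, 2, 3]"]) (auto simp: less_3_iff less_4_iff)
    next
      case 2
      then show ?thesis
        by (intro exI[of _ "a 0"] *[of "[1, 0, 3, 2]"]) (auto simp: less_3_iff less_4_iff)
    next
      case 3
      then show ?thesis
        by (intro exI[of _ "a 1"] *[of "[3, 2, 1, 0]"]) (auto simp: less_3_iff less_4_iff)
    next
      case 4
      then show ?thesis
        by (intro exI[of _ "a 2"] *[of "[2, 3, 0, 1]"]) (auto simp: less_3_iff less_4_iff)
    qed
  qed
  moreover have "[c, c, c] \<in> bracelets 3" for c by (cases c) (auto simp: bracelets_def)
  ultimately show ?thesis by blast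
qed

lemma star_M_I_flips:
  assumes k: "3 \<le> k"
  shows "\<exists>b\<in>bracelets k. \<exists>f g. embeds f g (\<lambda>i. a (f i)) (star_mat (M_I k)) (flip_rows b (star_mat (M_I k)))"
proof (cases "k = 3")
  case True
  then show ?thesis using star_M_I_3_flips by simp
next
  case False
  obtain b where b: "bracelet_equiv (map a [0..<k]) b" "bracelet b"
    using bracelet_exists by blast
  obtain f g where f: "embeds f g (\<lambda>_. False) (star_mat (M_I k)) (star_mat (M_I k))"
    "\<forall>i<k. b ! i = map a [0..<k] ! f i" and l: "length b = k"
    using bracelet_equiv_embeds[OF b(1) k] by auto
  have "embeds f g (\<lambda>i. a (f i)) (star_mat (M_I k)) (flip_rows b (star_mat (M_I k)))"
    by (rule embeds_flip_rows[OF f(1)]) (use f in \<open>auto simp: embeds_def\<close>)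
  moreover have "b \<in> bracelets k" using False b l by (simp add: bracelets_def)
  ultimately show ?thesis by blast
qed

section \<open>Distinctness of the matrices\<close>

lemma bracelet_equiv_rotate: "bracelet_equiv a (rotate n a)"
proof (induction n)
  case 0
  then show ?case by (simp add: bracelet_equiv_def)
next
  case (Suc n)
  have "bracelet_equiv (rotate n a) (rotate1 (rotate n a))"
    unfolding bracelet_equiv_def by (rule r_into_equivclp) simp
  with Suc show ?case unfolding bracelet_equiv_def rotate_Suc by (rule equivclp_trans)
qed

lemma bracelet_equiv_rev: "bracelet_equiv a (rev a)"
  unfolding bracelet_equiv_def by (rule r_into_equivclp) simp

text \<open>Once the zero column is known to be fixed, its entries give
  \<open>b ! i = a ! f i\<close>, and \<open>f\<close> preserves adjacency on a cycle, so it is a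
  rotation or a reflection.\<close>

lemma flip_star_M_I_bracelet_equiv:
  assumes k: "4 \<le> k" and l: "length a = k" "length b = k"
    and e: "embeds f g (\<lambda>_. False) (flip_rows a (star_mat (M_I k))) (flip_rows b (star_mat (M_I k)))"
  shows "bracelet_equiv a b"
proof -
  let ?N = "star_mat (M_I k)"
  have k3: "3 \<le> k" using k by simp
  note cyc = Suc_mod_cycle[OF k3]
  have f: "inj_on f {..<k}" "\<And>i. i < k \<Longrightarrow> f i < k" and g: "inj_on g {..<Suc k}" "\<And>j. j < Suc k \<Longrightarrow> g j < Suc k"
    using e unfolding embeds_def by auto
  have ent: "(?N $$ (i, j) \<noteq> b ! i) \<longleftrightarrow> (?N $$ (f i, g j) \<noteq> a ! f i)" if "i < k" "j < Suc k" for i j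
    using e f(2) g(2) that unfolding embeds_def by (simp add: flip_rows_index)
  have fsurj: "\<exists>i<k. f i = h" if "h < k" for h
    using endo_inj_surj[of "{..<k}" f] f that by (metis finite_lessThan image_iff image_subsetI lessThan_iff)
  have gsurj: "\<exists>i<Suc k. g i = h" if "h < Suc k" for h
    using endo_inj_surj[of "{..<Suc k}" g] g that by (metis finite_lessThan image_iff image_subsetI lessThan_iff)
  have gk: "g k = k"
  proof (rule ccontr)
    assume "g k \<noteq> k"
    define c where "c = g k"
    have c: "c < k" using g(2)[of k] \<open>g k \<noteq> k\<close> by (simp add: c_def)
    define c1 where "c1 = Suc c mod k"
    define c2 where "c2 = Suc c1 mod k"
    have c12: "c1 < k" "c2 < k" using k by (auto simp: c1_def c2_def)
    have neq: "c1 \<noteq> c" "c2 \<noteq> c" "c2 \<noteq> c1" "Suc c2 mod k \<noteq> c"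
      using k c unfolding c2_def c1_def by (auto simp: mod_Suc)
    obtain j where j: "j < Suc k" "g j = c2" using gsurj[of c2] c12 by auto
    have "j \<noteq> k" using j neq c_def by auto
    then have jk: "j < k" using j by simp
    \<comment> \<open>Flips do not affect whether two columns differ in a row. Columns
      \<open>c\<close> and \<open>c2\<close> differ in the rows \<open>c\<close>, \<open>c1\<close>,
      \<open>c2\<close>, where k >= 4 is needed, whereas column \<open>j\<close> differs from the
      zero column in only two rows.\<close>
    have col: "h' = j \<or> Suc h' mod k = j" if h: "h < k" "?N $$ (h, c) \<noteq> ?N $$ (h, c2)" "h' < k" "f h' = h" for h h'
    proof -
      have "?N $$ (h', j) \<noteq> ?N $$ (h', k)"
        using ent[OF h(3), of j] ent[OF h(3), of k] h(2,4) j jk by (auto simp: c_def)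
      then show ?thesis using h(3) jk k3 by (auto simp: star_M_I_index)
    qed
    have s1: "Suc c1 mod k = c2" "Suc c mod k = c1" by (simp_all add: c1_def c2_def)
    have "?N $$ (c, c) \<noteq> ?N $$ (c, c2)" using c c12 neq k3 s1 by (auto simp: star_M_I_index)
    moreover have "?N $$ (c1, c) \<noteq> ?N $$ (c1, c2)" using c c12 neq k3 s1 by (auto simp: star_M_I_index)
    moreover have "?N $$ (c2, c) \<noteq> ?N $$ (c2, c2)" using c c12 neq k3 by (auto simp: star_M_I_index)
    moreover obtain h0 h1 h2 where h: "h0 < k" "h1 < k" "h2 < k" "f h0 = c" "f h1 = c1" "f h2 = c2"
      using fsurj[OF c] fsurj[OF c12(1)] fsurj[OF c12(2)] by blast
    ultimately have hj: "h0 = j \<or> Suc h0 mod k = j" "h1 = j \<or> Suc h1 mod k = j" "h2 = j \<or> Suc h2 mod k = j"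
      using col[OF c _ h(1,4)] col[OF c12(1) _ h(2,5)] col[OF c12(2) _ h(3,6)] by blast+
    have "h0 \<noteq> h1" "h0 \<noteq> h2" "h1 \<noteq> h2" using neq h by auto
    then show False using hj Suc_mod_inj[OF h(1,2)] Suc_mod_inj[OF h(1,3)] Suc_mod_inj[OF h(2,3)] by auto
  qed
  have gless: "g j < k" if "j < k" for j
    using g(2)[of j] inj_onD[OF g(1), of j k] gk that by (cases "g j = k") auto
  have b: "b ! i = a ! f i" if "i < k" for i
    using ent[OF that, of k] f(2)[OF that] gk that k3 by (simp add: star_M_I_index)
  have ent': "j = i \<or> j = Suc i mod k \<longleftrightarrow> g j = f i \<or> g j = Suc (f i) mod k" if "i < k" "j < k" for i j
  proof -
    have "?N $$ (i, j) \<longleftrightarrow> ?N $$ (f i, g j)" using ent[OF that(1), of j] b[OF that(1)] that(2) by auto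
    then show ?thesis
      using star_M_I_index[OF k3 that(1), of j] star_M_I_index[OF k3 f(2)[OF that(1)], of "g j"]
        that(2) gless[OF that(2)] by simp
  qed
  \<comment> \<open>Successive rows share column \<open>Suc i mod k\<close>, so their images share a
    column and are adjacent.\<close>
  have step: "f (Suc i mod k) = Suc (f i) mod k \<or> f i = Suc (f (Suc i mod k)) mod k" if i: "i < k" for i
  proof -
    let ?s = "Suc i mod k"
    have s: "?s < k" "?s \<noteq> i" using cyc[OF i] by auto
    have "f i \<noteq> f ?s" using inj_onD[OF f(1), of i ?s] s i by auto
    then show ?thesis
      using ent'[OF i s(1)] ent'[OF s(1) s(1)] Suc_mod_inj[OF f(2)[OF i] f(2)[OF s(1)]] by auto
  qed
  define up where "up i \<longleftrightarrow> f (Suc i mod k) = Suc (f i) mod k" for i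
  \<comment> \<open>By injectivity \<open>f\<close> cannot turn back, so its direction is the same
    everywhere.\<close>
  have up_step: "up (Suc i mod k) \<longleftrightarrow> up i" if i: "i < k" for i
  proof -
    let ?s = "Suc i mod k"
    let ?t = "Suc ?s mod k"
    have st: "?s < k" "?t < k" "?t \<noteq> i" using cyc[OF i] k3 by auto
    have "f ?t \<noteq> f i" using inj_onD[OF f(1), of ?t i] st i by auto
    then show ?thesis
      using step[OF i] step[OF st(1)] Suc_mod_inj[OF f(2)[OF st(2)] f(2)[OF i]] unfolding up_def by metis
  qed
  have up_all: "up i \<longleftrightarrow> up 0" if "i < k" for i
    using that
  proof (induction i)
    case (Suc i)
    then show ?case using up_step[of i] by simp
  qed simp
  show ?thesis
  proof (cases "up 0")
    case True
    have fi: "f i = (f 0 + i) mod k" if "i < k" for i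
      using that
    proof (induction i)
      case 0
      then show ?case using f(2)[of 0] by simp
    next
      case (Suc i)
      then have "f (Suc i) = Suc (f i) mod k" using up_all[of i] True by (simp add: up_def)
      then show ?case using Suc by (simp add: mod_Suc_eq)
    qed
    have "b = rotate (f 0) a"
    proof (rule nth_equalityI)
      fix i assume "i < length b"
      then have i: "i < k" using l by simp
      show "b ! i = rotate (f 0) a ! i" unfolding b[OF i] fi[OF i] using l i by (simp add: nth_rotate)
    qed (simp add: l)
    then show ?thesis using bracelet_equiv_rotate by simp
  next
    case False
    have fi: "f (k - 1 - i) = (f (k - 1) + i) mod k" if "i < k" for i
      using that
    proof (induction i)
      case 0
      then show ?case using f(2)[of "k - 1"] by simp
    next
      case (Suc i)
      have "k - 1 - Suc i < k" using Suc by simp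
      then have "f (k - 1 - Suc i) = Suc (f (Suc (k - 1 - Suc i) mod k)) mod k"
        using up_all[of "k - 1 - Suc i"] step[of "k - 1 - Suc i"] False by (simp add: up_def)
      moreover have "Suc (k - 1 - Suc i) mod k = k - 1 - i" using Suc by simp
      ultimately show ?case using Suc by (simp add: mod_Suc_eq)
    qed
    have "rev b = rotate (f (k - 1)) a"
    proof (rule nth_equalityI)
      fix i assume "i < length (rev b)"
      then have i: "i < k" using l by simp
      then have "rev b ! i = a ! f (k - 1 - i)" using b[of "k - 1 - i"] l by (simp add: rev_nth)
      then show "rev b ! i = rotate (f (k - 1)) a ! i" unfolding fi[OF i] using l i by (simp add: nth_rotate)
    qed (simp add: l)
    then have "bracelet_equiv a (rev b)" using bracelet_equiv_rotate by metis
    moreover have "bracelet_equiv (rev b) b" using bracelet_equiv_rev[of "rev b"] by simp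
    ultimately show ?thesis unfolding bracelet_equiv_def by (rule equivclp_trans)
  qed
qed

text \<open>For k = 3, passing from one constant flip to the other would map the zero column to a
  column of \<open>M_I(3)*\<close> with three ones, but columns have at most two. For larger k,
  equivalent bracelets coincide by antisymmetry of the order.\<close>

lemma flip_star_M_I_unique:
  assumes k: "3 \<le> k" and ab: "a \<in> bracelets k" "b \<in> bracelets k"
    and e: "embeds f g (\<lambda>_. False) (flip_rows a (star_mat (M_I k))) (flip_rows b (star_mat (M_I k)))"
  shows "a = b"
proof (cases "k = 3")
  case True
  let ?N = "star_mat (M_I 3)"
  have no: False if "embeds f g (\<lambda>_. False) (flip_rows [c, c, c] ?N) (flip_rows [\<not> c, \<not> c, \<not> c] ?N)" for f g c
  proof -
    have c3: "[c, c, c] ! i = c" if "i < 3" for i and c :: bool using that unfolding less_3_iff by auto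
    have fg: "f i < 3" "g j < 4" if "i < 3" "j < 4" for i j
      using \<open>embeds f g _ _ _\<close> that unfolding embeds_def by auto
    have ent: "?N $$ (i, j) \<longleftrightarrow> \<not> ?N $$ (f i, g j)" if ij: "i < 3" "j < 4" for i j
    proof -
      have "flip_rows [\<not> c, \<not> c, \<not> c] ?N $$ (i, j) \<longleftrightarrow> flip_rows [c, c, c] ?N $$ (f i, g j)"
        using \<open>embeds f g _ _ _\<close> ij unfolding embeds_def by simp
      then have "(?N $$ (i, j) \<noteq> (\<not> c)) \<longleftrightarrow> (?N $$ (f i, g j) \<noteq> c)"
        using ij fg[OF ij] c3[OF ij(1), of "\<not> c"] c3[OF fg(1)[OF ij], of c] by (simp add: flip_rows_index)
      then show ?thesis by blast
    qed
    have "inj_on f {..<3}" using \<open>embeds f g _ _ _\<close> unfolding embeds_def by auto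
    then have f: "f 0 \<noteq> f 1" "f 1 \<noteq> f 2" "f 0 \<noteq> f 2" 
      using inj_onD[of f "{..<3}" 0 1] inj_onD[of f "{..<3}" 1 2] inj_onD[of f "{..<3}" 0 2] by auto
    have N: "?N $$ (f i, g 3)" if "i < 3" for i using ent[OF that, of 3] that by (simp add: star_M_I_index)
    have "g 3 < 3 \<and> (g 3 = f i \<or> g 3 = Suc (f i) mod 3)" if "i < 3" for i
      using N[OF that] fg[OF that, of 3] star_M_I_index[of 3 "f i" "g 3"] by simp
    from this[of 0] this[of 1] this[of 2] show False
      using f Suc_mod_inj[of "f 0" 3 "f 1"] Suc_mod_inj[of "f 1" 3 "f 2"] Suc_mod_inj[of "f 0" 3 "f 2"]
        fg[of 0 0] fg[of 1 0] fg[of 2 0] by auto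
  qed
  show ?thesis
    using no[of f g True] no[of f g False] ab e True by (auto simp: bracelets_def)
next
  case False
  then have "length a = k" "length b = k" "bracelet a" "bracelet b" "4 \<le> k"
    using ab k by (auto simp: bracelets_def)
  moreover from this have "bracelet_equiv a b" using flip_star_M_I_bracelet_equiv e by blast
  moreover from this have "bracelet_equiv b a" unfolding bracelet_equiv_def by (rule equivclp_sym)
  ultimately show ?thesis unfolding bracelet_def by (meson lexordp_eq_antisym)
qed

text \<open>An invariant of configurations of equal size that tells the four 4 x 6 matrices
  apart.\<close>

definition ones :: "bool mat \<Rightarrow> nat" where
  "ones M = (\<Sum>i<dim_row M. card (row_ones M i))"

lemma ones_embeds:
  assumes e: "embeds f g (\<lambda>_. False) M N" and d: "dim_row M = dim_row N" "dim_col M = dim_col N"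
  shows "ones M = ones N"
proof -
  have f: "inj_on f {..<dim_row N}" "f ` {..<dim_row N} \<subseteq> {..<dim_row N}"
    and g: "inj_on g {..<dim_col N}" "g ` {..<dim_col N} \<subseteq> {..<dim_col N}"
    using e d unfolding embeds_def by auto
  have fs: "f ` {..<dim_row N} = {..<dim_row N}" by (rule endo_inj_surj[OF _ f(2,1)]) simp
  have gs: "g ` {..<dim_col N} = {..<dim_col N}" by (rule endo_inj_surj[OF _ g(2,1)]) simp
  have "card (row_ones M (f i)) = card (row_ones N i)" if "i < dim_row N" for i
  proof -
    have "row_ones M (f i) = g ` row_ones N i"
    proof (intro Set.set_eqI iffI)
      fix x assume x: "x \<in> row_ones M (f i)"
      then have "x \<in> g ` {..<dim_col N}" using gs d by (simp add: row_ones_def)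
      then obtain j where "j < dim_col N" "x = g j" by auto
      then show "x \<in> g ` row_ones N i" using x e that by (auto simp: row_ones_def embeds_def)
    next
      fix x assume "x \<in> g ` row_ones N i"
      then show "x \<in> row_ones M (f i)" using e that by (auto simp: row_ones_def embeds_def)
    qed
    moreover have "inj_on g (row_ones N i)" using g(1) row_ones_subset inj_on_subset by blast
    ultimately show ?thesis by (simp add: card_image)
  qed
  moreover have "(\<Sum>i<dim_row N. card (row_ones M i)) = (\<Sum>i<dim_row N. card (row_ones M (f i)))"
    using sum.reindex[OF f(1), of "\<lambda>i. card (row_ones M i)"] fs by simp
  ultimately show ?thesis unfolding ones_def d(1) by simp
qed

lemma compl_mat_dim [simp]: "dim_row (compl_mat M) = dim_row M" "dim_col (compl_mat M) = dim_col M"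
  by (simp_all add: compl_mat_def)

lemma compl_mat_row_ones: "i < dim_row M \<Longrightarrow> row_ones (compl_mat M) i = {..<dim_col M} - row_ones M i"
  by (auto simp: row_ones_def compl_mat_def)

lemma star_M_V_row_ones:
  "row_ones (star_mat M_V) 0 = {0, 1}" "row_ones (star_mat M_V) (Suc 0) = {0, 1, 2, 3}"
  "row_ones (star_mat M_V) 2 = {2, 3}" "row_ones (star_mat M_V) 3 = {0, 3, 4}"
  unfolding row_ones_def by (auto simp: star_M_V_index)

lemma ones_special:
  "ones M_IV = 9" "ones (compl_mat M_IV) = 15"
  "ones (star_mat M_V) = 11" "ones (compl_mat (star_mat M_V)) = 13"
proof -
  have 4: "{..<4::nat} = {0, Suc 0, 2, 3}" by auto
  show "ones M_IV = 9" "ones (star_mat M_V) = 11"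
    by (simp_all add: ones_def 4 M_IV_row_ones star_M_V_row_ones)
  have "card ({..<6} - A) = 6 - card A" if "A \<subseteq> {..<6}" for A :: "nat set"
    using that by (simp add: card_Diff_subset finite_subset)
  then show "ones (compl_mat M_IV) = 15" "ones (compl_mat (star_mat M_V)) = 13"
    by (simp_all add: ones_def 4 compl_mat_row_ones M_IV_row_ones star_M_V_row_ones)
qed

section \<open>Uniqueness, minimality and completeness of the family\<close>

lemma F_Row_cases:
  assumes "F \<in> F_Row"
  obtains (cycle) k a where "3 \<le> k" "a \<in> bracelets k" "F = flip_rows a (star_mat (M_I k))"
  | (special) "F \<in> {M_IV, compl_mat M_IV, star_mat M_V, compl_mat (star_mat M_V)}"
  using assms unfolding F_Row_def by blast

text \<open>The flipped cycles have shape k x (k+1), which is never 4 x 6. Inside the two kinds,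
  bracelets and the number of ones decide.\<close>

lemma F_Row_unique:
  assumes F: "F \<in> F_Row" "F' \<in> F_Row" and e: "embeds f g (\<lambda>_. False) F F'"
    and d: "dim_row F = dim_row F'" "dim_col F = dim_col F'"
  shows "F = F'"
  using F(1)
proof (cases rule: F_Row_cases)
  case (cycle k a)
  note F1 = cycle
  from F(2) show ?thesis
  proof (cases rule: F_Row_cases)
    case (cycle k' a')
    then have "k' = k" using F1 d by simp
    then show ?thesis
      using cycle F1 e flip_star_M_I_unique[OF F1(1), of a a' f g] by simp
  next
    case special
    then show ?thesis using F1 d by auto
  qed
next
  case special
  note F1 = special
  from F(2) show ?thesis
  proof (cases rule: F_Row_cases)
    case (cycle k' a')
    then show ?thesis using F1 d by auto
  next
    case special
    then show ?thesis using F1 ones_embeds[OF e d] by (auto simp: ones_special)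
  qed
qed

lemma F_Row_minimal_noncircular:
  assumes "F \<in> F_Row"
  shows "minimal_noncircular F"
  using assms
proof (cases rule: F_Row_cases)
  case (cycle k a)
  have "embeds id id (\<lambda>_. False) (star_mat (M_I k)) (star_mat (M_I k))" by (simp add: embeds_def)
  then have "embeds id id ((!) a) (star_mat (M_I k)) F" unfolding cycle(3) by (rule embeds_flip_rows) simp
  then show ?thesis
    by (rule minimal_noncircular_embeds) (use cycle star_M_I_minimal_noncircular in auto)
next
  case special
  have id: "embeds id id (\<lambda>_. False) M_IV M_IV" by (simp add: embeds_def)
  \<comment> \<open>Flipping any single pair row would do; row 0 is chosen.\<close>
  obtain f g where V: "embeds f g (\<lambda>i. (\<lambda>j. j = 0) (f i)) M_IV (star_mat M_V)"
    using M_IV_embeds_star_M_V[of "\<lambda>j. j = 0"] by auto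
  have "\<exists>f g a. embeds f g a M_IV F"
    using special id embeds_compl[OF id] V embeds_compl[OF V] by blast
  then obtain f g a where "embeds f g a M_IV F" by blast
  then show ?thesis
    by (rule minimal_noncircular_embeds) (use special M_IV_minimal_noncircular in auto)
qed

lemma F_Row_complete:
  assumes "\<not> circular_ones M"
  shows "\<exists>F\<in>F_Row. contains_config M F"
proof -
  have final: "\<exists>F\<in>F_Row. contains_config M F"
    if e: "embeds f g a M N" and F: "\<exists>F\<in>F_Row. \<exists>f' g'. embeds f' g' (\<lambda>i. a (f' i)) N F" for f g a N
  proof -
    obtain F f' g' where F: "F \<in> F_Row" "embeds f' g' (\<lambda>i. a (f' i)) N F" using F by blast
    \<comment> \<open>Both embeddings carry the same flag \<open>a (f' i)\<close>, so the
      composition flips nothing.\<close>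
    have "embeds (f \<circ> f') (g \<circ> g') (\<lambda>_. False) M F" using embeds_trans[OF e F(2)] by simp
    then show ?thesis using F(1) contains_config_iff by blast
  qed
  from obstruction_if_not_circular assms
  have "has_cycle {..<dim_col M} (row_sets M) \<or> has_claw {..<dim_col M} (row_sets M)"
    by (simp add: circular_ones_iff)
  then show ?thesis
  proof
    assume "has_cycle {..<dim_col M} (row_sets M)"
    then obtain k f g a where k: "3 \<le> k" and e: "embeds f g a M (star_mat (M_I k))"
      using has_cycle_embeds by blast
    have "flip_rows b (star_mat (M_I k)) \<in> F_Row" if "b \<in> bracelets k" for b
      using that k unfolding F_Row_def by blast
    then show ?thesis using final[OF e] star_M_I_flips[OF k] by blast
  next
    assume "has_claw {..<dim_col M} (row_sets M)"
    then obtain f g a where e: "embeds f g a M M_IV" using has_claw_embeds by blast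
    have "{M_IV, compl_mat M_IV, star_mat M_V, compl_mat (star_mat M_V)} \<subseteq> F_Row"
      unfolding F_Row_def by blast
    then show ?thesis using final[OF e] M_IV_flips[of a] by blast
  qed
qed

lemma circular_ones_embeds:
  assumes "embeds f g a M N" "circular_ones M"
  shows "circular_ones N"
  using assms(2) unfolding circular_ones_iff
  by (rule circular_within_embeds[OF assms(1)]) (use assms(1) in \<open>auto simp: embeds_def\<close>)

text \<open>A row or column of \<open>N\<close> outside the image could be deleted, leaving a
  circular part that still contains \<open>P\<close>.\<close>

lemma minimal_noncircular_embeds_dim:
  assumes N: "minimal_noncircular N" and e: "embeds f g a N P" and P: "\<not> circular_ones P"
  shows "dim_row N = dim_row P" "dim_col N = dim_col P"
proof -
  have f: "f ` {..<dim_row P} \<subseteq> {..<dim_row N}" "inj_on f {..<dim_row P}"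
    and g: "g ` {..<dim_col P} \<subseteq> {..<dim_col N}" "inj_on g {..<dim_col P}"
    using e unfolding embeds_def by auto
  have "f ` {..<dim_row P} = {..<dim_row N}"
  proof (rule ccontr)
    assume "f ` {..<dim_row P} \<noteq> {..<dim_row N}"
    then obtain i where i: "i < dim_row N" "f ` {..<dim_row P} \<subseteq> {..<dim_row N} - {i}" using f by auto
    then have "circular_within N ({..<dim_row N} - {i}) {..<dim_col N}"
      using N unfolding minimal_noncircular_def by blast
    then have "circular_within P {..<dim_row P} {..<dim_col P}"
      by (rule circular_within_embeds[OF e]) (use i g in auto)
    then show False using P by (simp add: circular_ones_iff)
  qed
  then show "dim_row N = dim_row P" using card_image[OF f(2)] by simp
  have "g ` {..<dim_col P} = {..<dim_col N}"
  proof (rule ccontr)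
    assume "g ` {..<dim_col P} \<noteq> {..<dim_col N}"
    then obtain j where j: "j < dim_col N" "g ` {..<dim_col P} \<subseteq> {..<dim_col N} - {j}" using g by auto
    then have "circular_within N {..<dim_row N} ({..<dim_col N} - {j})"
      using N unfolding minimal_noncircular_def by blast
    then have "circular_within P {..<dim_row P} {..<dim_col P}"
      by (rule circular_within_embeds[OF e]) (use j f in auto)
    then show False using P by (simp add: circular_ones_iff)
  qed
  then show "dim_col N = dim_col P" using card_image[OF g(2)] by simp
qed

theorem theorem6:
  shows "(\<forall>M. circular_ones M \<longleftrightarrow> \<not> (\<exists>F\<in>F_Row. contains_config M F)) \<and>
    (\<forall>G. G \<subset> F_Row \<longrightarrow> \<not> characterizes_circular_ones G) \<and>
    (\<forall>F\<in>F_Row. minimal_forbidden F)"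
proof (intro conjI allI impI ballI)
  have not_circ: "\<not> circular_ones F" if "F \<in> F_Row" for F
    using F_Row_minimal_noncircular[OF that] unfolding minimal_noncircular_def circular_ones_iff by blast
  show "circular_ones M \<longleftrightarrow> \<not> (\<exists>F\<in>F_Row. contains_config M F)" for M
    using not_circ circular_ones_embeds F_Row_complete[of M] unfolding contains_config_iff by blast
  show "minimal_forbidden F" if "F \<in> F_Row" for F
    using F_Row_minimal_noncircular[OF that] by (rule minimal_forbidden_if_noncircular)
  fix G assume G: "G \<subset> F_Row"
  show "\<not> characterizes_circular_ones G"
  proof
    assume char: "characterizes_circular_ones G"
    obtain F where F: "F \<in> F_Row" "F \<notin> G" using G by blast
    \<comment> \<open>The omitted \<open>F\<close> is not circular, so \<open>G\<close> must have a
      member inside \<open>F\<close>; minimality of \<open>F\<close> gives it the same size, and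
      uniqueness makes it \<open>F\<close>.\<close>
    obtain F' where F': "F' \<in> G" "contains_config F F'"
      using char not_circ[OF F(1)] unfolding characterizes_circular_ones_def by blast
    then obtain f g where e: "embeds f g (\<lambda>_. False) F F'" unfolding contains_config_iff by blast
    have "F' \<in> F_Row" using F'(1) G by blast
    then have "F = F'"
      using F_Row_unique[OF F(1) _ e]
        minimal_noncircular_embeds_dim[OF F_Row_minimal_noncircular[OF F(1)] e not_circ] by blast
    then show False using F F' by blast
  qed
qed

end
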